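(* Let $\mathcal W=\mathcal W_2\boxtimes\mathcal W_k$ be a $(k+2)$-web in $(\mathbb C^2,0)$, with $\mathcal W_2$ a $2$-web and $\mathcal W_k$ a $k$-web ($k\ge1$), such that $\Delta(\mathcal W_2)=\Delta(\mathcal W)$ is smooth and invariant by $\mathcal W_2$. Then any deformation $\mathcal W^{\varepsilon}$ of $\mathcal W$ having holomorphic curvature is of the form $\mathcal W^{\varepsilon}=\mathcal W_2^{\varepsilon}\boxtimes\mathcal W_k^{\varepsilon}$ (with $\mathcal W_2^\varepsilon$ a $2$-web and $\mathcal W_k^\varepsilon$ a $k$-web) with $\Delta(\mathcal W_2^{\varepsilon})=\Delta(\mathcal W^{\varepsilon})$ invariant by $\mathcal W_2^{\varepsilon}$.
   Context: **Webs.** A (germ of) $k$-web on a complex surface is given locally by a holomorphic $k$-symmetric $1$-form $\omega=\sum_{i+j=k}a_{ij}(x,y)dx^i dy^j$ with isolated zeros and with discriminant (of $\omega$ as a binary form in $dx,dy$) not identically zero; forms differing by a unit define the same web. $\Delta(\mathcal W)$ is the divisor of zeros of this discriminant. $\mathcal W\boxtimes\mathcal W'$ is the superposition of webs, defined by the product of the symmetric forms. A $1$-web is a foliation. A deformation $\mathcal W^\varepsilon$ of $\mathcal W$ is an analytic family of webs, $\varepsilon\in(\mathbb C,0)$, with $\mathcal W^0=\mathcal W$. **Invariance.** A curve $C$ is invariant by $\mathcal W$ if $TC\subset T\mathcal W|_C$ over the regular part of $C$, i.e. $T_pC$ is one of the tangent lines of $\mathcal W$ at $p$. For a divisor, invariance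 means invariance of its support. **Curvature.** For a completely decomposable web $\mathcal W=\mathcal F_1\boxtimes\cdots\boxtimes\mathcal F_k$ with foliations $\mathcal F_i$ defined by $1$-forms $\omega_i$ with isolated singularities, put $\omega_i\wedge\omega_j=\delta_{ij}\,dx\wedge dy$. For $r<s<t$ let $\eta_{rst}$ be the unique meromorphic $1$-form with $d(\delta_{st}\omega_r)=\eta_{rst}\wedge\delta_{st}\omega_r$, $d(\delta_{tr}\omega_s)=\eta_{rst}\wedge\delta_{tr}\omega_s$, $d(\delta_{rs}\omega_t)=\eta_{rst}\wedge\delta_{rs}\omega_t$. The curvature is $K(\mathcal W)=d\sum_{r<s<t}\eta_{rst}$, a meromorphic $2$-form independent of choices, with poles contained in $\Delta(\mathcal W)$. For an arbitrary web, one passes to a ramified Galois covering on which the web is completely decomposable; the curvature there is Galois invariant and descends to a meromorphic $2$-form $K(\mathcal W)$. *)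

theory Defs
  imports "HOL-Complex_Analysis.Complex_Analysis" "Subresultants.Resultant_Prelim"
begin

hide_const (open) Determinants.det Module.smult

type_synonym point = "complex \<times> complex"

text \<open>Holomorphy in several variables means complex differentiability on an open set.
  The product types carry no complex scalar multiplication in the library, so the complex linearity
  of the derivative is written out.\<close>

definition holo2 :: "(point \<Rightarrow> complex) \<Rightarrow> point set \<Rightarrow> bool" where
  "holo2 f U \<longleftrightarrow> open U \<and>
     (\<forall>p\<in>U. \<exists>a b. (f has_derivative (\<lambda>v. a * fst v + b * snd v)) (at p))"

definition holo3 :: "(complex \<times> point \<Rightarrow> complex) \<Rightarrow> (complex \<times> point) set \<Rightarrow> bool" where
  "holo3 f S \<longleftrightarrow> open S \<and>
     (\<forall>p\<in>S. \<exists>a b c. (f has_derivative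
        (\<lambda>v. a * fst v + b * fst (snd v) + c * snd (snd v))) (at p))"

definition unit_on :: "point set \<Rightarrow> (point \<Rightarrow> complex) \<Rightarrow> bool" where
  "unit_on U u \<longleftrightarrow> holo2 u U \<and> (\<forall>p\<in>U. u p \<noteq> 0)"

definition pdx :: "(point \<Rightarrow> complex) \<Rightarrow> point \<Rightarrow> complex" where
  "pdx f p = deriv (\<lambda>x. f (x, snd p)) (fst p)"

definition pdy :: "(point \<Rightarrow> complex) \<Rightarrow> point \<Rightarrow> complex" where
  "pdy f p = deriv (\<lambda>y. f (fst p, y)) (snd p)"


text \<open>A binary form \<open>\<Sum>i\<le>k. a i * dx^i * dy^(k-i)\<close> of formal degree \<open>k\<close> is
  encoded by the polynomial of degree at most \<open>k\<close> with coefficients \<open>a i\<close>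
  (that is, \<open>dy\<close> is set to 1), so that the product of forms is the product of polynomials.
  The formal degree has to be carried along: powers of \<open>dy\<close> that divide the form are
  invisible in the polynomial.  In particular a 1-form \<open>a dx + b dy\<close> is \<open>[:b, a:]\<close>.\<close>

type_synonym sform = "point \<Rightarrow> complex poly"

definition form_eval :: "nat \<Rightarrow> complex poly \<Rightarrow> complex \<times> complex \<Rightarrow> complex" where
  "form_eval k P v = (\<Sum>i\<le>k. coeff P i * fst v ^ i * snd v ^ (k - i))"

text \<open>The discriminant of the binary form, as the resultant of its two partial derivatives (binary
  forms of formal degree \<open>k - 1\<close>).  It differs from other normalisations by a nonzero
  constant, which does not affect the divisor; it is 1 for \<open>k = 1\<close>
  and \<open>4ac - b^2\<close> for \<open>a dx^2 + b dx dy + c dy^2\<close>.\<close>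

definition form_disc :: "nat \<Rightarrow> complex poly \<Rightarrow> complex" where
  "form_disc k P = Determinant.det
     (sylvester_mat_sub (k - 1) (k - 1) (pderiv P)
        (\<Sum>i<k. monom (of_nat (k - i) * coeff P i) i))"

definition sform_on :: "point set \<Rightarrow> nat \<Rightarrow> sform \<Rightarrow> bool" where
  "sform_on U k \<omega> \<longleftrightarrow> (\<forall>p\<in>U. degree (\<omega> p) \<le> k) \<and> (\<forall>i\<le>k. holo2 (\<lambda>p. coeff (\<omega> p) i) U)"

definition web_disc :: "nat \<Rightarrow> sform \<Rightarrow> point \<Rightarrow> complex" where
  "web_disc k \<omega> p = form_disc k (\<omega> p)"

text \<open>As \<open>U\<close> need not be connected, the discriminant is required not to vanish identically
  on any nonempty open subset.\<close>

definition web_on :: "point set \<Rightarrow> nat \<Rightarrow> sform \<Rightarrow> bool" where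
  "web_on U k \<omega> \<longleftrightarrow> open U \<and> sform_on U k \<omega>
     \<and> (\<forall>p\<in>U. \<forall>\<^sub>F q in at p. \<omega> q \<noteq> 0)
     \<and> (\<forall>V. open V \<and> V \<noteq> {} \<and> V \<subseteq> U \<longrightarrow> (\<exists>p\<in>V. web_disc k \<omega> p \<noteq> 0))"

definition same_web :: "point set \<Rightarrow> sform \<Rightarrow> sform \<Rightarrow> bool" where
  "same_web U \<omega> \<omega>' \<longleftrightarrow> (\<exists>u. unit_on U u \<and> (\<forall>p\<in>U. \<omega> p = smult (u p) (\<omega>' p)))"

definition superpose :: "sform \<Rightarrow> sform \<Rightarrow> sform" (infixl "\<boxtimes>" 70) where
  "(\<omega> \<boxtimes> \<omega>') p = \<omega> p * \<omega>' p"


text \<open>The zero divisor of a holomorphic function is given by the function itself as equation;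
  equality of divisors is equality of equations up to a unit.  A divisor is smooth when
  its equation has nonzero differential along its support (so it is reduced, with smooth support,
  possibly empty).\<close>

definition same_divisor :: "point set \<Rightarrow> (point \<Rightarrow> complex) \<Rightarrow> (point \<Rightarrow> complex) \<Rightarrow> bool" where
  "same_divisor U f g \<longleftrightarrow> (\<exists>u. unit_on U u \<and> (\<forall>p\<in>U. f p = u p * g p))"

definition smooth_divisor :: "point set \<Rightarrow> (point \<Rightarrow> complex) \<Rightarrow> bool" where
  "smooth_divisor U f \<longleftrightarrow> (\<forall>p\<in>U. f p = 0 \<longrightarrow> pdx f p \<noteq> 0 \<or> pdy f p \<noteq> 0)"

text \<open>At a regular point \<open>p\<close> of the curve \<open>C\<close>, with local equation
  \<open>g = 0\<close> where \<open>dg\<close> is nonzero at \<open>p\<close>, the tangent line is spanned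
  by \<open>(- pdy g p, pdx g p)\<close>.\<close>

definition invariant_curve :: "nat \<Rightarrow> sform \<Rightarrow> point set \<Rightarrow> bool" where
  "invariant_curve k \<omega> C \<longleftrightarrow>
     (\<forall>p\<in>C. \<forall>V g. p \<in> V \<and> holo2 g V \<and> C \<inter> V = {q\<in>V. g q = 0} \<and> (pdx g p \<noteq> 0 \<or> pdy g p \<noteq> 0)
        \<longrightarrow> form_eval k (\<omega> p) (- pdy g p, pdx g p) = 0)"

definition invariant_divisor :: "point set \<Rightarrow> nat \<Rightarrow> sform \<Rightarrow> (point \<Rightarrow> complex) \<Rightarrow> bool" where
  "invariant_divisor U k \<omega> f \<longleftrightarrow> invariant_curve k \<omega> {p\<in>U. f p = 0}"


text \<open>Operations on 1-forms; 2-forms are given by their coefficient of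
  \<open>dx \<and> dy\<close>.\<close>

definition wedge :: "complex poly \<Rightarrow> complex poly \<Rightarrow> complex" where
  "wedge A B = coeff A 1 * coeff B 0 - coeff A 0 * coeff B 1"

definition ext_d :: "sform \<Rightarrow> point \<Rightarrow> complex" where
  "ext_d \<alpha> p = pdx (\<lambda>q. coeff (\<alpha> q) 0) p - pdy (\<lambda>q. coeff (\<alpha> q) 1) p"

definition scaled :: "sform \<Rightarrow> sform \<Rightarrow> sform \<Rightarrow> sform" where
  "scaled \<alpha> \<beta> \<gamma> p = smult (wedge (\<alpha> p) (\<beta> p)) (\<gamma> p)"

text \<open>Where the three foliations are pairwise transverse, the three equations are linear in the
  value of the 1-form at \<open>p\<close> and determine it; so the unique meromorphic 1-form
  satisfying them is defined pointwise, off its poles.\<close>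

definition eta :: "sform \<Rightarrow> sform \<Rightarrow> sform \<Rightarrow> sform" where
  "eta \<omega>r \<omega>s \<omega>t p = (THE h. degree h \<le> 1 \<and>
     ext_d (scaled \<omega>s \<omega>t \<omega>r) p = wedge h (scaled \<omega>s \<omega>t \<omega>r p) \<and>
     ext_d (scaled \<omega>t \<omega>r \<omega>s) p = wedge h (scaled \<omega>t \<omega>r \<omega>s p) \<and>
     ext_d (scaled \<omega>r \<omega>s \<omega>t) p = wedge h (scaled \<omega>r \<omega>s \<omega>t p))"

definition decomposed_curvature :: "nat \<Rightarrow> (nat \<Rightarrow> sform) \<Rightarrow> point \<Rightarrow> complex" where
  "decomposed_curvature k L =
     ext_d (\<lambda>p. \<Sum>t<k. \<Sum>s<t. \<Sum>r<s. eta (L r) (L s) (L t) p)"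

definition jacobian :: "(point \<Rightarrow> point) \<Rightarrow> point \<Rightarrow> complex" where
  "jacobian \<phi> q = pdx (fst \<circ> \<phi>) q * pdy (snd \<circ> \<phi>) q - pdy (fst \<circ> \<phi>) q * pdx (snd \<circ> \<phi>) q"

definition pullback :: "nat \<Rightarrow> (point \<Rightarrow> point) \<Rightarrow> sform \<Rightarrow> sform" where
  "pullback k \<phi> \<omega> q = (\<Sum>i\<le>k. smult (coeff (\<omega> (\<phi> q)) i)
     ([:pdy (fst \<circ> \<phi>) q, pdx (fst \<circ> \<phi>) q:] ^ i *
      [:pdy (snd \<circ> \<phi>) q, pdx (snd \<circ> \<phi>) q:] ^ (k - i)))"

text \<open>\<open>\<phi>\<close> is a coordinate chart \<open>V\<close> of a (possibly ramified) covering
  of \<open>U\<close>, followed by the covering map, and the web pulled back to \<open>V\<close> is the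
  superposition of the foliations \<open>L i\<close>.  The factor \<open>g\<close> is needed because
  the pulled back symmetric form may vanish along the ramification: under \<open>y = t^2\<close> the form
  \<open>dy^2 - y dx^2\<close> becomes \<open>t^2 (4 dt^2 - dx^2)\<close>.\<close>

definition decomposing_chart ::
    "point set \<Rightarrow> nat \<Rightarrow> sform \<Rightarrow> point set \<Rightarrow> (point \<Rightarrow> point) \<Rightarrow> (nat \<Rightarrow> sform) \<Rightarrow> bool" where
  "decomposing_chart U k \<omega> V \<phi> L \<longleftrightarrow>
     holo2 (fst \<circ> \<phi>) V \<and> holo2 (snd \<circ> \<phi>) V \<and> \<phi> ` V \<subseteq> U \<and>
     (\<forall>A. open A \<and> A \<noteq> {} \<and> A \<subseteq> V \<longrightarrow> (\<exists>q\<in>A. jacobian \<phi> q \<noteq> 0)) \<and>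
     (\<forall>i<k. web_on V 1 (L i)) \<and>
     (\<exists>g. holo2 g V \<and> (\<forall>q\<in>V. pullback k \<phi> \<omega> q = smult (g q) (\<Prod>i<k. L i q)))"

text \<open>\<open>\<kappa> dx \<and> dy\<close> is the curvature of the web when its pullback to every chart
  of a covering decomposing the web is the curvature upstairs.  Only values off the discriminant
  and off the ramification are compared.  They determine the meromorphic form, whose
  poles lie in the discriminant: off it the web is decomposable locally on \<open>U\<close> itself, so the
  inclusions of small open sets already are such charts, and
  they determine \<open>\<kappa>\<close> there.\<close>

definition is_curvature :: "point set \<Rightarrow> nat \<Rightarrow> sform \<Rightarrow> (point \<Rightarrow> complex) \<Rightarrow> bool" where
  "is_curvature U k \<omega> \<kappa> \<longleftrightarrow>
     (\<forall>V \<phi> L. decomposing_chart U k \<omega> V \<phi> L \<longrightarrow>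
        (\<forall>q\<in>V. jacobian \<phi> q \<noteq> 0 \<and> web_disc k \<omega> (\<phi> q) \<noteq> 0 \<longrightarrow>
           \<kappa> (\<phi> q) * jacobian \<phi> q = decomposed_curvature k L q))"

definition holomorphic_curvature :: "point set \<Rightarrow> nat \<Rightarrow> sform \<Rightarrow> bool" where
  "holomorphic_curvature U k \<omega> \<longleftrightarrow> (\<exists>\<kappa>. holo2 \<kappa> U \<and> is_curvature U k \<omega> \<kappa>)"


definition deformation_on ::
    "complex set \<Rightarrow> point set \<Rightarrow> nat \<Rightarrow> (complex \<Rightarrow> sform) \<Rightarrow> sform \<Rightarrow> bool" where
  "deformation_on E U k \<Omega> \<omega> \<longleftrightarrow> open E \<and> 0 \<in> E \<and>
     (\<forall>i\<le>k. holo3 (\<lambda>z. coeff (\<Omega> (fst z) (snd z)) i) (E \<times> U)) \<and>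
     (\<forall>\<epsilon>\<in>E. web_on U k (\<Omega> \<epsilon>)) \<and> same_web U (\<Omega> 0) \<omega>"

end

theory Submission
  imports Defs "HOL-Computational_Algebra.Fundamental_Theorem_Algebra"
begin

text \<open>
  At the origin the hypothesis on the discriminants makes \<open>\<omega>\<^sub>2\<close> and \<open>\<omega>\<^sub>k\<close> coprime and
  \<open>\<omega>\<^sub>k\<close> squarefree, since the discriminant of a product is the product of the discriminants and the
  squared resultant.  Hence the deformation factors as a quadratic form times \<open>k\<close> linear forms,
  with slopes \<open>a \<plusminus> s\<close>, \<open>s\<^sup>2 = h\<close>, and \<open>t\<^sub>i\<close>, and its discriminant is a unit times \<open>h\<close>.

  In the sum of the 1-forms \<open>\<eta>\<close> over all triples the terms that are odd in \<open>s\<close> cancel.  Only the triples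
  \<open>(a + s, a - s, t\<^sub>i)\<close> leave a pole along \<open>h = 0\<close>, and its residue shows that holomorphic
  curvature forces \<open>Z J = 0\<close> on \<open>h = 0\<close>.  Here \<open>Z = 0\<close> says that the curve is
  invariant by the quadratic factor and \<open>J = 0\<close> that it is invariant by the barycentre of the other
  foliations with respect to the double direction.  At parameter 0 the curve is invariant by
  \<open>\<omega>\<^sub>2\<close>, so it is transverse to the barycentre and \<open>J\<close> does not vanish; by
  continuity \<open>J \<noteq> 0\<close> near the origin for small parameters, and therefore \<open>Z = 0\<close> there.
\<close>

section \<open>Discriminants of binary forms\<close>

text \<open>The slopes \<open>a \<plusminus> s\<close> are multivalued along \<open>h = 0\<close>,
  exactly where the curvature has to be examined. The argument therefore works with
  \<open>a\<close>, \<open>h\<close> and the simple slopes \<open>t i\<close>, which are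
  holomorphic, and uses a branch \<open>s\<close> only on small sets off \<open>h = 0\<close>. There
  the sum of all \<eta> is \<open>(N dx + M (dy - c dx)) / h\<close>, where \<open>N\<close> and
  \<open>M\<close> do not involve \<open>s\<close> and are holomorphic through \<open>h = 0\<close>.
  Its differential times \<open>h\<^sup>2\<close> gives an identity that extends to
  \<open>h = 0\<close> by continuity. On that curve \<open>M = a N\<close> and
  \<open>2 N = J\<close>, and what is left of the identity is \<open>N Z = 0\<close>. The constant
  \<open>c\<close> fixes a direction \<open>(1, c)\<close> tangent to no foliation at the origin, so
  that all slopes are finite near it. The parameter is frozen in the curvature computation; joint
  holomorphy serves the factorization and the continuity of \<open>J\<close>. As leading
  coefficients may vanish and roots may coincide, the discriminant formulas are proved for generic
  roots and extended by continuity.\<close>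

lemma det_vandermonde_nonzero:
  fixes z :: "nat \<Rightarrow> complex"
  assumes inj: "inj_on z {..<d}"
  shows "Determinant.det (Matrix.mat d d (\<lambda>(i, j). z j ^ (d - 1 - i))) \<noteq> 0" (is "Determinant.det ?V \<noteq> 0")
proof
  assume "Determinant.det ?V = 0"
  then have "Determinant.det (transpose_mat ?V) = 0"
    by (subst Determinant.det_transpose[of _ d]) auto
  then obtain v where v: "v \<in> carrier_vec d" "v \<noteq> 0\<^sub>v d" "transpose_mat ?V *\<^sub>v v = 0\<^sub>v d"
    by (subst (asm) det_0_iff_vec_prod_zero[of _ d]) auto
  \<comment> \<open>A kernel vector of the transpose is the coefficient list, highest power first,
    of a polynomial of degree below \<open>d\<close> that vanishes at the \<open>d\<close> distinct
    points \<open>z j\<close>.\<close>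
  define p where "p = (\<Sum>i<d. monom (vec_index v i) (d - 1 - i))"
  have roots: "poly p (z j) = 0" if "j < d" for j
  proof -
    have "vec_index (transpose_mat ?V *\<^sub>v v) j = (\<Sum>i<d. z j ^ (d - 1 - i) * vec_index v i)"
      using that v(1) by (auto simp: scalar_prod_def lessThan_atLeast0)
    with v(3) that show ?thesis
      by (simp add: p_def poly_sum poly_monom mult.commute)
  qed
  have cf: "coeff p (d - 1 - i) = vec_index v i" if "i < d" for i
  proof -
    have "coeff p (d - 1 - i) = (\<Sum>j<d. if j = i then vec_index v j else 0)"
      unfolding p_def coeff_sum by (rule sum.cong) (use that in auto)
    with that show ?thesis by simp
  qed
  have "p \<noteq> 0"
  proof
    assume "p = 0"
    with cf have "v = 0\<^sub>v d" using v(1) by (intro eq_vecI) auto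
    with v(2) show False by blast
  qed
  have "degree p \<le> d - 1"
    unfolding p_def by (intro degree_sum_le) (auto intro: order_trans[OF degree_monom_le])
  have "z ` {..<d} \<subseteq> {x. poly p x = 0}" using roots by auto
  then have "card (z ` {..<d}) \<le> card {x. poly p x = 0}"
    using poly_roots_finite[OF \<open>p \<noteq> 0\<close>] by (intro card_mono) auto
  also have "\<dots> \<le> degree p" using card_poly_roots_bound[OF \<open>p \<noteq> 0\<close>] .
  finally have "d \<le> d - 1" using inj \<open>degree p \<le> d - 1\<close> by (simp add: card_image)
  then have "d = 0" by simp
  with v show False by auto
qed

text \<open>The rows of the Sylvester matrix are the coefficient lists of X^(n-1-i) f and
  X^(m+n-1-i) q, highest power first; the Vandermonde matrix evaluates them at the points
  \<open>z j\<close>.\<close>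

lemma sylvester_mat_times_vandermonde:
  fixes z :: "nat \<Rightarrow> complex"
  assumes "degree f \<le> m" "degree q \<le> n"
  shows "sylvester_mat_sub m n f q * Matrix.mat (m + n) (m + n) (\<lambda>(i, j). z j ^ (m + n - 1 - i)) =
    Matrix.mat (m + n) (m + n) (\<lambda>(i, j). if i < n then z j ^ (n - 1 - i) * poly f (z j)
      else z j ^ (m + n - 1 - i) * poly q (z j))" (is "?S * ?V = ?R")
proof (rule eq_matI)
  fix i j assume "i < dim_row ?R" "j < dim_col ?R"
  then have ij: "i < m + n" "j < m + n" by auto
  have e: "(?S * ?V) $$ (i, j) = (\<Sum>l<m+n. ?S $$ (i, l) * z j ^ (m + n - 1 - l))"
    using ij by (simp add: scalar_prod_def lessThan_atLeast0)
  show "(?S * ?V) $$ (i, j) = ?R $$ (i, j)"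
  proof (cases "i < n")
    case True
    have "(\<Sum>l<m+n. ?S $$ (i, l) * z j ^ (m + n - 1 - l)) =
      (\<Sum>l\<in>{i..i+m}. coeff f (m + i - l) * z j ^ (m + n - 1 - l))"
      by (rule sum.mono_neutral_cong_right)
        (use True ij in \<open>auto simp: sylvester_mat_sub_index\<close>)
    also have "\<dots> = (\<Sum>r\<le>m. coeff f r * z j ^ (n - 1 - i + r))"
      by (rule sum.reindex_bij_witness[of _ "\<lambda>r. m + i - r" "\<lambda>l. m + i - l"])
        (use True in \<open>auto intro!: arg_cong[where f = "\<lambda>n. _ ^ n"]\<close>)
    also have "\<dots> = z j ^ (n - 1 - i) * poly f (z j)"
      by (subst poly_altdef, subst sum.mono_neutral_right[of "{..m}" "{..degree f}"])
        (use assms in \<open>auto simp: sum_distrib_left power_add mult_ac coeff_eq_0\<close>)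
    finally show ?thesis using e True ij by simp
  next
    case False
    have "(\<Sum>l<m+n. ?S $$ (i, l) * z j ^ (m + n - 1 - l)) =
      (\<Sum>l\<in>{i-n..i}. coeff q (i - l) * z j ^ (m + n - 1 - l))"
      by (rule sum.mono_neutral_cong_right)
        (use False ij in \<open>auto simp: sylvester_mat_sub_index\<close>)
    also have "\<dots> = (\<Sum>r\<le>n. coeff q r * z j ^ (m + n - 1 - i + r))"
      by (rule sum.reindex_bij_witness[of _ "\<lambda>r. i - r" "\<lambda>l. i - l"])
        (use False ij in \<open>auto intro!: arg_cong[where f = "\<lambda>n. _ ^ n"]\<close>)
    also have "\<dots> = z j ^ (m + n - 1 - i) * poly q (z j)"
      by (subst poly_altdef, subst sum.mono_neutral_right[of "{..n}" "{..degree q}"])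
        (use assms in \<open>auto simp: sum_distrib_left power_add mult_ac coeff_eq_0\<close>)
    finally show ?thesis using e False ij by simp
  qed
qed auto

text \<open>Multiplying by a Vandermonde matrix makes the Sylvester matrix block triangular; comparison with the
  constant \<open>q = 1\<close>, whose Sylvester determinant is \<open>l ^ n\<close>, cancels the Vandermonde
  factors.\<close>

lemma resultant_roots_distinct:
  fixes \<xi> :: "nat \<Rightarrow> complex"
  assumes inj: "inj_on \<xi> {..<m}" and q: "degree q \<le> n"
  shows "Determinant.det (sylvester_mat_sub m n (smult l (\<Prod>j<m. [:- \<xi> j, 1:])) q)
    = l ^ n * (\<Prod>j<m. poly q (\<xi> j))"
proof -
  define f where "f = smult l (\<Prod>j<m. [:- \<xi> j, 1:])"
  have deg: "degree (\<Prod>j<m. [:- \<xi> j, 1:]) = m" by (simp add: degree_prod_eq_sum_degree)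
  moreover have "lead_coeff (\<Prod>j<m. [:- \<xi> j, 1:]) = 1" by (simp only: lead_coeff_prod) simp
  ultimately have "coeff (\<Prod>j<m. [:- \<xi> j, 1:]) m = 1" by simp
  with deg have f: "degree f \<le> m" "coeff f m = l" by (auto simp: f_def intro: order_trans[OF degree_smult_le])
  have fx: "poly f (\<xi> j) = 0" if "j < m" for j
    using that by (auto simp: f_def poly_prod intro!: bexI[of _ j])
  have "infinite (UNIV - \<xi> ` {..<m})" by (simp add: infinite_UNIV_char_0)
  then obtain Z where Z: "finite Z" "card Z = n" "Z \<subseteq> UNIV - \<xi> ` {..<m}"
    using infinite_arbitrarily_large by blast
  then obtain y where y: "bij_betw y {..<n} Z" using ex_bij_betw_nat_finite[of Z] by (auto simp: atLeast0LessThan)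
  \<comment> \<open>The \<open>n\<close> auxiliary points outside the roots come first and the roots
    last, so that \<open>f\<close> vanishes on the last \<open>m\<close> columns and the upper right
    block of the product is zero.\<close>
  define z where "z i = (if i < n then y i else \<xi> (i - n))" for i
  have injz: "inj_on z {..<m + n}"
  proof (rule inj_onI)
    fix i j assume a: "i \<in> {..<m + n}" "j \<in> {..<m + n}" "z i = z j"
    have 1: "y i \<in> Z" if "i < n" for i using y that by (auto simp: bij_betw_def)
    have 2: "\<xi> (i - n) \<notin> Z" if "n \<le> i" "i < m + n" for i using Z(3) that by auto
    have 3: "inj_on y {..<n}" using y by (auto simp: bij_betw_def)
    show "i = j"
    proof (cases "i < n"; cases "j < n")
      assume "\<not> i < n" "\<not> j < n"
      then have "i - n = j - n" using a inj by (auto simp: z_def dest!: inj_onD)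
      then show ?thesis using \<open>\<not> i < n\<close> \<open>\<not> j < n\<close> by simp
    qed (use a 1 2 3 in \<open>auto simp: z_def dest: inj_onD, (metis leI)+\<close>)
  qed
  let ?V = "Matrix.mat (m + n) (m + n) (\<lambda>(i, j). z j ^ (m + n - 1 - i))"
  let ?A = "Matrix.mat n n (\<lambda>(i, j). z j ^ (n - 1 - i) * poly f (z j))"
  let ?D = "Matrix.mat m m (\<lambda>(i, j). \<xi> j ^ (m - 1 - i))"
  have fac: "Determinant.det (sylvester_mat_sub m n f r) * Determinant.det ?V =
      Determinant.det ?A * Determinant.det ?D * (\<Prod>j<m. poly r (\<xi> j))" if r: "degree r \<le> n" for r
  proof -
    let ?C = "Matrix.mat m n (\<lambda>(i, j). z j ^ (m - 1 - i) * poly r (z j))"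
    let ?E = "Matrix.mat m m (\<lambda>(i, j). if i = j then poly r (\<xi> i) else 0)"
    let ?F = "Matrix.mat m m (\<lambda>(i, j). \<xi> j ^ (m - 1 - i) * poly r (\<xi> j))"
    have DE: "?D * ?E = ?F"
      by (rule eq_matI) (auto simp: scalar_prod_def if_distrib cong: if_cong)
    have "Determinant.det ?E = prod_list (diag_mat ?E)"
      by (rule det_upper_triangular[of _ m]) auto
    also have "\<dots> = (\<Prod>j<m. poly r (\<xi> j))"
      by (auto simp: prod_list_diag_prod atLeast0LessThan)
    finally have detE: "Determinant.det ?E = (\<Prod>j<m. poly r (\<xi> j))" .
    have "sylvester_mat_sub m n f r * ?V = four_block_mat ?A (0\<^sub>m n m) ?C ?F"
      unfolding sylvester_mat_times_vandermonde[OF f(1) r]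
      by (rule eq_matI) (auto simp: z_def fx add.commute intro!: arg_cong[where f = "\<lambda>n. _ ^ n"])
    then have "Determinant.det (sylvester_mat_sub m n f r * ?V) = Determinant.det ?A * Determinant.det ?F"
      using det_four_block_mat_upper_right_zero[of ?A n "0\<^sub>m n m" m ?C ?F] by simp
    also have "Determinant.det ?F = Determinant.det ?D * Determinant.det ?E"
      unfolding DE[symmetric] by (rule Determinant.det_mult[of _ m]) auto
    finally show ?thesis
      by (subst (asm) Determinant.det_mult[of _ "m + n"]) (auto simp: detE sylvester_mat_sub_carrier)
  qed
  have V: "Determinant.det ?V \<noteq> 0" using det_vandermonde_nonzero[OF injz] by simp
  have "Determinant.det (sylvester_mat_sub m n f [:1:]) = prod_list (diag_mat (sylvester_mat_sub m n f [:1:]))"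
    by (rule det_upper_triangular[of _ "m + n"])
      (auto simp: sylvester_mat_sub_index sylvester_mat_sub_carrier coeff_eq_0 coeff_pCons split: nat.split)
  also have "\<dots> = (\<Prod>i<m+n. if i < n then l else 1)"
    by (auto simp: prod_list_diag_prod atLeast0LessThan sylvester_mat_sub_index f(2) intro!: prod.cong)
  also have "\<dots> = l ^ n"
  proof -
    have "{..<m + n} \<inter> {i. i < n} = {..<n}" by auto
    then show ?thesis by (simp add: prod.If_cases)
  qed
  finally have one: "Determinant.det (sylvester_mat_sub m n f [:1:]) = l ^ n" .
  have "Determinant.det ?A * Determinant.det ?D = l ^ n * Determinant.det ?V"
    using fac[of "[:1:]"] one by simp
  with fac[OF q] V show ?thesis by (simp add: f_def mult_ac)
qed

text \<open>The formal degrees \<open>m\<close> and \<open>n\<close> are fixed, so the size of the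
  matrix does not jump when leading coefficients vanish, and the Leibniz expansion is a polynomial
  in the coefficients.\<close>

lemma continuous_on_det_sylvester:
  fixes f q :: "'a::topological_space \<Rightarrow> complex poly"
  assumes "\<And>i. continuous_on S (\<lambda>x. coeff (f x) i)" "\<And>i. continuous_on S (\<lambda>x. coeff (q x) i)"
  shows "continuous_on S (\<lambda>x. Determinant.det (sylvester_mat_sub m n (f x) (q x)))"
proof -
  have "Determinant.det (sylvester_mat_sub m n (f x) (q x)) =
     (\<Sum>p | p permutes {0..<m+n}. signof p * (\<Prod>i = 0..<m+n. if p i < m + n then
     (if i < n then
       if i \<le> p i \<and> p i - i \<le> m then coeff (f x) (m + i - p i) else 0
     else if i - n \<le> p i \<and> p i \<le> i then coeff (q x) (i-p i) else 0) else 0))" for x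
    unfolding Determinant.det_def'[OF sylvester_mat_sub_carrier]
    by (intro sum.cong prod.cong arg_cong2[where f = "(*)"] refl)
      (auto simp: sylvester_mat_sub_index permutes_in_image dest: permutes_in_image)
  moreover have ifc: "continuous_on S (\<lambda>x. if c then g x else h x)"
    if "continuous_on S g" "continuous_on S h" for c and g h :: "'a \<Rightarrow> complex"
    using that by (cases c) auto
  ultimately show ?thesis
    by (simp only:) (intro continuous_intros ifc assms)
qed

lemma continuous_on_coeff_prod_linear:
  fixes a b :: "nat \<Rightarrow> complex \<Rightarrow> complex"
  assumes "\<And>j. continuous_on S (a j)" "\<And>j. continuous_on S (b j)"
  shows "continuous_on S (\<lambda>t. coeff (\<Prod>j<m. [:b j t, a j t:]) i)"
proof (induction m arbitrary: i)
  case (Suc m)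
  have "coeff ((\<Prod>j<m. [:b j t, a j t:]) * [:b m t, a m t:]) i =
    b m t * coeff (\<Prod>j<m. [:b j t, a j t:]) i + (case i of 0 \<Rightarrow> 0 | Suc i \<Rightarrow> a m t * coeff (\<Prod>j<m. [:b j t, a j t:]) i)" for t
    by (simp add: coeff_pCons mult.commute[of "prod _ _"] split: nat.split)
  with Suc show ?case
    by (cases i) (auto intro!: continuous_intros assms simp: mult.commute)
qed (auto simp: coeff_1)

lemma eq_at_0_of_eventually_eq:
  fixes f g :: "complex \<Rightarrow> complex"
  assumes "continuous_on UNIV f" "continuous_on UNIV g" "\<forall>\<^sub>F t in at 0. f t = g t"
  shows "f 0 = g 0"
proof -
  have "f \<midarrow>0\<rightarrow> f 0" "g \<midarrow>0\<rightarrow> g 0" using assms by (auto simp: continuous_on_def)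
  then show ?thesis using assms(3) tendsto_cong LIM_unique by metis
qed

text \<open>Repeated roots are separated by moving \<open>\<xi> j\<close> to
  \<open>\<xi> j + j t\<close>: two of these agree for at most one \<open>t\<close>, hence all are
  distinct for small nonzero \<open>t\<close>, and both sides are continuous at
  \<open>t = 0\<close>.\<close>

lemma resultant_roots:
  fixes \<xi> :: "nat \<Rightarrow> complex"
  assumes q: "degree q \<le> n"
  shows "Determinant.det (sylvester_mat_sub m n (smult l (\<Prod>j<m. [:- \<xi> j, 1:])) q)
    = l ^ n * (\<Prod>j<m. poly q (\<xi> j))"
proof -
  define x where "x j t = \<xi> j + of_nat j * t" for j and t :: complex
  define F where "F t = Determinant.det (sylvester_mat_sub m n (smult l (\<Prod>j<m. [:- x j t, 1:])) q)" for t
  define G where "G t = l ^ n * (\<Prod>j<m. poly q (x j t))" for t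
  have "finite {t. \<not> inj_on (\<lambda>j. x j t) {..<m}}"
  proof (rule finite_subset)
    show "{t. \<not> inj_on (\<lambda>j. x j t) {..<m}} \<subseteq> (\<lambda>(i, j). (\<xi> i - \<xi> j) / (of_nat j - of_nat i)) ` ({..<m} \<times> {..<m})"
    proof
      fix t assume "t \<in> {t. \<not> inj_on (\<lambda>j. x j t) {..<m}}"
      then obtain i j where "i < m" "j < m" "i \<noteq> j" "x i t = x j t" by (auto simp: inj_on_def)
      then have "t = (\<xi> i - \<xi> j) / (of_nat j - of_nat i)" by (simp add: x_def field_simps)
      with \<open>i < m\<close> \<open>j < m\<close> show "t \<in> (\<lambda>(i, j). (\<xi> i - \<xi> j) / (of_nat j - of_nat i)) ` ({..<m} \<times> {..<m})"
        by force
    qed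
  qed auto
  then have ev: "\<forall>\<^sub>F t in at 0. inj_on (\<lambda>j. x j t) {..<m}"
    using islimpt_finite[of "{t. \<not> inj_on (\<lambda>j. x j t) {..<m}}" "0::complex"] by (simp add: islimpt_iff_eventually)
  have "F 0 = G 0"
  proof (rule eq_at_0_of_eventually_eq)
    show "continuous_on UNIV F" unfolding F_def x_def
      by (intro continuous_on_det_sylvester) (auto intro!: continuous_intros continuous_on_coeff_prod_linear)
    show "continuous_on UNIV G" unfolding G_def x_def by (intro continuous_intros)
    show "\<forall>\<^sub>F t in at 0. F t = G t" using ev
      by eventually_elim (simp add: F_def G_def resultant_roots_distinct q)
  qed
  then show ?thesis by (simp add: F_def G_def x_def)
qed

lemma poly_pderiv_prod_linear:
  fixes x :: "nat \<Rightarrow> complex"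
  assumes "i < n"
  shows "poly (pderiv (\<Prod>j<n. [:- x j, 1:])) (x i) = (\<Prod>j\<in>{..<n} - {i}. x i - x j)"
proof -
  have "(\<Prod>j<n. [:- x j, 1:]) = [:- x i, 1:] * (\<Prod>j\<in>{..<n} - {i}. [:- x j, 1:])"
    using assms by (subst prod.remove[of _ i]) auto
  then show ?thesis by (simp only: pderiv_mult) (simp add: pderiv_pCons poly_prod)
qed

text \<open>Euler's relation for a form of degree \<open>n\<close>, with \<open>dy\<close> set to 1:
  it expresses the derivative with respect to \<open>dy\<close> by the form and its other
  derivative.\<close>

lemma form_disc_euler:
  assumes "degree P \<le> n"
  shows "(\<Sum>i<n. monom (of_nat (n - i) * coeff P i) i) = smult (of_nat n) P - pCons 0 (pderiv P)"
proof (rule poly_eqI)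
  fix i
  have "coeff (\<Sum>i<n. monom (of_nat (n - i) * coeff P i) i) i = (\<Sum>j<n. if j = i then of_nat (n - i) * coeff P i else 0)"
    unfolding coeff_sum by (rule sum.cong) auto
  also have "\<dots> = of_nat n * coeff P i - of_nat i * coeff P i"
  proof (cases "i \<le> n")
    case True
    then obtain d where "n = i + d" using le_Suc_ex by blast
    then show ?thesis by (cases "d = 0") (auto simp: algebra_simps)
  qed (use assms in \<open>auto simp: coeff_eq_0\<close>)
  also have "\<dots> = coeff (smult (of_nat n) P - pCons 0 (pderiv P)) i"
    by (auto simp: coeff_pCons coeff_pderiv algebra_simps split: nat.split)
  finally show "coeff (\<Sum>i<n. monom (of_nat (n - i) * coeff P i) i) i = coeff (smult (of_nat n) P - pCons 0 (pderiv P)) i" .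
qed

text \<open>For \<open>n \<ge> 1\<close> the value is n^(n-2). The numerator collects the factors
  \<open>n\<close> from the leading coefficient \<open>n l\<close> of P' and from the values
  \<open>n P\<close> of the other derivative at the roots of P'; the denominator comes from the
  \<open>n\<close> quotients of P'(x i) by \<open>n l\<close>.\<close>

definition disc_const :: "nat \<Rightarrow> complex" where
  "disc_const n = of_nat n ^ (2 * n - 2) / of_nat n ^ n"

text \<open>At the roots \<xi> of P' Euler's relation leaves \<open>n P\<close> of the other
  derivative. Exchanging the two products turns the values P(\<xi> j) into values P'(x i), which are
  products of differences of roots.\<close>

lemma form_disc_monic_roots:
  fixes x :: "nat \<Rightarrow> complex"
  assumes n: "n \<ge> 1" and l: "l \<noteq> 0"
  shows "form_disc n (smult l (\<Prod>j<n. [:- x j, 1:])) =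
    disc_const n * l ^ (2 * n - 2) * (\<Prod>i<n. \<Prod>j\<in>{..<n} - {i}. x i - x j)"
proof -
  define M where "M = (\<Prod>j<n. [:- x j, 1:])"
  define P where "P = smult l M"
  define Q where "Q = (\<Sum>i<n. monom (of_nat (n - i) * coeff P i) i)"
  have degM: "degree M = n" unfolding M_def by (simp add: degree_prod_eq_sum_degree)
  have "lead_coeff M = 1" unfolding M_def by (simp only: lead_coeff_prod) simp
  with degM l have P: "degree P = n" "lead_coeff P = l" by (auto simp: P_def)
  have degP': "degree (pderiv P) = n - 1" by (simp add: degree_pderiv P)
  have lcP': "lead_coeff (pderiv P) = of_nat n * l"
    using P n unfolding degP' by (auto simp: coeff_pderiv Suc_diff_le of_nat_diff)
  obtain \<xi> where \<xi>: "pderiv P = smult (of_nat n * l) (\<Prod>j<n-1. [:- \<xi> j, 1:])"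
  proof -
    obtain r where "smult (lead_coeff (pderiv P)) (\<Prod>i<degree (pderiv P). [:- r i, 1:]) = pderiv P"
      using complex_poly_decompose' by blast
    then have "smult (of_nat n * l) (\<Prod>i<n - 1. [:- r i, 1:]) = pderiv P"
      using lcP' unfolding degP' by simp
    then show ?thesis by (intro that[of r]) simp
  qed
  have Q: "Q = smult (of_nat n) P - pCons 0 (pderiv P)"
    unfolding Q_def by (rule form_disc_euler) (simp add: P)
  have degQ: "degree Q \<le> n - 1" unfolding Q_def
    by (intro degree_sum_le) (auto intro: order_trans[OF degree_monom_le])
  have z: "poly (pderiv P) (\<xi> j) = 0" if "j < n - 1" for j
    unfolding \<xi> using that by (auto simp: poly_prod intro!: bexI[of _ j])
  have "form_disc n P = Determinant.det (sylvester_mat_sub (n - 1) (n - 1) (pderiv P) Q)"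
    by (simp add: form_disc_def Q_def)
  also have "\<dots> = (of_nat n * l) ^ (n - 1) * (\<Prod>j<n-1. poly Q (\<xi> j))"
    unfolding \<xi> by (rule resultant_roots[OF degQ])
  also have "(\<Prod>j<n-1. poly Q (\<xi> j)) = (\<Prod>j<n-1. of_nat n * l * (\<Prod>i<n. \<xi> j - x i))"
    by (intro prod.cong refl) (auto simp: Q z; simp add: P_def M_def poly_prod)
  also have "\<dots> = (of_nat n * l) ^ (n - 1) * (\<Prod>i<n. \<Prod>j<n-1. \<xi> j - x i)"
    by (subst prod.swap) (simp add: prod.distrib)
  also have "(\<Prod>i<n. \<Prod>j<n-1. \<xi> j - x i) = (\<Prod>i<n. (-1) ^ (n - 1) * (\<Prod>j\<in>{..<n} - {i}. x i - x j) / of_nat n)"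
  proof (intro prod.cong refl)
    fix i assume "i \<in> {..<n}"
    then have "l * (\<Prod>j\<in>{..<n} - {i}. x i - x j) = poly (pderiv P) (x i)"
      using poly_pderiv_prod_linear[of i n x] by (simp add: P_def M_def pderiv_smult)
    also have "\<dots> = of_nat n * l * (\<Prod>j<n-1. x i - \<xi> j)" by (subst \<xi>) (simp add: poly_prod)
    finally have "(\<Prod>j\<in>{..<n} - {i}. x i - x j) / of_nat n = (\<Prod>j<n-1. x i - \<xi> j)"
      using l n by (simp add: field_simps)
    moreover have "(\<Prod>j<n-1. \<xi> j - x i) = (-1) ^ (n - 1) * (\<Prod>j<n-1. x i - \<xi> j)"
      using prod.distrib[of "\<lambda>_. -1" "\<lambda>j. x i - \<xi> j" "{..<n-1}"] by simp
    ultimately show "(\<Prod>j<n-1. \<xi> j - x i) = (-1) ^ (n - 1) * (\<Prod>j\<in>{..<n} - {i}. x i - x j) / of_nat n"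
      by (metis times_divide_eq_right)
  qed
  also have "\<dots> = ((-1) ^ (n - 1)) ^ n * (\<Prod>i<n. \<Prod>j\<in>{..<n} - {i}. x i - x j) / of_nat n ^ n"
    by (simp add: prod.distrib prod_dividef)
  also have "((-1 :: complex) ^ (n - 1)) ^ n = 1"
    by (cases "even n") (use n in \<open>auto simp flip: power_mult\<close>)
  finally have "form_disc n P = (of_nat n * l) ^ (n - 1) * ((of_nat n * l) ^ (n - 1) *
      ((\<Prod>i<n. \<Prod>j\<in>{..<n} - {i}. x i - x j) / of_nat n ^ n))" by simp
  also have "\<dots> = ((of_nat n * l) ^ (n - 1) * (of_nat n * l) ^ (n - 1)) / of_nat n ^ n * (\<Prod>i<n. \<Prod>j\<in>{..<n} - {i}. x i - x j)"
    by simp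
  also have "(of_nat n * l) ^ (n - 1) * (of_nat n * l) ^ (n - 1) = (of_nat n * l) ^ (2 * n - 2)"
    unfolding power_add[symmetric] by (rule arg_cong[where f = "\<lambda>m. _ ^ m"]) simp
  finally show ?thesis
    by (simp add: disc_const_def P_def M_def power_mult_distrib)
qed

lemma continuous_on_form_disc:
  fixes P :: "'a::topological_space \<Rightarrow> complex poly"
  assumes P: "\<And>i. continuous_on S (\<lambda>x. coeff (P x) i)"
  shows "continuous_on S (\<lambda>x. form_disc n (P x))"
  unfolding form_disc_def
proof (rule continuous_on_det_sylvester)
  show "continuous_on S (\<lambda>x. coeff (pderiv (P x)) i)" for i
    unfolding coeff_pderiv by (intro continuous_intros P)
  have "continuous_on S (\<lambda>x. if j = i then of_nat (n - j) * coeff (P x) j else 0)" for i j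
    by (cases "j = i") (auto intro!: continuous_intros P)
  then show "continuous_on S (\<lambda>x. coeff (\<Sum>i<n. monom (of_nat (n - i) * coeff (P x) i) i) i)" for i
    unfolding coeff_sum coeff_monom by (intro continuous_on_sum)
qed

text \<open>A factor with \<open>a i = 0\<close> is a multiple of \<open>dy\<close>, a root at
  infinity. Replacing \<open>a i\<close> by \<open>a i + t\<close> makes all roots finite for small
  nonzero \<open>t\<close>, and the limit \<open>t = 0\<close> gives the general case.\<close>

lemma form_disc_linear_factors:
  fixes a b :: "nat \<Rightarrow> complex"
  assumes n: "n \<ge> 1"
  shows "form_disc n (\<Prod>i<n. [:b i, a i:]) =
    disc_const n * (\<Prod>i<n. \<Prod>j\<in>{..<n} - {i}. a i * b j - a j * b i)"
proof -
  have generic: "form_disc n (\<Prod>i<n. [:b i, a i:]) =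
    disc_const n * (\<Prod>i<n. \<Prod>j\<in>{..<n} - {i}. a i * b j - a j * b i)"
    if nz: "\<And>i. i < n \<Longrightarrow> a i \<noteq> 0" for a :: "nat \<Rightarrow> complex"
  proof -
    define l where "l = (\<Prod>i<n. a i)"
    have l: "l \<noteq> 0" using nz by (auto simp: l_def)
    have "(\<Prod>i<n. [:b i, a i:]) = (\<Prod>i<n. [:a i:] * [:- (- b i / a i), 1:])"
      by (intro prod.cong) (auto simp: nz)
    also have "\<dots> = smult l (\<Prod>i<n. [:- (- b i / a i), 1:])"
    proof -
      have "(\<Prod>i<m. [:a i:]) = [:\<Prod>i<m. a i:]" for m by (induction m) auto
      then show ?thesis by (simp only: prod.distrib l_def) simp
    qed
    finally have *: "(\<Prod>i<n. [:b i, a i:]) = smult l (\<Prod>i<n. [:- (- b i / a i), 1:])" .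
    have "(\<Prod>i<n. \<Prod>j\<in>{..<n} - {i}. a i * b j - a j * b i) =
        (\<Prod>i<n. \<Prod>j\<in>{..<n} - {i}. (a i * a j) * (- b i / a i - - b j / a j))"
      by (intro prod.cong refl) (auto simp: nz field_simps)
    also have "\<dots> = (\<Prod>i<n. a i ^ (n - 1)) * (\<Prod>i<n. \<Prod>j\<in>{..<n} - {i}. a j) *
        (\<Prod>i<n. \<Prod>j\<in>{..<n} - {i}. (- b i / a i - - b j / a j))"
      by (simp add: prod.distrib)
    also have "(\<Prod>i<n. a i ^ (n - 1)) = l ^ (n - 1)" by (simp add: l_def prod_power_distrib)
    also have "(\<Prod>i<n. \<Prod>j\<in>{..<n} - {i}. a j) = (\<Prod>i<n. l / a i)"
      by (intro prod.cong refl) (auto simp: l_def prod_diff1 nz)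
    also have "\<dots> = l ^ n / l" by (simp add: prod_dividef l_def)
    also have "l ^ (n - 1) * (l ^ n / l) = l ^ (2 * n - 2)"
      using l n by (cases n) (auto simp: mult_2 simp flip: power_add)
    finally show ?thesis
      unfolding * form_disc_monic_roots[OF n l] by simp
  qed
  define A where "A i t = a i + t" for i and t :: complex
  define F where "F t = form_disc n (\<Prod>i<n. [:b i, A i t:])" for t
  define G where "G t = disc_const n * (\<Prod>i<n. \<Prod>j\<in>{..<n} - {i}. A i t * b j - A j t * b i)" for t
  have "finite ((\<lambda>i. - a i) ` {..<n})" by auto
  then have "\<forall>\<^sub>F t in at 0. t \<notin> (\<lambda>i. - a i) ` {..<n}"
    using islimpt_finite[of _ "0::complex"] islimpt_iff_eventually by blast
  then have ev: "\<forall>\<^sub>F t in at 0. \<forall>i<n. A i t \<noteq> 0"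
    by eventually_elim (auto simp: A_def add_eq_0_iff image_iff)
  have "F 0 = G 0"
  proof (rule eq_at_0_of_eventually_eq)
    show "continuous_on UNIV F" unfolding F_def A_def
      by (intro continuous_on_form_disc continuous_on_coeff_prod_linear continuous_intros)
    show "continuous_on UNIV G" unfolding G_def A_def by (intro continuous_intros)
    show "\<forall>\<^sub>F t in at 0. F t = G t" using ev
      by eventually_elim (simp add: F_def G_def generic)
  qed
  then show ?thesis by (simp add: F_def G_def A_def)
qed

section \<open>Linear factors of binary forms and the discriminant of a product\<close>

lemma linear_factors:
  fixes P :: "complex poly"
  assumes "degree P \<le> n" "n \<ge> 1"
  obtains a b where "P = (\<Prod>i<n. [:b i, a i:])"
proof -
  obtain r where r: "smult (lead_coeff P) (\<Prod>i<degree P. [:- r i, 1:]) = P"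
    using complex_poly_decompose' by blast
  \<comment> \<open>The leading coefficient, possibly zero, goes into factor 0, hence
    \<open>n \<ge> 1\<close>; the missing degree is filled up with factors \<open>1\<close>, that is
    with powers of \<open>dy\<close>.\<close>
  define u where "u i = (if i = 0 then lead_coeff P else 1)" for i :: nat
  define L where "L i = (if i < degree P then [:- r i, 1:] else 1)" for i
  have "(\<Prod>i<n. [:u i:]) = [:lead_coeff P:]"
    using assms(2) by (subst prod.remove[of _ 0]) (auto simp: u_def one_pCons[symmetric])
  moreover have "(\<Prod>i<n. L i) = (\<Prod>i<degree P. [:- r i, 1:])"
    by (rule prod.mono_neutral_cong_right) (use assms(1) in \<open>auto simp: L_def\<close>)
  ultimately have "P = (\<Prod>i<n. [:u i:] * L i)" by (simp only: prod.distrib) (simp add: r)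
  also have "\<dots> = (\<Prod>i<n. [:u i * coeff (L i) 0, u i * coeff (L i) 1:])"
    by (intro prod.cong refl) (auto simp: L_def one_pCons)
  finally show ?thesis by (rule that)
qed

lemma form_eval_alt:
  assumes "degree P \<le> n" "v \<noteq> 0"
  shows "form_eval n P (u, v) = v ^ n * poly P (u / v)"
proof -
  have "poly P (u / v) = (\<Sum>i\<le>n. coeff P i * (u / v) ^ i)"
    unfolding poly_altdef by (rule sum.mono_neutral_left) (use assms in \<open>auto simp: coeff_eq_0\<close>)
  then show ?thesis using assms(2)
    by (auto simp: form_eval_def sum_distrib_left power_divide power_diff field_simps intro!: sum.cong)
qed

lemma form_eval_mult:
  assumes "degree P \<le> m" "degree Q \<le> n"
  shows "form_eval (m + n) (P * Q) w = form_eval m P w * form_eval n Q w"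
proof (cases w)
  case (Pair u v)
  show ?thesis
  proof (cases "v = 0")
    case True
    have top: "form_eval d R (u, 0) = coeff R d * u ^ d" for d R
      by (simp add: form_eval_def power_0_left if_distrib sum.delta' cong: if_cong)
    have "coeff (P * Q) (m + n) = (\<Sum>i\<le>m + n. if i = m then coeff P m * coeff Q n else 0)"
      unfolding coeff_mult
    proof (intro sum.cong refl)
      fix i assume "i \<in> {..m + n}"
      consider "i < m" | "i = m" | "m < i" by linarith
      then show "coeff P i * coeff Q (m + n - i) = (if i = m then coeff P m * coeff Q n else 0)"
        by cases (use assms in \<open>auto simp: coeff_eq_0\<close>)
    qed
    then show ?thesis by (simp add: Pair True top power_add)
  next
    case False
    have "degree (P * Q) \<le> m + n" using assms degree_mult_le[of P Q] by linarith
    with False assms show ?thesis by (simp add: Pair form_eval_alt power_add)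
  qed
qed

lemma form_eval_linear: "form_eval 1 [:b, a:] w = a * fst w + b * snd w"
  by (simp add: form_eval_def)

lemma degree_prod_linear_le: "degree (\<Prod>i<n. [:b i, a i:]) \<le> n" for a b :: "nat \<Rightarrow> complex"
proof (induction n)
  case (Suc n)
  have "degree ((\<Prod>i<n. [:b i, a i:]) * [:b n, a n:]) \<le> n + 1"
    by (rule order_trans[OF degree_mult_le]) (use Suc in \<open>auto intro: add_mono\<close>)
  then show ?case by simp
qed auto

lemma form_eval_prod_linear:
  "form_eval n (\<Prod>i<n. [:b i, a i:]) w = (\<Prod>i<n. a i * fst w + b i * snd w)"
proof (induction n)
  case (Suc n)
  have "form_eval (n + 1) ((\<Prod>i<n. [:b i, a i:]) * [:b n, a n:]) w =
      form_eval n (\<Prod>i<n. [:b i, a i:]) w * form_eval 1 [:b n, a n:] w"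
    by (rule form_eval_mult) (auto simp: degree_prod_linear_le)
  with Suc show ?case by (simp add: form_eval_linear[unfolded One_nat_def])
qed (simp add: form_eval_def)

lemma disc_const_nonzero: "n \<ge> 1 \<Longrightarrow> disc_const n \<noteq> 0"
  by (simp add: disc_const_def)

text \<open>The ordered pairs of factors lie inside the quadratic form, inside \<open>Q\<close>, or
  are mixed. As \<open>(- b0, a0)\<close> spans the kernel of \<open>[:b0, a0:]\<close>, the mixed
  pairs give the values of \<open>Q\<close> on the two kernels, in both orders: hence the square,
  while the sign \<open>(-1) ^ k\<close> occurs twice.\<close>

lemma form_disc_mult_quadratic:
  assumes "degree Q \<le> k" "k \<ge> 1"
  shows "form_disc (k + 2) ([:b0, a0:] * [:b1, a1:] * Q) =
    disc_const (k + 2) / (disc_const 2 * disc_const k) * form_disc 2 ([:b0, a0:] * [:b1, a1:]) * form_disc k Q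
      * (form_eval k Q (- b0, a0) * form_eval k Q (- b1, a1))\<^sup>2"
proof -
  obtain a b where Q: "Q = (\<Prod>i<k. [:b i, a i:])" using linear_factors[OF assms] .
  define a' b' where "a' = case_nat a0 (case_nat a1 a)" and "b' = case_nat b0 (case_nat b1 b)"
  have PQ: "[:b0, a0:] * [:b1, a1:] * Q = (\<Prod>i<k+2. [:b' i, a' i:])"
    by (simp add: Q prod.lessThan_Suc_shift a'_def b'_def del: prod.lessThan_Suc mult_pCons_left mult_pCons_right)
  have P: "[:b0, a0:] * [:b1, a1:] = (\<Prod>i<2. [:b' i, a' i:])"
    by (simp add: numeral_2_eq_2 a'_def b'_def)
  have minus: "{..<k+2} - {i + 2} = insert 0 (insert 1 ((\<lambda>j. j + 2) ` ({..<k} - {i})))" if "i < k" for i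
  proof -
    have "j \<in> (\<lambda>j. j + 2) ` ({..<k} - {i})" if "j < k + 2" "j \<noteq> i + 2" "j \<noteq> 0" "j \<noteq> 1" for j
      using that by (intro image_eqI[of _ _ "j - 2"]) auto
    then show ?thesis using \<open>i < k\<close> by auto
  qed
  define D where "D i j = a' i * b' j - a' j * b' i" for i j
  have im: "prod f ((\<lambda>j. j + 2) ` S) = (\<Prod>j\<in>S. f (j + 2))" for f :: "nat \<Rightarrow> complex" and S
    by (subst prod.reindex) (auto simp: inj_on_def)
  have m0: "{..<k+2} - {0} = insert 1 ((\<lambda>j. j + 2) ` {..<k})" "{..<k+2} - {1} = insert 0 ((\<lambda>j. j + 2) ` {..<k})"
  proof -
    have "j \<in> (\<lambda>j. j + 2) ` {..<k}" if "j < k + 2" "j \<noteq> 0" "j \<noteq> 1" for j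
      using that by (intro image_eqI[of _ _ "j - 2"]) auto
    then show "{..<k+2} - {0} = insert 1 ((\<lambda>j. j + 2) ` {..<k})" "{..<k+2} - {1} = insert 0 ((\<lambda>j. j + 2) ` {..<k})" by auto
  qed
  have m2: "{..<2} - {0} = {Suc 0}" "{..<2} - {Suc 0} = {0::nat}" by auto
  have "(\<Prod>i<k+2. \<Prod>j\<in>{..<k+2} - {i}. D i j) =
     (\<Prod>j\<in>{..<k+2} - {0}. D 0 j) * (\<Prod>j\<in>{..<k+2} - {1}. D 1 j) * (\<Prod>i<k. \<Prod>j\<in>{..<k+2} - {i + 2}. D (i + 2) j)"
    by (simp add: prod.lessThan_Suc_shift del: prod.lessThan_Suc)
  also have "(\<Prod>i<k. \<Prod>j\<in>{..<k+2} - {i + 2}. D (i + 2) j) =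
     (\<Prod>i<k. D (i + 2) 0) * (\<Prod>i<k. D (i + 2) 1) * (\<Prod>i<k. \<Prod>j\<in>{..<k} - {i}. D (i + 2) (j + 2))"
    unfolding prod.distrib[symmetric]
  proof (intro prod.cong refl)
    fix i assume "i \<in> {..<k}"
    then have i: "i < k" by simp
    show "(\<Prod>j\<in>{..<k+2} - {i + 2}. D (i + 2) j) = D (i + 2) 0 * D (i + 2) 1 * (\<Prod>j\<in>{..<k} - {i}. D (i + 2) (j + 2))"
      unfolding minus[OF i] by (simp add: im image_iff del: add_2_eq_Suc add_2_eq_Suc')
  qed
  also have "(\<Prod>j\<in>{..<k+2} - {0}. D 0 j) = D 0 1 * (\<Prod>j<k. D 0 (j + 2))"
    unfolding m0 by (simp add: im image_iff del: add_2_eq_Suc add_2_eq_Suc')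
  also have "(\<Prod>j\<in>{..<k+2} - {1}. D 1 j) = D 1 0 * (\<Prod>j<k. D 1 (j + 2))"
    unfolding m0 by (simp add: im image_iff del: add_2_eq_Suc add_2_eq_Suc')
  finally have expand: "(\<Prod>i<k+2. \<Prod>j\<in>{..<k+2} - {i}. D i j) = D 0 1 * (\<Prod>j<k. D 0 (j + 2)) *
     (D 1 0 * (\<Prod>j<k. D 1 (j + 2))) * ((\<Prod>i<k. D (i + 2) 0) * (\<Prod>i<k. D (i + 2) 1) *
     (\<Prod>i<k. \<Prod>j\<in>{..<k} - {i}. D (i + 2) (j + 2)))" .
  have DQ: "(\<Prod>i<k. \<Prod>j\<in>{..<k} - {i}. D (i + 2) (j + 2)) = (\<Prod>i<k. \<Prod>j\<in>{..<k} - {i}. a i * b j - a j * b i)"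
    by (simp add: D_def a'_def b'_def)
  have ev: "form_eval k Q (- b0, a0) = (\<Prod>j<k. D 0 (j + 2))" "form_eval k Q (- b1, a1) = (\<Prod>j<k. D 1 (j + 2))"
    by (auto simp: Q form_eval_prod_linear D_def a'_def b'_def algebra_simps)
  have ev': "(\<Prod>i<k. D (i + 2) e) = (-1) ^ k * (\<Prod>j<k. D e (j + 2))" for e
  proof -
    have "(\<Prod>i<k. D (i + 2) e) = (\<Prod>i<k. (-1) * D e (i + 2))"
      by (intro prod.cong) (auto simp: D_def)
    then show ?thesis by (simp only: prod.distrib prod_constant card_lessThan)
  qed
  have s: "(-1 :: complex) ^ k * (-1) ^ k = 1" by (simp flip: power_mult_distrib)
  have d2: "form_disc 2 ([:b0, a0:] * [:b1, a1:]) = disc_const 2 * (D 0 1 * D 1 0)"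
    unfolding P by (subst form_disc_linear_factors) (auto simp: numeral_2_eq_2 m2[unfolded numeral_2_eq_2] D_def)
  have dk: "form_disc k Q = disc_const k * (\<Prod>i<k. \<Prod>j\<in>{..<k} - {i}. a i * b j - a j * b i)"
    unfolding Q using form_disc_linear_factors[OF assms(2)] .
  have "form_disc (k + 2) ([:b0, a0:] * [:b1, a1:] * Q) = disc_const (k + 2) * (\<Prod>i<k+2. \<Prod>j\<in>{..<k+2} - {i}. D i j)"
    unfolding PQ by (subst form_disc_linear_factors) (auto simp: D_def)
  also have "\<dots> = disc_const (k + 2) * (D 0 1 * D 1 0 * ((-1) ^ k * (-1) ^ k) *
     (form_eval k Q (- b0, a0) * form_eval k Q (- b1, a1))\<^sup>2 * (\<Prod>i<k. \<Prod>j\<in>{..<k} - {i}. a i * b j - a j * b i))"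
    unfolding expand DQ ev ev' by (simp add: power2_eq_square mult_ac)
  finally show ?thesis
    unfolding d2 dk s using disc_const_nonzero[OF assms(2)] disc_const_nonzero[of 2]
    by (simp del: mult_pCons_left mult_pCons_right)
qed

section \<open>Holomorphic functions of several variables\<close>

text \<open>\<open>C\<close> is the space of complex linear forms, as in \<open>holo2\<close> and \<open>holo3\<close>.\<close>

definition cdiff :: "('a::real_normed_vector \<Rightarrow> complex) set \<Rightarrow> ('a \<Rightarrow> complex) \<Rightarrow> 'a \<Rightarrow> bool" where
  "cdiff C f p \<longleftrightarrow> (\<exists>f'\<in>C. (f has_derivative f') (at p))"

text \<open>Because \<open>G\<close> vanishes at \<open>z\<close>, mere continuity of the other
  factor is enough. This gives the differentiability of a root \<open>w\<close> in
  \<open>simple_root\<close>, where the other factor contains \<open>w\<close> itself.\<close>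

lemma has_derivative_mult_continuous:
  fixes G q :: "'a::real_normed_vector \<Rightarrow> complex"
  assumes G: "(G has_derivative G') (at z)" "G z = 0" and q: "isCont q z"
  shows "((\<lambda>x. G x * q x) has_derivative (\<lambda>v. G' v * q z)) (at z)"
proof -
  interpret G': bounded_linear G' using G(1) by (rule has_derivative_bounded_linear)
  obtain K where K: "\<And>v. norm (G' v) \<le> norm v * K" using G'.bounded by blast
  define N where "N x = norm (G x - G' (x - z)) / norm (x - z) * norm (q x) + norm (q x - q z) * K" for x
  have "((\<lambda>x. norm (G x - G' (x - z)) / norm (x - z)) \<longlongrightarrow> 0) (at z)"
    using G by (simp add: has_derivative_iff_norm)
  moreover have "((\<lambda>x. norm (q x - q z)) \<longlongrightarrow> 0) (at z)" "((\<lambda>x. norm (q x)) \<longlongrightarrow> norm (q z)) (at z)"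
    using q by (auto simp: isCont_def LIM_zero tendsto_norm_zero intro: tendsto_norm)
  ultimately have "(N \<longlongrightarrow> 0 * norm (q z) + 0 * K) (at z)"
    unfolding N_def by (intro tendsto_add tendsto_mult tendsto_const)
  then have "(N \<longlongrightarrow> 0) (at z)" by simp
  moreover have "\<forall>\<^sub>F x in at z. norm (norm (G x * q x - G z * q z - G' (x - z) * q z) / norm (x - z)) \<le> N x"
    unfolding eventually_at_filter
  proof (intro always_eventually allI impI)
    fix x assume "x \<noteq> z"
    then have "norm (G' (x - z)) / norm (x - z) \<le> K" using K[of "x - z"] by (simp add: field_simps)
    from mult_right_mono[OF this, of "norm (q x - q z)"]
    have *: "norm (G' (x - z) * (q x - q z)) / norm (x - z) \<le> norm (q x - q z) * K"
      by (simp add: norm_mult mult.commute)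
    have "G x * q x - G z * q z - G' (x - z) * q z = (G x - G' (x - z)) * q x + G' (x - z) * (q x - q z)"
      by (simp add: G(2) algebra_simps)
    then have "norm (G x * q x - G z * q z - G' (x - z) * q z) \<le>
        norm (G x - G' (x - z)) * norm (q x) + norm (G' (x - z) * (q x - q z))"
      by (metis norm_triangle_ineq norm_mult)
    from divide_right_mono[OF this, of "norm (x - z)"] *
    show "norm (norm (G x * q x - G z * q z - G' (x - z) * q z) / norm (x - z)) \<le> N x"
      by (simp add: N_def add_divide_distrib)
  qed
  ultimately have "((\<lambda>x. norm (G x * q x - G z * q z - G' (x - z) * q z) / norm (x - z)) \<longlongrightarrow> 0) (at z)"
    by (rule Lim_null_comparison[rotated])
  moreover have "bounded_linear (\<lambda>v. G' v * q z)"
    by (rule bounded_linear_mult_const) (rule G'.bounded_linear_axioms)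
  ultimately show ?thesis
    by (simp add: has_derivative_iff_norm)
qed

text \<open>Closure under sums and complex multiples is what the calculus below needs of the
  derivatives, so the same proofs serve two variables, for a single web, and three, for a
  deformation.\<close>

locale complex_linear_maps =
  fixes C :: "('a::real_normed_vector \<Rightarrow> complex) set"
  assumes zero: "(\<lambda>_. 0) \<in> C"
    and add: "\<And>f g. f \<in> C \<Longrightarrow> g \<in> C \<Longrightarrow> (\<lambda>v. f v + g v) \<in> C"
    and scale: "\<And>f c. f \<in> C \<Longrightarrow> (\<lambda>v. f v * c) \<in> C"
begin

lemma cdiff_continuous: "cdiff C f p \<Longrightarrow> isCont f p"
  by (auto simp: cdiff_def intro: has_derivative_continuous)

lemma cdiff_const [intro]: "cdiff C (\<lambda>_. c) p"
  unfolding cdiff_def using zero has_derivative_const by blast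

lemma cdiff_add [intro]: "cdiff C f p \<Longrightarrow> cdiff C g p \<Longrightarrow> cdiff C (\<lambda>x. f x + g x) p"
  unfolding cdiff_def using add has_derivative_add by blast

lemma cdiff_mult [intro]:
  assumes "cdiff C f p" "cdiff C g p" shows "cdiff C (\<lambda>x. f x * g x) p"
proof -
  obtain f' g' where d: "f' \<in> C" "(f has_derivative f') (at p)" "g' \<in> C" "(g has_derivative g') (at p)"
    using assms by (auto simp: cdiff_def)
  have "(\<lambda>v. g' v * f p + f' v * g p) \<in> C" by (intro add scale d)
  moreover have "((\<lambda>x. f x * g x) has_derivative (\<lambda>v. g' v * f p + f' v * g p)) (at p)"
    using has_derivative_mult[OF d(2,4)] by (simp add: mult.commute)
  ultimately show ?thesis by (auto simp: cdiff_def)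
qed

lemma cdiff_minus [intro]: "cdiff C f p \<Longrightarrow> cdiff C (\<lambda>x. - f x) p"
  using cdiff_mult[of "\<lambda>_. -1"] by fastforce

lemma cdiff_diff [intro]: "cdiff C f p \<Longrightarrow> cdiff C g p \<Longrightarrow> cdiff C (\<lambda>x. f x - g x) p"
  using cdiff_add[of f p "\<lambda>x. - g x"] by auto

lemma cdiff_sum [intro]: "(\<And>i. i \<in> A \<Longrightarrow> cdiff C (f i) p) \<Longrightarrow> cdiff C (\<lambda>x. \<Sum>i\<in>A. f i x) p"
  by (induction A rule: infinite_finite_induct) auto

lemma cdiff_prod [intro]: "(\<And>i. i \<in> A \<Longrightarrow> cdiff C (f i) p) \<Longrightarrow> cdiff C (\<lambda>x. \<Prod>i\<in>A. f i x) p"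
  by (induction A rule: infinite_finite_induct) auto

lemma cdiff_power [intro]: "cdiff C f p \<Longrightarrow> cdiff C (\<lambda>x. f x ^ n) p"
  by (induction n) auto

lemma cdiff_compose:
  assumes "cdiff C f p" "(g has_field_derivative g') (at (f p))"
  shows "cdiff C (\<lambda>x. g (f x)) p"
proof -
  obtain f' where d: "f' \<in> C" "(f has_derivative f') (at p)" using assms by (auto simp: cdiff_def)
  have "((\<lambda>x. g (f x)) has_derivative (\<lambda>v. f' v * g')) (at p)"
    using has_derivative_compose[OF d(2), of g "(*) g'"] assms(2)
    by (simp add: has_field_derivative_def mult.commute)
  with scale[OF d(1)] show ?thesis by (auto simp: cdiff_def)
qed

lemma cdiff_inverse [intro]: "cdiff C f p \<Longrightarrow> f p \<noteq> 0 \<Longrightarrow> cdiff C (\<lambda>x. inverse (f x)) p"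
  by (rule cdiff_compose[where g = inverse]) (auto intro: DERIV_inverse)

lemma cdiff_divide [intro]: "cdiff C f p \<Longrightarrow> cdiff C g p \<Longrightarrow> g p \<noteq> 0 \<Longrightarrow> cdiff C (\<lambda>x. f x / g x) p"
  unfolding divide_inverse by auto

lemma cdiff_poly:
  assumes "\<And>i. i \<le> N \<Longrightarrow> cdiff C (\<lambda>z. coeff (P z) i) p" "cdiff C w p" "\<And>z. degree (P z) \<le> N"
  shows "cdiff C (\<lambda>z. poly (P z) (w z)) p"
proof -
  have "poly (P z) x = (\<Sum>i\<le>N. coeff (P z) i * x ^ i)" for z x
    unfolding poly_altdef by (rule sum.mono_neutral_left) (use assms(3)[of z] in \<open>auto simp: coeff_eq_0\<close>)
  then show ?thesis by (simp only:) (intro cdiff_sum cdiff_mult cdiff_power assms(1,2); simp)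
qed

lemma cdiff_cong_open:
  assumes "cdiff C f p" "open T" "p \<in> T" "\<And>x. x \<in> T \<Longrightarrow> f x = g x"
  shows "cdiff C g p"
  using assms unfolding cdiff_def by (metis has_derivative_transform_within_open)

end

section \<open>Roots of polynomials that depend on parameters\<close>

lemma poly_root_near:
  fixes P :: "'a::t2_space \<Rightarrow> complex poly"
  assumes cont: "\<And>i. i \<le> N \<Longrightarrow> isCont (\<lambda>z. coeff (P z) i) z0" and deg: "\<And>z. degree (P z) \<le> N"
    and lc: "coeff (P z0) N \<noteq> 0" and root: "poly (P z0) w0 = 0" and r: "r > 0"
  shows "\<forall>\<^sub>F z in nhds z0. \<exists>w\<in>ball w0 r. poly (P z) w = 0"
proof -
  have eq: "poly (P z) x = (\<Sum>i\<le>N. coeff (P z) i * x ^ i)" for z x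
    unfolding poly_altdef by (rule sum.mono_neutral_left) (use deg[of z] in \<open>auto simp: coeff_eq_0\<close>)
  define g where "g z = norm (coeff (P z) N) * r ^ N - norm (poly (P z) w0)" for z
  have "isCont g z0"
    unfolding eq g_def by (intro continuous_intros cont) auto
  then have "(g \<longlongrightarrow> g z0) (nhds z0)"
    unfolding tendsto_at_iff_tendsto_nhds[symmetric] isCont_def .
  then have "((\<lambda>z. norm (coeff (P z) N) * r ^ N - norm (poly (P z) w0)) \<longlongrightarrow> norm (coeff (P z0) N) * r ^ N) (nhds z0)"
    using root by (simp add: g_def[abs_def])
  moreover have "norm (coeff (P z0) N) * r ^ N > 0" using lc r by simp
  ultimately have "\<forall>\<^sub>F z in nhds z0. norm (coeff (P z) N) * r ^ N - norm (poly (P z) w0) > 0"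
    by (rule order_tendstoD(1))
  then show ?thesis
  proof eventually_elim
    case (elim z)
    then have nz: "coeff (P z) N \<noteq> 0" using r by auto
    then have d: "degree (P z) = N" using deg[of z] le_degree le_antisym by metis
    obtain a where a: "smult (coeff (P z) N) (\<Prod>i<N. [:- a i, 1:]) = P z"
      using complex_poly_decompose'[of "P z"] d by metis
    \<comment> \<open>If all \<open>N\<close> roots had distance at least \<open>r\<close> from
      \<open>w0\<close>, the modulus of \<open>P z\<close> at \<open>w0\<close> would be at least
      that of the leading coefficient times \<open>r ^ N\<close>; but near \<open>z0\<close> it is
      smaller.\<close>
    show ?case
    proof (rule ccontr)
      assume *: "\<not> ?case"
      have "r \<le> norm (w0 - a i)" if "i < N" for i
      proof (rule ccontr)
        assume "\<not> r \<le> norm (w0 - a i)"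
        then have "a i \<in> ball w0 r" by (simp add: dist_norm)
        moreover have "poly (P z) (a i) = 0" by (subst a[symmetric]) (use that in \<open>auto simp: poly_prod\<close>)
        ultimately show False using * by blast
      qed
      then have "(\<Prod>i<N. r) \<le> (\<Prod>i<N. norm (w0 - a i))" using r by (intro prod_mono) auto
      moreover have "norm (poly (P z) w0) = norm (coeff (P z) N) * (\<Prod>i<N. norm (w0 - a i))"
        by (subst a[symmetric]) (simp add: poly_prod norm_mult prod_norm)
      ultimately show False using elim by (simp add: mult_left_mono leD)
    qed
  qed
qed

text \<open>The quotient (p(x) - p(y)) / (x - y), written as a polynomial in \<open>x\<close> and
  \<open>y\<close> so that it is continuous across the diagonal.\<close>

definition divided_diff :: "nat \<Rightarrow> complex poly \<Rightarrow> complex \<Rightarrow> complex \<Rightarrow> complex" where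
  "divided_diff N p x y = (\<Sum>i\<le>N. coeff p i * (\<Sum>j<i. y ^ (i - Suc j) * x ^ j))"

lemma divided_diff:
  assumes "degree p \<le> N"
  shows "poly p x - poly p y = (x - y) * divided_diff N p x y"
    and "divided_diff N p x x = poly (pderiv p) x"
proof -
  have eq: "poly p x = (\<Sum>i\<le>N. coeff p i * x ^ i)" for x
    unfolding poly_altdef by (rule sum.mono_neutral_left) (use assms in \<open>auto simp: coeff_eq_0\<close>)
  show 1: "poly p x - poly p y = (x - y) * divided_diff N p x y" for y
    unfolding eq divided_diff_def sum_distrib_left sum_subtractf[symmetric]
    by (intro sum.cong refl) (simp add: power_diff_sumr2 sum_distrib_left algebra_simps flip: right_diff_distrib)
  have "((\<lambda>y. divided_diff N p x y) \<longlongrightarrow> divided_diff N p x x) (at x)"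
    unfolding divided_diff_def by (intro tendsto_intros)
  moreover have "((\<lambda>y. (poly p y - poly p x) / (y - x)) \<longlongrightarrow> poly (pderiv p) x) (at x)"
    using poly_DERIV[of p x] by (simp add: has_field_derivative_iff)
  then have "((\<lambda>y. divided_diff N p x y) \<longlongrightarrow> poly (pderiv p) x) (at x)"
  proof (rule Lim_transform_eventually)
    show "\<forall>\<^sub>F y in at x. (poly p y - poly p x) / (y - x) = divided_diff N p x y"
      unfolding eventually_at_filter
    proof (intro always_eventually allI impI)
      fix y assume "y \<noteq> x"
      have "poly p y - poly p x = (y - x) * divided_diff N p x y" using 1[of y] by (simp add: algebra_simps)
      with \<open>y \<noteq> x\<close> show "(poly p y - poly p x) / (y - x) = divided_diff N p x y" by simp
    qed
  qed
  ultimately show "divided_diff N p x x = poly (pderiv p) x" by (rule LIM_unique)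
qed

text \<open>The divided difference stays away from 0 near \<open>(z0, w0, w0)\<close>, where it is
  the derivative at a simple root. This one bound gives uniqueness of the root and, as
  \<open>w z' - w z\<close> is the quotient of the value of \<open>- P z'\<close> at
  \<open>w z\<close> by it, first continuity of \<open>w\<close> and then differentiability.\<close>

lemma (in complex_linear_maps) simple_root:
  fixes P :: "'a \<Rightarrow> complex poly"
  assumes S: "open S" "z0 \<in> S" and P: "\<And>z i. z \<in> S \<Longrightarrow> i \<le> N \<Longrightarrow> cdiff C (\<lambda>z. coeff (P z) i) z"
    and deg: "\<And>z. degree (P z) \<le> N"
    and lc: "coeff (P z0) N \<noteq> 0" and root: "poly (P z0) w0 = 0" and simple: "poly (pderiv (P z0)) w0 \<noteq> 0"
    and R: "R > 0"
  obtains T r w where "open T" "z0 \<in> T" "T \<subseteq> S" "r > 0" "r \<le> R" "w z0 = w0"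
    "\<And>z. z \<in> T \<Longrightarrow> cdiff C w z" "\<And>z. z \<in> T \<Longrightarrow> w z \<in> ball w0 r" "\<And>z. z \<in> T \<Longrightarrow> poly (P z) (w z) = 0"
    "\<And>z x. z \<in> T \<Longrightarrow> x \<in> ball w0 r \<Longrightarrow> poly (P z) x = 0 \<Longrightarrow> x = w z"
proof -
  define q where "q = (\<lambda>(z, x, y). divided_diff N (P z) x y)"
  define \<delta> where "\<delta> = norm (poly (pderiv (P z0)) w0) / 2"
  have \<delta>: "\<delta> > 0" using simple by (simp add: \<delta>_def)
  have contP: "isCont (\<lambda>z. coeff (P z) i) z" if "z \<in> S" "i \<le> N" for z i
    using P[OF that] by (rule cdiff_continuous)
  then have "continuous_on S (\<lambda>z. coeff (P z) i)" if "i \<le> N" for i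
    using that by (auto intro: continuous_at_imp_continuous_on)
  then have "continuous_on (S \<times> UNIV) (\<lambda>u. coeff (P (fst u)) i)" if "i \<le> N" for i
    using that by (auto intro!: continuous_on_compose2[of S "\<lambda>z. coeff (P z) i" "S \<times> UNIV" fst] continuous_intros)
  then have contq: "continuous_on (S \<times> UNIV) q"
    unfolding q_def divided_diff_def case_prod_unfold by (intro continuous_intros) auto
  have "open ((S \<times> UNIV) \<inter> (\<lambda>u. norm (q u)) -` {\<delta><..})"
    by (rule continuous_open_preimage[OF continuous_on_norm[OF contq] open_Times[OF S(1) open_UNIV] open_greaterThan])
  moreover have "(S \<times> UNIV) \<inter> (\<lambda>u. norm (q u)) -` {\<delta><..} = {u \<in> S \<times> UNIV. norm (q u) > \<delta>}" by auto
  ultimately have qopen: "open {u \<in> S \<times> UNIV. norm (q u) > \<delta>}" by simp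
  have "(z0, w0, w0) \<in> {u \<in> S \<times> UNIV. norm (q u) > \<delta>}"
    using S simple by (simp add: q_def \<delta>_def divided_diff(2)[OF deg])
  then obtain A B where A: "open A" "open B" "(z0, w0, w0) \<in> A \<times> B"
     "A \<times> B \<subseteq> {u \<in> S \<times> UNIV. norm (q u) > \<delta>}" by (rule open_prod_elim[OF qopen])
  then have "(w0, w0) \<in> B" "z0 \<in> A" by auto
  obtain B1 B2 where B: "open B1" "open B2" "(w0, w0) \<in> B1 \<times> B2" "B1 \<times> B2 \<subseteq> B"
    by (rule open_prod_elim[OF A(2) \<open>(w0, w0) \<in> B\<close>])
  have "open (B1 \<inter> B2)" "w0 \<in> B1 \<inter> B2" using B by auto
  then obtain r0 where r0: "r0 > 0" "ball w0 r0 \<subseteq> B1 \<inter> B2" by (meson open_contains_ball)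
  define r where "r = min r0 R"
  have r: "r > 0" "r \<le> R" using r0 R by (auto simp: r_def)
  have lower: "norm (divided_diff N (P z) x y) > \<delta>" if "z \<in> A" "x \<in> ball w0 r" "y \<in> ball w0 r" for z x y
  proof -
    have "(z, x, y) \<in> A \<times> B" using that r0 B(4) by (auto simp: r_def subset_iff)
    with A(4) show ?thesis by (auto simp: q_def)
  qed
  have AS: "A \<subseteq> S" using A by auto
  obtain T1 where T1: "open T1" "z0 \<in> T1" "\<And>z. z \<in> T1 \<Longrightarrow> \<exists>x\<in>ball w0 r. poly (P z) x = 0"
    using poly_root_near[where P = P and N = N and r = r and ?z0.0 = z0 and ?w0.0 = w0] contP[OF S(2)] deg lc root r by (auto simp: eventually_nhds)
  define T where "T = T1 \<inter> A"
  have T: "open T" "z0 \<in> T" "T \<subseteq> A" "T \<subseteq> S" using T1 A AS \<open>z0 \<in> A\<close> by (auto simp: T_def)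
  define w where "w z = (SOME x. x \<in> ball w0 r \<and> poly (P z) x = 0)" for z
  have w: "w z \<in> ball w0 r" "poly (P z) (w z) = 0" if "z \<in> T" for z
  proof -
    have "\<exists>x. x \<in> ball w0 r \<and> poly (P z) x = 0" using T1(3)[of z] that by (auto simp: T_def)
    from someI_ex[OF this] show "w z \<in> ball w0 r" "poly (P z) (w z) = 0" by (auto simp: w_def)
  qed
  have uniq: "x = w z" if "z \<in> T" "x \<in> ball w0 r" "poly (P z) x = 0" for z x
  proof -
    have "0 = (x - w z) * divided_diff N (P z) x (w z)"
      using divided_diff(1)[OF deg, of z x "w z"] w[OF that(1)] that by simp
    with lower[of z x "w z"] \<delta> w[OF that(1)] that T show ?thesis by auto
  qed
  have diff: "w z' - w z = - poly (P z') (w z) / divided_diff N (P z') (w z') (w z)"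
    and bound: "norm (w z' - w z) \<le> norm (poly (P z') (w z)) * (1 / \<delta>)" if "z \<in> T" "z' \<in> T" for z z'
  proof -
    have "norm (divided_diff N (P z') (w z') (w z)) > \<delta>" using lower w that T by blast
    moreover from this have "divided_diff N (P z') (w z') (w z) \<noteq> 0" using \<delta> by auto
    moreover have "- poly (P z') (w z) = (w z' - w z) * divided_diff N (P z') (w z') (w z)"
      using divided_diff(1)[OF deg, of z' "w z'" "w z"] w[OF that(2)] by simp
    ultimately show "w z' - w z = - poly (P z') (w z) / divided_diff N (P z') (w z') (w z)"
      by simp
    then have "norm (w z' - w z) = norm (poly (P z') (w z)) / norm (divided_diff N (P z') (w z') (w z))"
      by (simp add: norm_divide)
    also have "\<dots> \<le> norm (poly (P z') (w z)) / \<delta>"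
      using \<open>norm _ > \<delta>\<close> \<delta> by (intro divide_left_mono mult_pos_pos norm_ge_zero) linarith+
    finally show "norm (w z' - w z) \<le> norm (poly (P z') (w z)) * (1 / \<delta>)" by simp
  qed
  have "cdiff C w z" if z: "z \<in> T" for z
  proof -
    \<comment> \<open>With the root frozen at \<open>w z\<close>, \<open>G\<close> is differentiable
      and vanishes at \<open>z\<close>; the denominator \<open>Q\<close> contains the moving root
      and can so far only be shown to be continuous.\<close>
    define G where "G z' = poly (P z') (w z)" for z'
    define Q where "Q z' = divided_diff N (P z') (w z') (w z)" for z'
    have zS: "z \<in> S" using z T by auto
    have G: "cdiff C G z" unfolding G_def by (rule cdiff_poly[OF _ _ deg]) (use P zS in auto)
    have G0: "G z = 0" using w z by (simp add: G_def)
    have evT: "\<forall>\<^sub>F z' in at z. z' \<in> T" using T(1) z by (auto simp: eventually_at_topological)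
    have "((\<lambda>z'. w z' - w z) \<longlongrightarrow> 0) (at z)"
    proof (rule tendsto_0_le[where K = "1 / \<delta>"])
      show "(G \<longlongrightarrow> 0) (at z)" using cdiff_continuous[OF G] G0 by (simp add: isCont_def)
      show "\<forall>\<^sub>F z' in at z. norm (w z' - w z) \<le> norm (G z') * (1 / \<delta>)"
        using evT by eventually_elim (use bound z in \<open>auto simp: G_def\<close>)
    qed
    then have cw: "isCont w z" by (simp add: isCont_def LIM_zero_iff)
    have cQ: "isCont Q z" unfolding Q_def divided_diff_def
      by (intro continuous_intros cw contP zS) auto
    have "norm (Q z) > \<delta>" using lower w z T by (auto simp: Q_def)
    then have Qz: "Q z \<noteq> 0" using \<delta> by auto
    obtain G' where G': "G' \<in> C" "(G has_derivative G') (at z)" using G by (auto simp: cdiff_def)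
    have "((\<lambda>z'. G z' * (- 1 / Q z')) has_derivative (\<lambda>v. G' v * (- 1 / Q z))) (at z)"
      by (rule has_derivative_mult_continuous[OF G'(2) G0]) (intro continuous_intros cQ Qz)
    then have "cdiff C (\<lambda>z'. G z' * (- 1 / Q z')) z"
      unfolding cdiff_def using scale[OF G'(1)] by blast
    then have "cdiff C (\<lambda>z'. w z + G z' * (- 1 / Q z')) z" by (rule cdiff_add[OF cdiff_const])
    then show "cdiff C w z"
    proof (rule cdiff_cong_open[OF _ T(1) z])
      fix z' assume "z' \<in> T"
      then show "w z + G z' * (- 1 / Q z') = w z'"
        using diff[OF z] by (simp add: G_def Q_def diff_eq_eq)
    qed
  qed
  moreover have "w z0 = w0" using uniq[of z0 w0] T r root by simp
  ultimately show ?thesis using that[of T r w] T r w uniq by blast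
qed

section \<open>Cauchy integrals with a parameter\<close>

lemma deriv_eq_integral_circle:
  assumes "f holomorphic_on S" "open S" "cball z r \<subseteq> S" "x \<in> ball z r"
  shows "deriv f x = integral (cbox 0 1)
    (\<lambda>t. f (circlepath z r t) / (circlepath z r t - x)\<^sup>2 * (r * exp (2 * of_real pi * \<i> * t)))"
proof -
  have "continuous_on (cball z r) f" "f holomorphic_on ball z r"
    using assms(1,3) ball_subset_cball[of z r]
    by (meson holomorphic_on_imp_continuous_on holomorphic_on_subset order_trans)+
  then have "(f has_field_derivative (1 / (2 * of_real pi * \<i>) * contour_integral (circlepath z r) (\<lambda>u. f u / (u - x)\<^sup>2))) (at x)"
    using Cauchy_derivative_integral_circlepath assms(4) by blast
  then have "deriv f x = 1 / (2 * of_real pi * \<i>) * contour_integral (circlepath z r) (\<lambda>u. f u / (u - x)\<^sup>2)"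
    by (rule DERIV_imp_deriv)
  also have "\<dots> = 1 / (2 * of_real pi * \<i>) * integral {0..1} (\<lambda>t. f (circlepath z r t) / (circlepath z r t - x)\<^sup>2 *
      (2 * pi * \<i> * r * exp (2 * of_real pi * \<i> * t)))"
    unfolding contour_integral_integral
    by (intro arg_cong2[where f = "(*)"] integral_cong refl) (simp add: vector_derivative_circlepath)
  also have "\<dots> = integral {0..1} (\<lambda>t. 1 / (2 * of_real pi * \<i>) * (f (circlepath z r t) / (circlepath z r t - x)\<^sup>2 *
      (2 * pi * \<i> * r * exp (2 * of_real pi * \<i> * t))))"
    by (simp only: integral_mult_right)
  also have "\<dots> = integral (cbox 0 1) (\<lambda>t. f (circlepath z r t) / (circlepath z r t - x)\<^sup>2 * (r * exp (2 * of_real pi * \<i> * t)))"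
    unfolding cbox_interval by (intro integral_cong) (simp add: mult_ac)
  finally show ?thesis .
qed

lemma dist_circlepath: "dist z (circlepath z r t) = \<bar>r\<bar>"
  by (simp add: circlepath dist_norm norm_mult norm_exp_eq_Re)

lemma circlepath_minus_nonzero: "x \<in> ball z r \<Longrightarrow> circlepath z r t - x \<noteq> 0"
  by (auto simp: dist_circlepath)

lemma circlepath_in_cball: "r \<ge> 0 \<Longrightarrow> circlepath z r t \<in> cball z r"
  by (simp add: dist_circlepath)

lemma continuous_on_circlepath [continuous_intros]:
  "continuous_on S f \<Longrightarrow> continuous_on S (\<lambda>x. circlepath z r (f x))"
  unfolding circlepath by (intro continuous_intros)

lemma open_product_nbhd:
  assumes "open S" "(a, x) \<in> (S :: ('a::metric_space \<times> complex) set)"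
  obtains d where "d > 0" "ball a d \<times> cball x d \<subseteq> S"
proof -
  obtain A B where AB: "open A" "open B" "(a, x) \<in> A \<times> B" "A \<times> B \<subseteq> S"
    by (rule open_prod_elim[OF assms])
  obtain d1 where d1: "d1 > 0" "ball a d1 \<subseteq> A" using AB by (auto simp: open_contains_ball)
  obtain d2 where d2: "d2 > 0" "cball x d2 \<subseteq> B" using AB by (auto simp: open_contains_cball)
  show ?thesis
  proof (rule that[of "min d1 d2"])
    show "ball a (min d1 d2) \<times> cball x (min d1 d2) \<subseteq> S" using d1 d2 AB(4) by (auto simp: subset_iff)
  qed (use d1 d2 in auto)
qed

text \<open>By Cauchy's formula the derivative is an integral over a fixed interval of values of
  \<open>F\<close> on a circle, so it inherits joint continuity from \<open>F\<close>.\<close>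

lemma continuous_on_deriv_param:
  fixes F :: "'a::metric_space \<Rightarrow> complex \<Rightarrow> complex"
  assumes S: "open S" and cont: "continuous_on S (\<lambda>(a, x). F a x)"
    and hol: "\<And>a x. (a, x) \<in> S \<Longrightarrow> F a field_differentiable at x"
  shows "continuous_on S (\<lambda>(a, x). deriv (F a) x)"
proof (rule continuous_at_imp_continuous_on, rule ballI)
  fix u assume "u \<in> S"
  obtain a x where u: "u = (a, x)" by (cases u)
  with \<open>u \<in> S\<close> S obtain d where d: "d > 0" "ball a d \<times> cball x d \<subseteq> S" using open_product_nbhd by blast
  let ?N = "ball a d \<times> ball x d"
  let ?g = "\<lambda>(b, y) t. F b (circlepath x d t) / (circlepath x d t - y)\<^sup>2 * (d * exp (2 * of_real pi * \<i> * t))"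
  have cF: "continuous_on (?N \<times> cbox 0 1) (\<lambda>v. F (fst (fst v)) (circlepath x d (snd v)))"
  proof -
    have "continuous_on (?N \<times> cbox 0 1) (\<lambda>v. case (fst (fst v), circlepath x d (snd v)) of (a, x) \<Rightarrow> F a x)"
    proof (rule continuous_on_compose2[OF cont])
      show "(\<lambda>v. (fst (fst v), circlepath x d (snd v))) ` (?N \<times> cbox 0 1) \<subseteq> S"
        using d circlepath_in_cball[of d x] by (auto simp del: mem_cball simp: subset_iff)
    qed (intro continuous_intros)
    then show ?thesis by simp
  qed
  have "continuous_on ?N (\<lambda>v. integral (cbox 0 1) (?g v))"
  proof (rule integral_continuous_on_param)
    show "continuous_on (?N \<times> cbox 0 1) (\<lambda>(v, t). ?g v t)"
      unfolding case_prod_unfold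
      by (intro continuous_intros cF) (auto simp: dist_circlepath)
  qed
  then have "continuous_on ?N (\<lambda>(b, y). deriv (F b) y)"
  proof (rule continuous_on_eq)
    fix v assume "v \<in> ?N"
    then obtain b y where v: "v = (b, y)" "b \<in> ball a d" "y \<in> ball x d" by auto
    define T where "T = {w. (b, w) \<in> S}"
    have "open ((\<lambda>w. (b, w)) -` S)" by (intro open_vimage S continuous_intros)
    then have "open T" by (simp add: T_def vimage_def)
    moreover have "F b holomorphic_on T" using hol \<open>open T\<close>
      by (auto simp: holomorphic_on_open field_differentiable_def T_def)
    moreover have "cball x d \<subseteq> T" using d v by (auto simp: T_def)
    ultimately show "integral (cbox 0 1) (?g v) = (case v of (b, y) \<Rightarrow> deriv (F b) y)"
      unfolding v by (simp only: prod.case deriv_eq_integral_circle[OF _ _ _ v(3)])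
  qed
  then show "isCont (\<lambda>(a, x). deriv (F a) x) u"
    using d by (subst (asm) continuous_on_eq_continuous_at) (auto simp: u open_Times)
qed

text \<open>By Osgood's lemma this is equivalent to \<open>holo2\<close>; it is the notion for which closure under
  partial derivatives is easiest to prove, and the Frechet derivative is not needed for the curvature.\<close>

definition sep_holo :: "(point \<Rightarrow> complex) \<Rightarrow> point set \<Rightarrow> bool" where
  "sep_holo f U \<longleftrightarrow> open U \<and> continuous_on U f \<and>
    (\<forall>(x, y)\<in>U. (\<lambda>x. f (x, y)) field_differentiable at x \<and> (\<lambda>y. f (x, y)) field_differentiable at y)"

text \<open>The circle does not move with \<open>a\<close>, so the Cauchy integral can be
  differentiated in \<open>a\<close> under the integral sign. This supplies the mixed derivatives in
  \<open>sep_holo_pd\<close>.\<close>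

lemma deriv_param_holomorphic:
  assumes U: "open (U :: point set)" and cont: "continuous_on U (\<lambda>(a, x). F a x)"
    and hol: "\<And>a x. (a, x) \<in> U \<Longrightarrow> F a field_differentiable at x"
    and hol': "\<And>a x. (a, x) \<in> U \<Longrightarrow> (\<lambda>a. F a x) field_differentiable at a"
    and ax: "(a, x) \<in> U"
  shows "(\<lambda>a. deriv (F a) x) field_differentiable at a"
proof -
  obtain d where d: "d > 0" "ball a d \<times> cball x d \<subseteq> U" using open_product_nbhd[OF U ax] by blast
  define D where "D b w = deriv (\<lambda>b. F b w) b" for b w
  \<comment> \<open>The Leibniz rule asks for joint continuity of the derivative in the parameter:
    \<open>continuous_on_deriv_param\<close> with the two variables exchanged.\<close>
  have cD: "continuous_on U (\<lambda>(b, w). D b w)"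
  proof -
    let ?U = "(\<lambda>(w, b). (b, w)) -` U"
    have oU: "open ?U" by (intro open_vimage U) (auto simp: case_prod_unfold intro!: continuous_intros)
    have "continuous_on ?U (\<lambda>(w, b). F b w)"
    proof -
      have "continuous_on ?U (\<lambda>v. case (case v of (w, b) \<Rightarrow> (b, w)) of (b, w) \<Rightarrow> F b w)"
      proof (rule continuous_on_compose2[OF cont])
        show "continuous_on ?U (\<lambda>(w, b). (b, w))" by (auto simp: case_prod_unfold intro!: continuous_intros)
      qed auto
      then show ?thesis by (simp add: case_prod_unfold)
    qed
    from continuous_on_deriv_param[OF oU, of "\<lambda>w b. F b w", OF this]
    have c: "continuous_on ?U (\<lambda>(w, b). D b w)" using hol' by (auto simp: D_def)
    have "continuous_on U (\<lambda>v. case (case v of (b, w) \<Rightarrow> (w, b)) of (w, b) \<Rightarrow> D b w)"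
    proof (rule continuous_on_compose2[OF c])
      show "continuous_on U (\<lambda>(b, w). (w, b))" by (auto simp: case_prod_unfold intro!: continuous_intros)
    qed auto
    then show ?thesis by (simp add: case_prod_unfold)
  qed
  let ?c = "circlepath x d"
  let ?k = "\<lambda>t. (d * exp (2 * of_real pi * \<i> * t)) / (?c t - x)\<^sup>2"
  have x: "x \<in> ball x d" using d by simp
  have nz: "?c t - x \<noteq> 0" for t using circlepath_minus_nonzero[OF x] .
  have in_U: "(b, ?c t) \<in> U" if "b \<in> ball a d" for b t
    using d that circlepath_in_cball[of d x t] by (auto simp del: mem_cball mem_ball)
  have "(\<lambda>b. integral (cbox 0 1) (\<lambda>t. F b (?c t) * ?k t)) holomorphic_on ball a d"
  proof (rule leibniz_rule_holomorphic)
    show "((\<lambda>b. F b (?c t) * ?k t) has_field_derivative D b (?c t) * ?k t) (at b within ball a d)" if "b \<in> ball a d" for b t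
    proof -
      have "((\<lambda>b. F b (?c t)) has_field_derivative D b (?c t)) (at b)"
        unfolding D_def using hol'[OF in_U[OF that]] by (rule field_differentiable_derivI)
      then show ?thesis by (rule has_field_derivative_at_within[OF DERIV_cmult_right])
    qed
    show "(\<lambda>t. F b (?c t) * ?k t) integrable_on cbox 0 1" if "b \<in> ball a d" for b
    proof (rule integrable_continuous)
      have "continuous_on (cbox 0 1) (\<lambda>t. F b (?c t))"
      proof -
        have "continuous_on (cbox 0 1) (\<lambda>t. case (b, ?c t) of (a, x) \<Rightarrow> F a x)"
        proof (rule continuous_on_compose2[OF cont])
          show "(\<lambda>t. (b, ?c t)) ` cbox 0 1 \<subseteq> U" using in_U[OF that] by blast
        qed (intro continuous_intros)
        then show ?thesis by simp
      qed
      then show "continuous_on (cbox 0 1) (\<lambda>t. F b (?c t) * ?k t)"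
        by (intro continuous_intros) (use nz in auto)
    qed
    have "continuous_on (ball a d \<times> cbox 0 1) (\<lambda>v. D (fst v) (?c (snd v)))"
    proof -
      have "continuous_on (ball a d \<times> cbox 0 1) (\<lambda>v. case (fst v, ?c (snd v)) of (a, x) \<Rightarrow> D a x)"
      proof (rule continuous_on_compose2[OF cD])
        show "(\<lambda>v. (fst v, ?c (snd v))) ` (ball a d \<times> cbox 0 1) \<subseteq> U"
          using in_U by (auto simp del: mem_ball)
      qed (intro continuous_intros)
      then show ?thesis by simp
    qed
    then show "continuous_on (ball a d \<times> cbox 0 1) (\<lambda>(b, t). D b (?c t) * ?k t)"
      unfolding case_prod_unfold by (intro continuous_intros) (use nz in auto)
  qed auto
  then have fd: "(\<lambda>b. integral (cbox 0 1) (\<lambda>t. F b (?c t) * ?k t)) field_differentiable at a"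
    using d by (auto simp: holomorphic_on_open field_differentiable_def)
  have "integral (cbox 0 1) (\<lambda>t. F b (?c t) * ?k t) = deriv (F b) x" if "b \<in> ball a d" for b
  proof -
    define T where "T = {w. (b, w) \<in> U}"
    have "open ((\<lambda>w. (b, w)) -` U)" by (intro open_vimage U continuous_intros)
    then have T: "open T" by (simp add: T_def vimage_def)
    have "F b holomorphic_on T" using hol T
      by (auto simp: holomorphic_on_open field_differentiable_def T_def)
    moreover have "cball x d \<subseteq> T" using d that by (auto simp: T_def)
    ultimately show ?thesis
      using deriv_eq_integral_circle[OF _ T _ x] by simp
  qed
  then show ?thesis
    by (intro field_differentiable_transform_within[OF d(1) UNIV_I _ fd]) (simp add: dist_commute)
qed

text \<open>\<open>N\<close> and \<open>M\<close> below contain first derivatives of the slopes and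
  of \<open>h\<close>, and the curvature differentiates them once more.\<close>

lemma sep_holo_pd:
  assumes "sep_holo f U"
  shows "sep_holo (pdx f) U" "sep_holo (pdy f) U"
proof -
  have U: "open U" and cont: "continuous_on U f"
    and dx: "(x, y) \<in> U \<Longrightarrow> (\<lambda>x. f (x, y)) field_differentiable at x"
    and dy: "(x, y) \<in> U \<Longrightarrow> (\<lambda>y. f (x, y)) field_differentiable at y" for x y
    using assms by (auto simp: sep_holo_def)
  let ?U = "prod.swap -` U"
  have oU: "open ?U" by (intro open_vimage U continuous_on_swap)
  have c1: "continuous_on U (\<lambda>(x, y). f (x, y))" using cont by (simp add: case_prod_unfold)
  have c2: "continuous_on ?U (\<lambda>(y, x). f (x, y))"
  proof -
    have "continuous_on ?U (\<lambda>v. f (prod.swap v))"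
      by (rule continuous_on_compose2[OF cont continuous_on_swap]) auto
    then show ?thesis by (simp add: case_prod_unfold prod.swap_def)
  qed
  have "continuous_on U (\<lambda>(x, y). deriv (\<lambda>y. f (x, y)) y)"
    by (rule continuous_on_deriv_param[OF U c1]) (use dy in auto)
  then have C2: "continuous_on U (pdy f)" by (simp add: pdy_def[abs_def] case_prod_unfold)
  have "continuous_on ?U (\<lambda>(y, x). deriv (\<lambda>x. f (x, y)) x)"
    by (rule continuous_on_deriv_param[OF oU c2]) (use dx in auto)
  then have "continuous_on U (\<lambda>v. case prod.swap v of (y, x) \<Rightarrow> deriv (\<lambda>x. f (x, y)) x)"
    by (rule continuous_on_compose2[OF _ continuous_on_swap]) auto
  then have C1: "continuous_on U (pdx f)" by (simp add: pdx_def[abs_def] case_prod_unfold prod.swap_def)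
  have second: "deriv g field_differentiable at z" if "open T" "z \<in> T" "\<And>w. w \<in> T \<Longrightarrow> g field_differentiable at w" for g and z :: complex and T
  proof -
    have "g holomorphic_on T" using that by (auto simp: holomorphic_on_open field_differentiable_def)
    then have "deriv g holomorphic_on T" using that(1) by (rule holomorphic_deriv)
    then show ?thesis using that by (auto simp: holomorphic_on_open field_differentiable_def)
  qed
  have xx: "deriv (\<lambda>x. f (x, y)) field_differentiable at x" if "(x, y) \<in> U" for x y
  proof (rule second)
    show "open ((\<lambda>x. (x, y)) -` U)" by (intro open_vimage U continuous_intros)
  qed (use that dx in auto)
  have yy: "deriv (\<lambda>y. f (x, y)) field_differentiable at y" if "(x, y) \<in> U" for x y
  proof (rule second)
    show "open ((\<lambda>y. (x, y)) -` U)" by (intro open_vimage U continuous_intros)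
  qed (use that dy in auto)
  have yx: "(\<lambda>x. deriv (\<lambda>y. f (x, y)) y) field_differentiable at x" if "(x, y) \<in> U" for x y
    by (rule deriv_param_holomorphic[OF U c1 _ _ that]) (use dx dy in auto)
  have xy: "(\<lambda>y. deriv (\<lambda>x. f (x, y)) x) field_differentiable at y" if "(x, y) \<in> U" for x y
    by (rule deriv_param_holomorphic[OF oU c2]) (use that dx dy in auto)
  show "sep_holo (pdx f) U" "sep_holo (pdy f) U"
    using U C1 C2 xx yy xy yx by (auto simp: sep_holo_def pdx_def pdy_def)
qed

section \<open>Curvature of a web given by its slopes\<close>

definition has_pd :: "(point \<Rightarrow> complex) \<Rightarrow> complex \<Rightarrow> complex \<Rightarrow> point \<Rightarrow> bool" where
  "has_pd f fx fy p \<longleftrightarrow> ((\<lambda>x. f (x, snd p)) has_field_derivative fx) (at (fst p)) \<and>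
     ((\<lambda>y. f (fst p, y)) has_field_derivative fy) (at (snd p))"

lemma has_pdD: "has_pd f fx fy p \<Longrightarrow> pdx f p = fx" "has_pd f fx fy p \<Longrightarrow> pdy f p = fy"
  by (auto simp: has_pd_def pdx_def pdy_def DERIV_imp_deriv)

lemma has_pd_const: "has_pd (\<lambda>_. c) 0 0 p"
  by (auto simp: has_pd_def)

lemma has_pd_add: "has_pd f a b p \<Longrightarrow> has_pd g c d p \<Longrightarrow> has_pd (\<lambda>q. f q + g q) (a + c) (b + d) p"
  by (auto simp: has_pd_def intro: DERIV_add)

lemma has_pd_diff: "has_pd f a b p \<Longrightarrow> has_pd g c d p \<Longrightarrow> has_pd (\<lambda>q. f q - g q) (a - c) (b - d) p"
  by (auto simp: has_pd_def intro: DERIV_diff)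

lemma has_pd_mult: "has_pd f a b p \<Longrightarrow> has_pd g c d p \<Longrightarrow>
    has_pd (\<lambda>q. f q * g q) (a * g p + c * f p) (b * g p + d * f p) p"
  unfolding has_pd_def using DERIV_mult by fastforce

lemma has_pd_divide: "has_pd f a b p \<Longrightarrow> has_pd g c d p \<Longrightarrow> g p \<noteq> 0 \<Longrightarrow>
    has_pd (\<lambda>q. f q / g q) ((a * g p - f p * c) / (g p * g p)) ((b * g p - f p * d) / (g p * g p)) p"
  unfolding has_pd_def using DERIV_divide by fastforce

lemma has_pd_cong_open:
  assumes "has_pd f a b p" "open V" "p \<in> V" "\<And>q. q \<in> V \<Longrightarrow> f q = g q"
  shows "has_pd g a b p"
proof -
  have 1: "open ((\<lambda>x. (x, snd p)) -` V)" "open ((\<lambda>y. (fst p, y)) -` V)"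
    by (intro open_vimage assms continuous_intros)+
  have "((\<lambda>x. g (x, snd p)) has_field_derivative a) (at (fst p))"
    by (rule has_field_derivative_transform_within_open[where f = "\<lambda>x. f (x, snd p)", OF _ 1(1)]) (use assms in \<open>auto simp: has_pd_def\<close>)
  moreover have "((\<lambda>y. g (fst p, y)) has_field_derivative b) (at (snd p))"
    by (rule has_field_derivative_transform_within_open[where f = "\<lambda>y. f (fst p, y)", OF _ 1(2)]) (use assms in \<open>auto simp: has_pd_def\<close>)
  ultimately show ?thesis by (simp add: has_pd_def)
qed

lemma sep_holo_iff:
  "sep_holo f U \<longleftrightarrow> open U \<and> continuous_on U f \<and> (\<forall>p\<in>U. \<exists>a b. has_pd f a b p)"
  unfolding sep_holo_def has_pd_def field_differentiable_def by fastforce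

lemma sep_holo_has_pd: "sep_holo f U \<Longrightarrow> p \<in> U \<Longrightarrow> has_pd f (pdx f p) (pdy f p) p"
  unfolding sep_holo_iff using has_pdD by metis

lemma sep_holo_const: "open U \<Longrightarrow> sep_holo (\<lambda>_. c) U"
  unfolding sep_holo_iff using has_pd_const by (blast intro: continuous_on_const)

lemma sep_holo_add: "sep_holo f U \<Longrightarrow> sep_holo g U \<Longrightarrow> sep_holo (\<lambda>p. f p + g p) U"
  unfolding sep_holo_iff using has_pd_add by (blast intro: has_pd_add continuous_on_add)

lemma sep_holo_diff: "sep_holo f U \<Longrightarrow> sep_holo g U \<Longrightarrow> sep_holo (\<lambda>p. f p - g p) U"
  unfolding sep_holo_iff using has_pd_diff by (blast intro: continuous_on_diff)

lemma sep_holo_mult: "sep_holo f U \<Longrightarrow> sep_holo g U \<Longrightarrow> sep_holo (\<lambda>p. f p * g p) U"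
  unfolding sep_holo_iff using has_pd_mult by (blast intro: continuous_on_mult)

lemma sep_holo_divide: "sep_holo f U \<Longrightarrow> sep_holo g U \<Longrightarrow> (\<And>p. p \<in> U \<Longrightarrow> g p \<noteq> 0) \<Longrightarrow> sep_holo (\<lambda>p. f p / g p) U"
  unfolding sep_holo_iff using has_pd_divide by (blast intro: continuous_on_divide)

lemma sep_holo_sum: "open U \<Longrightarrow> (\<And>i. i \<in> A \<Longrightarrow> sep_holo (f i) U) \<Longrightarrow> sep_holo (\<lambda>p. \<Sum>i\<in>A. f i p) U"
  by (induction A rule: infinite_finite_induct) (auto intro: sep_holo_const sep_holo_add)

lemma has_derivative_imp_has_pd:
  assumes d: "(f has_derivative (\<lambda>v. a * fst v + b * snd v)) (at p)"
  shows "has_pd f a b p"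
proof -
  have "((\<lambda>x. (x, snd p)) has_derivative (\<lambda>v. (v, 0))) (at (fst p))"
    "((\<lambda>y. (fst p, y)) has_derivative (\<lambda>v. (0, v))) (at (snd p))"
    by (auto intro!: derivative_eq_intros)
  note compose = has_derivative_compose[OF this(1), of f "\<lambda>v. a * fst v + b * snd v"]
    has_derivative_compose[OF this(2), of f "\<lambda>v. a * fst v + b * snd v"]
  show ?thesis
    using compose d by (simp add: has_pd_def has_field_derivative_def)
qed

lemma holo2_has_derivative:
  assumes "holo2 f U" "p \<in> U"
  shows "(f has_derivative (\<lambda>v. pdx f p * fst v + pdy f p * snd v)) (at p)"
proof -
  obtain a b where d: "(f has_derivative (\<lambda>v. a * fst v + b * snd v)) (at p)"
    using assms by (auto simp: holo2_def)
  then have "pdx f p = a" "pdy f p = b" by (auto intro: has_pdD has_derivative_imp_has_pd)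
  with d show ?thesis by simp
qed

lemma holo2_imp_sep_holo:
  assumes "holo2 f U" shows "sep_holo f U"
  unfolding sep_holo_iff
proof (intro conjI ballI)
  show "open U" using assms by (simp add: holo2_def)
  show "continuous_on U f"
  proof (rule continuous_at_imp_continuous_on, rule ballI)
    fix p assume "p \<in> U"
    with assms show "isCont f p" unfolding holo2_def by (meson has_derivative_continuous)
  qed
next
  fix p assume "p \<in> U"
  with assms show "\<exists>a b. has_pd f a b p"
    using has_derivative_imp_has_pd unfolding holo2_def by blast
qed

text \<open>The form \<open>dx + t (dy - c dx)\<close>, normalised to take the value 1 on the vector \<open>(1, c)\<close>; its
  kernel is spanned by \<open>(- t, 1 - c t)\<close>.  It covers every direction except that of
  \<open>(1, c)\<close>.\<close>

definition lform :: "complex \<Rightarrow> complex \<Rightarrow> complex poly" where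
  "lform c t = [:t, 1 - c * t:]"

lemma wedge_lform: "wedge (lform c s) (lform c t) = t - s"
  by (simp add: wedge_def lform_def algebra_simps)

lemma wedge_scaled_lform:
  "wedge [:B, A - c * B:] (smult d (lform c t)) = d * (A * t - B)"
  by (simp add: wedge_def lform_def algebra_simps)

lemma ext_d_scaled_lform:
  assumes "has_pd r r1 r2 p" "has_pd s s1 s2 p" "has_pd t t1 t2 p"
  shows "ext_d (scaled (\<lambda>q. lform c (s q)) (\<lambda>q. lform c (t q)) (\<lambda>q. lform c (r q))) p =
     (t p - s p) * (r1 + c * r2) + r p * (t1 - s1 + c * (t2 - s2)) - (t2 - s2)"
proof -
  have 0: "coeff (scaled (\<lambda>q. lform c (s q)) (\<lambda>q. lform c (t q)) (\<lambda>q. lform c (r q)) q) 0 = (t q - s q) * r q"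
    and 1: "coeff (scaled (\<lambda>q. lform c (s q)) (\<lambda>q. lform c (t q)) (\<lambda>q. lform c (r q)) q) 1 = (t q - s q) * (1 - c * r q)" for q
    by (simp_all add: scaled_def wedge_lform) (simp_all add: lform_def)
  note d = has_pd_mult[OF has_pd_diff[OF assms(3,2)] assms(1)]
    has_pd_mult[OF has_pd_diff[OF assms(3,2)] has_pd_diff[OF has_pd_const has_pd_mult[OF has_pd_const assms(1)]]]
  show ?thesis unfolding ext_d_def 0 1
    by (subst has_pdD(1)[OF d(1)], subst has_pdD(2)[OF d(2)]) (simp add: algebra_simps)
qed

text \<open>The value \<open>A t - B\<close> at the slope \<open>t\<close> of one foliation, for \<open>\<eta> = A dx + B (dy - c dx)\<close> and
  \<open>d\<close> the difference of the slopes of the other two.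
  The two partial derivatives enter through \<open>Y = \<partial>\<^sub>x + c \<partial>\<^sub>y\<close> and
  \<open>\<partial>\<^sub>y\<close>, the frame dual to \<open>dx, dy - c dx\<close>.\<close>

definition eta_value :: "complex \<Rightarrow> complex \<Rightarrow> complex \<Rightarrow> complex \<Rightarrow> complex \<Rightarrow> complex" where
  "eta_value t Yt d Yd yd = (t * Yd - yd) / d + Yt"

lemma eta_value_flip: "eta_value t Yt (- d) (- Yd) (- yd) = eta_value t Yt d Yd yd"
proof -
  have "t * (- Yd) - (- yd) = - (t * Yd - yd)" by simp
  then show ?thesis unfolding eta_value_def by (simp only: minus_divide_divide)
qed

text \<open>Three linear equations for the two unknowns \<open>A\<close> and \<open>B\<close>. They
  are compatible because the three scaled forms add up to zero, hence so do their exterior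
  derivatives; two distinct slopes then determine the solution.\<close>

lemma eta_lform:
  assumes r: "has_pd r r1 r2 p" and s: "has_pd s s1 s2 p" and t: "has_pd t t1 t2 p"
    and ne: "r p \<noteq> s p" "s p \<noteq> t p" "t p \<noteq> r p"
  obtains A B where "eta (\<lambda>q. lform c (r q)) (\<lambda>q. lform c (s q)) (\<lambda>q. lform c (t q)) p = [:B, A - c * B:]"
    "A * r p - B = eta_value (r p) (r1 + c * r2) (t p - s p) (t1 - s1 + c * (t2 - s2)) (t2 - s2)"
    "A * s p - B = eta_value (s p) (s1 + c * s2) (r p - t p) (r1 - t1 + c * (r2 - t2)) (r2 - t2)"
    "A * t p - B = eta_value (t p) (t1 + c * t2) (s p - r p) (s1 - r1 + c * (s2 - r2)) (s2 - r2)"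
proof -
  let ?r = "\<lambda>q. lform c (r q)" and ?s = "\<lambda>q. lform c (s q)" and ?t = "\<lambda>q. lform c (t q)"
  define vr where "vr = eta_value (r p) (r1 + c * r2) (t p - s p) (t1 - s1 + c * (t2 - s2)) (t2 - s2)"
  define vs where "vs = eta_value (s p) (s1 + c * s2) (r p - t p) (r1 - t1 + c * (r2 - t2)) (r2 - t2)"
  define vt where "vt = eta_value (t p) (t1 + c * t2) (s p - r p) (s1 - r1 + c * (s2 - r2)) (s2 - r2)"
  have Dr: "ext_d (scaled ?s ?t ?r) p = (t p - s p) * vr"
    unfolding ext_d_scaled_lform[OF r s t] vr_def eta_value_def using ne by (simp add: field_simps)
  have Ds: "ext_d (scaled ?t ?r ?s) p = (r p - t p) * vs"
    unfolding ext_d_scaled_lform[OF s t r] vs_def eta_value_def using ne by (simp add: field_simps)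
  have Dt: "ext_d (scaled ?r ?s ?t) p = (s p - r p) * vt"
    unfolding ext_d_scaled_lform[OF t r s] vt_def eta_value_def using ne by (simp add: field_simps)
  have sum0: "(t p - s p) * vr + (r p - t p) * vs + (s p - r p) * vt = 0"
    unfolding Dr[symmetric] Ds[symmetric] Dt[symmetric] ext_d_scaled_lform[OF r s t] ext_d_scaled_lform[OF s t r] ext_d_scaled_lform[OF t r s]
    by (simp add: algebra_simps)
  define A where "A = (vr - vs) / (r p - s p)"
  define B where "B = A * r p - vr"
  have 1: "A * r p - B = vr" by (simp add: B_def)
  have "A * (r p - s p) = vr - vs" using ne by (simp add: A_def)
  then have 2: "A * s p - B = vs" by (simp add: B_def algebra_simps)
  have "(s p - r p) * (A * t p - B) = (s p - r p) * vt"
  proof -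
    have "(t p - s p) * (A * r p - B) + (r p - t p) * (A * s p - B) + (s p - r p) * (A * t p - B) = 0"
      by (simp add: algebra_simps)
    with sum0 show ?thesis unfolding 1 2 by (metis add_left_cancel)
  qed
  then have 3: "A * t p - B = vt" using ne by simp
  have "eta ?r ?s ?t p = [:B, A - c * B:]"
    unfolding eta_def
  proof (rule the_equality)
    show "degree [:B, A - c * B:] \<le> 1 \<and>
      ext_d (scaled ?s ?t ?r) p = wedge [:B, A - c * B:] (scaled ?s ?t ?r p) \<and>
      ext_d (scaled ?t ?r ?s) p = wedge [:B, A - c * B:] (scaled ?t ?r ?s p) \<and>
      ext_d (scaled ?r ?s ?t) p = wedge [:B, A - c * B:] (scaled ?r ?s ?t p)"
      unfolding Dr Ds Dt scaled_def wedge_lform wedge_scaled_lform 1 2 3 by auto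
  next
    fix h assume h: "degree h \<le> 1 \<and>
      ext_d (scaled ?s ?t ?r) p = wedge h (scaled ?s ?t ?r p) \<and>
      ext_d (scaled ?t ?r ?s) p = wedge h (scaled ?t ?r ?s p) \<and>
      ext_d (scaled ?r ?s ?t) p = wedge h (scaled ?r ?s ?t p)"
    define b where "b = coeff h 0"
    define a where "a = coeff h 1 + c * b"
    have hp: "h = [:b, a - c * b:]"
      using h by (intro poly_eqI) (auto simp: a_def b_def coeff_pCons coeff_eq_0 split: nat.split)
    have "(t p - s p) * (a * r p - b) = (t p - s p) * vr" "(r p - t p) * (a * s p - b) = (r p - t p) * vs"
      using h unfolding Dr Ds scaled_def wedge_lform hp wedge_scaled_lform by auto
    then have e: "a * r p - b = vr" "a * s p - b = vs" using ne by auto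
    have "a * (r p - s p) = vr - vs" unfolding e[symmetric] by (simp add: algebra_simps)
    then have "a = A" using ne by (simp add: A_def field_simps)
    moreover from this have "b = B" by (simp add: B_def e(1)[symmetric])
    ultimately show "h = [:B, A - c * B:]" by (simp add: hp)
  qed
  with 1 2 3 that show ?thesis unfolding vr_def vs_def vt_def by blast
qed

text \<open>Replacing \<open>s\<close> by \<open>- s\<close> exchanges the two summands. Their mean
  is therefore even in \<open>s\<close>, and over the common denominator \<open>q\<close> only
  \<open>h\<close> and its derivatives remain of it.\<close>

lemma eta_value_conjugate_pair:
  fixes a s Ya Ys ya ys t Yt yt :: complex
  assumes "t - (a + s) \<noteq> 0" "t - (a - s) \<noteq> 0" "g = t - a" "Yg = Yt - Ya" "yg = yt - ya"
    and h: "h = s\<^sup>2" "Yh = 2 * s * Ys" "yh = 2 * s * ys"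
    and q: "q = g\<^sup>2 - h" "Yq = 2 * g * Yg - Yh" "yq = 2 * g * yg - yh"
  shows "(eta_value (a + s) (Ya + Ys) (t - (a - s)) (Yt - (Ya - Ys)) (yt - (ya - ys)) +
     eta_value (a - s) (Ya - Ys) (a + s - t) (Ya + Ys - Yt) (ya + ys - yt)) / 2 =
     ((a * Yq - yq) + g * Yh - 2 * h * Yg) / (2 * q) + Ya"
proof -
  have q0: "q = (g + s) * (g - s)" by (simp add: q h power2_eq_square algebra_simps)
  have nz: "g + s \<noteq> 0" "g - s \<noteq> 0" using assms(1-3) by (auto simp: algebra_simps)
  have e: "t - (a - s) = g + s" "a + s - t = - (g - s)" "Yt - (Ya - Ys) = Yg + Ys" "yt - (ya - ys) = yg + ys"
    "Ya + Ys - Yt = - (Yg - Ys)" "ya + ys - yt = - (yg - ys)"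
    using assms by auto
  have "(eta_value (a + s) (Ya + Ys) (t - (a - s)) (Yt - (Ya - Ys)) (yt - (ya - ys)) +
     eta_value (a - s) (Ya - Ys) (a + s - t) (Ya + Ys - Yt) (ya + ys - yt)) =
     ((a + s) * (Yg + Ys) - (yg + ys)) / (g + s) + ((a - s) * (Yg - Ys) - (yg - ys)) / (g - s) + 2 * Ya"
    unfolding e eta_value_flip unfolding eta_value_def by simp
  also have "((a + s) * (Yg + Ys) - (yg + ys)) / (g + s) + ((a - s) * (Yg - Ys) - (yg - ys)) / (g - s) =
      (((a + s) * (Yg + Ys) - (yg + ys)) * (g - s) + ((a - s) * (Yg - Ys) - (yg - ys)) * (g + s)) / q"
    unfolding q0 using nz by (simp add: add_frac_eq)
  also have "((a + s) * (Yg + Ys) - (yg + ys)) * (g - s) + ((a - s) * (Yg - Ys) - (yg - ys)) * (g + s) =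
      (a * Yq - yq) + g * Yh - 2 * h * Yg"
    unfolding q h by (simp add: power2_eq_square algebra_simps)
  finally show ?thesis by (simp add: add_divide_distrib)
qed

text \<open>Here the conjugate slopes lie in different triples; the sum over both choices of sign is
  even in \<open>s\<close>, again with the common denominator \<open>q\<close>.\<close>

lemma eta_value_sum_conjugates:
  fixes a s Ya Ys ya ys t Yt yt u Yu :: complex
  assumes "t - (a + s) \<noteq> 0" "t - (a - s) \<noteq> 0" "g = t - a" "Yg = Yt - Ya" "yg = yt - ya"
    and h: "h = s\<^sup>2" "Yh = 2 * s * Ys" "yh = 2 * s * ys"
    and q: "q = g\<^sup>2 - h" "Yq = 2 * g * Yg - Yh" "yq = 2 * g * yg - yh"
  shows "eta_value u Yu (t - (a + s)) (Yt - (Ya + Ys)) (yt - (ya + ys)) +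
     eta_value u Yu (t - (a - s)) (Yt - (Ya - Ys)) (yt - (ya - ys)) = (u * Yq - yq) / q + 2 * Yu"
proof -
  have q0: "q = (g - s) * (g + s)" by (simp add: q h power2_eq_square algebra_simps)
  have nz: "g + s \<noteq> 0" "g - s \<noteq> 0" using assms(1-3) by (auto simp: algebra_simps)
  have e: "t - (a - s) = g + s" "t - (a + s) = g - s" "Yt - (Ya - Ys) = Yg + Ys" "yt - (ya - ys) = yg + ys"
    "Yt - (Ya + Ys) = Yg - Ys" "yt - (ya + ys) = yg - ys"
    using assms by auto
  have "(u * (Yg - Ys) - (yg - ys)) / (g - s) + (u * (Yg + Ys) - (yg + ys)) / (g + s) =
    ((u * (Yg - Ys) - (yg - ys)) * (g + s) + (u * (Yg + Ys) - (yg + ys)) * (g - s)) / q"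
    unfolding q0 using nz by (simp add: add_frac_eq)
  also have "(u * (Yg - Ys) - (yg - ys)) * (g + s) + (u * (Yg + Ys) - (yg + ys)) * (g - s) = u * Yq - yq"
    unfolding q h by (simp add: power2_eq_square algebra_simps)
  finally show ?thesis unfolding eta_value_def e by simp
qed

definition pdY :: "complex \<Rightarrow> (point \<Rightarrow> complex) \<Rightarrow> point \<Rightarrow> complex" where
  "pdY c f p = pdx f p + c * pdy f p"

text \<open>The web has slopes \<open>a \<plusminus> s\<close> with \<open>s\<^sup>2 = h\<close>, and \<open>t i\<close> for \<open>i < k\<close>.
  With \<open>\<eta> = A dx + B (dy - c dx)\<close>, \<open>ee i\<close> is the value \<open>A a - B\<close> for the triple
  \<open>(a + s, a - s, t i)\<close> and \<open>nn i\<close> is \<open>h A\<close>; \<open>v2 i j\<close> and \<open>A2 i j\<close> are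
  \<open>A (t i) - B\<close> and \<open>A\<close> for the sum of the two triples \<open>(a \<plusminus> s, t i, t j)\<close>, and
  \<open>v3\<close>, \<open>A3\<close> are the same for \<open>(t i, t j, t l)\<close>.  The total is
  \<open>(N dx + M (dy - c dx)) / h\<close>.\<close>

locale slopes =
  fixes c :: complex and k :: nat and a h :: "point \<Rightarrow> complex" and t :: "nat \<Rightarrow> point \<Rightarrow> complex"
begin

text \<open>The product of the differences of \<open>t i\<close> to the two conjugate slopes, that
  is the value of the quadratic factor on the direction of slope \<open>t i\<close>.\<close>

definition q :: "nat \<Rightarrow> point \<Rightarrow> complex" where
  "q i p = (t i p - a p) * (t i p - a p) - h p"

definition ee :: "nat \<Rightarrow> point \<Rightarrow> complex" where
  "ee i p = ((a p * pdY c (q i) p - pdy (q i) p) + (t i p - a p) * pdY c h p - 2 * h p * (pdY c (t i) p - pdY c a p)) / (2 * q i p) + pdY c a p"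

text \<open>For the triple \<open>(a + s, a - s, t i)\<close> the value \<open>A (t i) - B\<close>
  has the polar part \<open>(t i * Yh - h_y) / (2 h)\<close>. Subtracting the value
  \<open>ee i\<close> at \<open>a\<close> and dividing by \<open>t i - a\<close> gives
  \<open>A\<close>.\<close>

definition nn :: "nat \<Rightarrow> point \<Rightarrow> complex" where
  "nn i p = ((t i p * pdY c h p - pdy h p) / 2 + h p * (pdY c (t i) p - ee i p)) / (t i p - a p)"

definition v2 :: "nat \<Rightarrow> nat \<Rightarrow> point \<Rightarrow> complex" where
  "v2 i j p = (t i p * pdY c (q j) p - pdy (q j) p) / q j p + 2 * pdY c (t i) p"

definition A2 :: "nat \<Rightarrow> nat \<Rightarrow> point \<Rightarrow> complex" where
  "A2 i j p = (v2 i j p - v2 j i p) / (t i p - t j p)"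

definition v3 :: "nat \<Rightarrow> nat \<Rightarrow> nat \<Rightarrow> point \<Rightarrow> complex" where
  "v3 i j l p = (t i p * (pdY c (t l) p - pdY c (t j) p) - (pdy (t l) p - pdy (t j) p)) / (t l p - t j p) + pdY c (t i) p"

definition A3 :: "nat \<Rightarrow> nat \<Rightarrow> nat \<Rightarrow> point \<Rightarrow> complex" where
  "A3 i j l p = (v3 i j l p - v3 j l i p) / (t i p - t j p)"

definition N :: "point \<Rightarrow> complex" where
  "N p = (\<Sum>i<k. nn i p) + h p * ((\<Sum>j<k. \<Sum>i<j. A2 i j p) + (\<Sum>l<k. \<Sum>j<l. \<Sum>i<j. A3 i j l p))"

definition M :: "point \<Rightarrow> complex" where
  "M p = (\<Sum>i<k. a p * nn i p - h p * ee i p) + h p * ((\<Sum>j<k. \<Sum>i<j. t i p * A2 i j p - v2 i j p)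
     + (\<Sum>l<k. \<Sum>j<l. \<Sum>i<j. t i p * A3 i j l p - v3 i j l p))"

end

text \<open>The nonvanishing conditions are those on the denominators that occur. On
  \<open>h = 0\<close> the one on \<open>t i - a\<close> follows from the one on \<open>q i\<close>;
  elsewhere it says that no simple slope is the mean of the conjugate ones.\<close>

locale slopes_on = slopes +
  fixes U :: "point set"
  assumes U: "open U" and a: "sep_holo a U" and h: "sep_holo h U" and t: "\<And>i. i < k \<Longrightarrow> sep_holo (t i) U"
    and g_nz: "\<And>i p. i < k \<Longrightarrow> p \<in> U \<Longrightarrow> t i p \<noteq> a p"
    and q_nz: "\<And>i p. i < k \<Longrightarrow> p \<in> U \<Longrightarrow> q i p \<noteq> 0"
    and t_ne: "\<And>i j p. i < k \<Longrightarrow> j < k \<Longrightarrow> i \<noteq> j \<Longrightarrow> p \<in> U \<Longrightarrow> t i p \<noteq> t j p"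
begin

lemma sep_holo_pdY: "sep_holo f U \<Longrightarrow> sep_holo (pdY c f) U"
  unfolding pdY_def[abs_def] by (intro sep_holo_add sep_holo_mult sep_holo_const sep_holo_pd U)

lemma sep_holo_q: "i < k \<Longrightarrow> sep_holo (q i) U"
  unfolding q_def[abs_def] by (intro sep_holo_diff sep_holo_mult t a h)

lemma sep_holo_ee: "i < k \<Longrightarrow> sep_holo (ee i) U"
  unfolding ee_def[abs_def]
  by (intro sep_holo_add sep_holo_diff sep_holo_mult sep_holo_divide sep_holo_pdY sep_holo_pd sep_holo_q t a h sep_holo_const U)
    (auto simp: q_nz)

lemma sep_holo_nn: "i < k \<Longrightarrow> sep_holo (nn i) U"
  unfolding nn_def[abs_def]
  by (intro sep_holo_add sep_holo_diff sep_holo_mult sep_holo_divide sep_holo_pdY sep_holo_pd sep_holo_ee t a h sep_holo_const U)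
    (auto simp: g_nz)

lemma sep_holo_v2: "i < k \<Longrightarrow> j < k \<Longrightarrow> sep_holo (v2 i j) U"
  unfolding v2_def[abs_def]
  by (intro sep_holo_add sep_holo_diff sep_holo_mult sep_holo_divide sep_holo_pdY sep_holo_pd sep_holo_q t a h sep_holo_const U)
    (auto simp: q_nz)

lemma sep_holo_A2: "i < k \<Longrightarrow> j < k \<Longrightarrow> i \<noteq> j \<Longrightarrow> sep_holo (A2 i j) U"
  unfolding A2_def[abs_def] by (intro sep_holo_divide sep_holo_diff sep_holo_v2 t) (auto simp: t_ne)

lemma sep_holo_v3: "i < k \<Longrightarrow> j < k \<Longrightarrow> l < k \<Longrightarrow> j \<noteq> l \<Longrightarrow> sep_holo (v3 i j l) U"
  unfolding v3_def[abs_def]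
  by (intro sep_holo_add sep_holo_diff sep_holo_mult sep_holo_divide sep_holo_pdY sep_holo_pd t) (auto simp: t_ne)

lemma sep_holo_A3: "i < k \<Longrightarrow> j < k \<Longrightarrow> l < k \<Longrightarrow> j \<noteq> l \<Longrightarrow> i \<noteq> j \<Longrightarrow> i \<noteq> l \<Longrightarrow> sep_holo (A3 i j l) U"
  unfolding A3_def[abs_def] by (intro sep_holo_divide sep_holo_diff sep_holo_v3 t) (auto simp: t_ne)

lemma sep_holo_N: "sep_holo N U"
  unfolding N_def[abs_def]
  by (intro sep_holo_add sep_holo_mult sep_holo_sum sep_holo_nn sep_holo_A2 sep_holo_A3 h U) auto

lemma sep_holo_M: "sep_holo M U"
  unfolding M_def[abs_def]
  by (intro sep_holo_add sep_holo_diff sep_holo_mult sep_holo_sum sep_holo_nn sep_holo_ee sep_holo_v2 sep_holo_v3 sep_holo_A2 sep_holo_A3 a t h U) auto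

end

lemma sum_lessThan_add_2: "(\<Sum>i<n+2. f i) = f 0 + f 1 + (\<Sum>i<n. f (i + 2))" for f :: "nat \<Rightarrow> 'b::comm_monoid_add"
  by (simp add: sum.lessThan_Suc_shift add.assoc del: sum.lessThan_Suc)

text \<open>Triples are sorted by how many of the indices 0 and 1, which will stand for the
  conjugate foliations, they contain.\<close>

lemma sum_triples_add_2:
  fixes F :: "nat \<Rightarrow> nat \<Rightarrow> nat \<Rightarrow> 'b::comm_monoid_add"
  shows "(\<Sum>t<k+2. \<Sum>s<t. \<Sum>r<s. F r s t) = (\<Sum>j<k. F 0 1 (j + 2)) +
    (\<Sum>j<k. \<Sum>i<j. F 0 (i + 2) (j + 2) + F 1 (i + 2) (j + 2)) +
    (\<Sum>l<k. \<Sum>j<l. \<Sum>i<j. F (i + 2) (j + 2) (l + 2))"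
  unfolding sum_lessThan_add_2 by (simp add: sum.distrib add.assoc)

lemma linear_pair:
  fixes A B u v m n :: complex
  assumes "A * u - B = m" "A * v - B = n" "u \<noteq> v"
  shows "A = (m - n) / (u - v)" "B = A * u - m"
proof -
  have "A * (u - v) = m - n" using assms(1,2) by (auto simp: algebra_simps)
  then show "A = (m - n) / (u - v)" using assms(3) by (simp add: field_simps)
  show "B = A * u - m" using assms(1) by auto
qed

lemma sum_add_mult: "(sum f I + Y + Z) * x = (\<Sum>i\<in>I. f i * x) + x * (Y + Z)" for x :: complex
  unfolding sum_distrib_right[symmetric] by (simp add: algebra_simps)

section \<open>The total of the forms \<eta> and its exterior derivative\<close>

context slopes_on
begin

definition L :: "(point \<Rightarrow> complex) \<Rightarrow> nat \<Rightarrow> sform" where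
  "L s = case_nat (\<lambda>p. lform c (a p + s p)) (case_nat (\<lambda>p. lform c (a p - s p)) (\<lambda>i p. lform c (t i p)))"

lemma L_simps: "L s 0 = (\<lambda>p. lform c (a p + s p))" "L s (Suc 0) = (\<lambda>p. lform c (a p - s p))"
   "L s (Suc (Suc i)) = (\<lambda>p. lform c (t i p))"
  by (auto simp: L_def)

context
  fixes s V p
  assumes V: "open V" "V \<subseteq> U" "p \<in> V" and s: "sep_holo s V" and sq: "\<And>p. p \<in> V \<Longrightarrow> s p * s p = h p" and hp: "h p \<noteq> 0"
begin

lemma pU: "p \<in> U" using V by auto

lemma has_pd_s: "has_pd s (pdx s p) (pdy s p) p" using sep_holo_has_pd[OF s V(3)] .
lemma has_pd_a: "has_pd a (pdx a p) (pdy a p) p" using sep_holo_has_pd[OF a pU] .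
lemma has_pd_t: "i < k \<Longrightarrow> has_pd (t i) (pdx (t i) p) (pdy (t i) p) p" using sep_holo_has_pd[OF t pU] .

lemma h_jet: "h p = (s p)\<^sup>2" "pdY c h p = 2 * s p * pdY c s p" "pdy h p = 2 * s p * pdy s p"
proof -
  have "has_pd h (pdx s p * s p + pdx s p * s p) (pdy s p * s p + pdy s p * s p) p"
    by (rule has_pd_cong_open[OF has_pd_mult[OF has_pd_s has_pd_s] V(1,3)]) (rule sq)
  from has_pdD[OF this] show "pdY c h p = 2 * s p * pdY c s p" "pdy h p = 2 * s p * pdy s p"
    by (simp_all add: pdY_def algebra_simps)
  show "h p = (s p)\<^sup>2" using sq[OF V(3)] by (simp add: power2_eq_square)
qed

lemma s_nz: "s p \<noteq> 0" using h_jet(1) hp by auto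

lemma q_jet:
  assumes "i < k"
  shows "q i p = (t i p - a p)\<^sup>2 - h p"
    "pdY c (q i) p = 2 * (t i p - a p) * (pdY c (t i) p - pdY c a p) - pdY c h p"
    "pdy (q i) p = 2 * (t i p - a p) * (pdy (t i) p - pdy a p) - pdy h p"
proof -
  note d = has_pd_diff[OF has_pd_mult[OF has_pd_diff[OF has_pd_t[OF assms] has_pd_a] has_pd_diff[OF has_pd_t[OF assms] has_pd_a]] sep_holo_has_pd[OF h pU]]
  have "has_pd (q i) ((pdx (t i) p - pdx a p) * (t i p - a p) + (pdx (t i) p - pdx a p) * (t i p - a p) - pdx h p)
    ((pdy (t i) p - pdy a p) * (t i p - a p) + (pdy (t i) p - pdy a p) * (t i p - a p) - pdy h p) p"
    unfolding q_def[abs_def] by (rule d)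
  note Q = has_pdD[OF this]
  show "pdY c (q i) p = 2 * (t i p - a p) * (pdY c (t i) p - pdY c a p) - pdY c h p"
    "pdy (q i) p = 2 * (t i p - a p) * (pdy (t i) p - pdy a p) - pdy h p"
    unfolding pdY_def Q by (simp_all add: algebra_simps)
qed (simp add: q_def power2_eq_square)

lemma t_ne_pm:
  assumes "i < k" shows "t i p - (a p + s p) \<noteq> 0" "t i p - (a p - s p) \<noteq> 0"
proof -
  have "q i p = (t i p - (a p + s p)) * (t i p - (a p - s p))"
    by (simp add: q_def sq[OF V(3), symmetric] algebra_simps)
  with q_nz[OF assms pU] show "t i p - (a p + s p) \<noteq> 0" "t i p - (a p - s p) \<noteq> 0" by auto
qed

lemma eta_pm:
  assumes i: "i < k"
  defines "E \<equiv> eta (L s 0) (L s 1) (L s (i + 2)) p"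
  shows "coeff E 0 * h p = a p * nn i p - h p * ee i p"
    "(coeff E 1 + c * coeff E 0) * h p = nn i p"
proof -
  note pm = t_ne_pm[OF i]
  obtain A B where E: "E = [:B, A - c * B:]"
    and 1: "A * (a p + s p) - B = eta_value (a p + s p) (pdY c a p + pdY c s p) (t i p - (a p - s p)) (pdY c (t i) p - (pdY c a p - pdY c s p)) (pdy (t i) p - (pdy a p - pdy s p))"
    and 2: "A * (a p - s p) - B = eta_value (a p - s p) (pdY c a p - pdY c s p) (a p + s p - t i p) (pdY c a p + pdY c s p - pdY c (t i) p) (pdy a p + pdy s p - pdy (t i) p)"
    and 3: "A * t i p - B = eta_value (t i p) (pdY c (t i) p) (a p - s p - (a p + s p)) (pdY c a p - pdY c s p - (pdY c a p + pdY c s p)) (pdy a p - pdy s p - (pdy a p + pdy s p))"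
  proof (rule eta_lform[OF has_pd_add[OF has_pd_a has_pd_s] has_pd_diff[OF has_pd_a has_pd_s] has_pd_t[OF i], of c])
    show "a p + s p \<noteq> a p - s p" using s_nz by (auto simp: eq_diff_eq add.assoc)
    show "a p - s p \<noteq> t i p" "t i p \<noteq> a p + s p" using pm by auto
  next
    fix A B
    assume "eta (\<lambda>q. lform c (a q + s q)) (\<lambda>q. lform c (a q - s q)) (\<lambda>q. lform c (t i q)) p = [:B, A - c * B:]"
      "A * (a p + s p) - B = eta_value (a p + s p) (pdx a p + pdx s p + c * (pdy a p + pdy s p)) (t i p - (a p - s p))
        (pdx (t i) p - (pdx a p - pdx s p) + c * (pdy (t i) p - (pdy a p - pdy s p))) (pdy (t i) p - (pdy a p - pdy s p))"
      "A * (a p - s p) - B = eta_value (a p - s p) (pdx a p - pdx s p + c * (pdy a p - pdy s p)) (a p + s p - t i p)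
        (pdx a p + pdx s p - pdx (t i) p + c * (pdy a p + pdy s p - pdy (t i) p)) (pdy a p + pdy s p - pdy (t i) p)"
      "A * t i p - B = eta_value (t i p) (pdx (t i) p + c * pdy (t i) p) (a p - s p - (a p + s p))
        (pdx a p - pdx s p - (pdx a p + pdx s p) + c * (pdy a p - pdy s p - (pdy a p + pdy s p))) (pdy a p - pdy s p - (pdy a p + pdy s p))"
    then show thesis
      by (intro that) (simp_all add: E_def L_simps pdY_def algebra_simps)
  qed
  \<comment> \<open>The values at \<open>a + s\<close> and \<open>a - s\<close> depend on the
    branch; their mean, the value at \<open>a\<close>, does not.\<close>
  have "A * a p - B = ((A * (a p + s p) - B) + (A * (a p - s p) - B)) / 2"
    by (simp add: field_simps)
  also have "\<dots> = ee i p"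
    unfolding 1 2 ee_def using eta_value_conjugate_pair[OF pm refl refl refl h_jet q_jet[OF i]] .
  finally have e: "A * a p - B = ee i p" .
  \<comment> \<open>The conjugate slopes differ by \<open>2 s\<close>, and
    \<open>Ys / s = Yh / (2 h)\<close>. This is where the pole along \<open>h = 0\<close>
    arises.\<close>
  have "A * t i p - B = eta_value (t i p) (pdY c (t i) p) (- (2 * s p)) (- (2 * pdY c s p)) (- (2 * pdy s p))"
    unfolding 3 by (simp add: algebra_simps)
  also have "\<dots> = (t i p * pdY c h p - pdy h p) / (2 * h p) + pdY c (t i) p"
    unfolding eta_value_flip eta_value_def h_jet using s_nz by (simp add: field_simps power2_eq_square)
  finally have m: "A * t i p - B = (t i p * pdY c h p - pdy h p) / (2 * h p) + pdY c (t i) p" .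
  have "t i p - a p \<noteq> 0" using g_nz[OF i pU] by simp
  have "A * (t i p - a p) = (A * t i p - B) - (A * a p - B)" by (simp add: algebra_simps)
  also have "\<dots> = (t i p * pdY c h p - pdy h p) / (2 * h p) + pdY c (t i) p - ee i p" unfolding m e ..
  finally have "A * (t i p - a p) * h p = (t i p * pdY c h p - pdy h p) / 2 + h p * (pdY c (t i) p - ee i p)"
    using hp by (simp add: field_simps)
  then have A: "A * h p = nn i p" unfolding nn_def using \<open>t i p - a p \<noteq> 0\<close> by (simp add: field_simps)
  have "B = a p * A - ee i p" using e by (simp add: algebra_simps)
  then have "B * h p = a p * nn i p - h p * ee i p" unfolding A[symmetric]
    by (simp only:) (simp add: algebra_simps)
  with A show "coeff E 0 * h p = a p * nn i p - h p * ee i p"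
    "(coeff E 1 + c * coeff E 0) * h p = nn i p" by (simp_all add: E)
qed

text \<open>Each of the two triples depends on the branch \<open>s\<close>, their sum does not; its
  values at the two simple slopes determine its coefficients.\<close>

lemma eta_2:
  assumes i: "i < k" and j: "j < k" and ij: "i \<noteq> j"
  defines "E \<equiv> eta (L s 0) (L s (i + 2)) (L s (j + 2)) p + eta (L s 1) (L s (i + 2)) (L s (j + 2)) p"
  shows "coeff E 0 = t i p * A2 i j p - v2 i j p" "coeff E 1 + c * coeff E 0 = A2 i j p"
proof -
  have tij: "t i p \<noteq> t j p" using t_ne[OF i j ij pU] .
  have single: "\<exists>A B. eta (\<lambda>q. lform c (u q)) (L s (i + 2)) (L s (j + 2)) p = [:B, A - c * B:] \<and>
      A * t i p - B = eta_value (t i p) (pdY c (t i) p) (t j p - u p) (pdY c (t j) p - (u1 + c * u2)) (pdy (t j) p - u2) \<and>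
      A * t j p - B = eta_value (t j p) (pdY c (t j) p) (t i p - u p) (pdY c (t i) p - (u1 + c * u2)) (pdy (t i) p - u2)"
    if u: "has_pd u u1 u2 p" "u p \<noteq> t i p" "u p \<noteq> t j p" for u u1 u2
  proof (rule eta_lform[OF u(1) has_pd_t[OF i] has_pd_t[OF j] u(2) tij u(3)[symmetric], of c])
    fix A B
    assume A: "eta (\<lambda>q. lform c (u q)) (\<lambda>q. lform c (t i q)) (\<lambda>q. lform c (t j q)) p = [:B, A - c * B:]"
      "A * t i p - B = eta_value (t i p) (pdx (t i) p + c * pdy (t i) p) (u p - t j p) (u1 - pdx (t j) p + c * (u2 - pdy (t j) p)) (u2 - pdy (t j) p)"
      "A * t j p - B = eta_value (t j p) (pdx (t j) p + c * pdy (t j) p) (t i p - u p) (pdx (t i) p - u1 + c * (pdy (t i) p - u2)) (pdy (t i) p - u2)"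
    have "A * t i p - B = eta_value (t i p) (pdY c (t i) p) (t j p - u p) (pdY c (t j) p - (u1 + c * u2)) (pdy (t j) p - u2)"
      unfolding A(2) by (subst eta_value_flip[symmetric]) (simp add: pdY_def algebra_simps)
    moreover have "A * t j p - B = eta_value (t j p) (pdY c (t j) p) (t i p - u p) (pdY c (t i) p - (u1 + c * u2)) (pdy (t i) p - u2)"
      unfolding A(3) by (simp add: pdY_def algebra_simps)
    ultimately show ?thesis using A(1) by (auto simp: L_simps)
  qed
  obtain A B where 1: "eta (L s 0) (L s (i + 2)) (L s (j + 2)) p = [:B, A - c * B:]"
      "A * t i p - B = eta_value (t i p) (pdY c (t i) p) (t j p - (a p + s p)) (pdY c (t j) p - (pdY c a p + pdY c s p)) (pdy (t j) p - (pdy a p + pdy s p))"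
      "A * t j p - B = eta_value (t j p) (pdY c (t j) p) (t i p - (a p + s p)) (pdY c (t i) p - (pdY c a p + pdY c s p)) (pdy (t i) p - (pdy a p + pdy s p))"
    using single[OF has_pd_add[OF has_pd_a has_pd_s]] t_ne_pm[OF i] t_ne_pm[OF j]
    by (auto simp: L_simps pdY_def algebra_simps)
  obtain A' B' where 2: "eta (L s 1) (L s (i + 2)) (L s (j + 2)) p = [:B', A' - c * B':]"
      "A' * t i p - B' = eta_value (t i p) (pdY c (t i) p) (t j p - (a p - s p)) (pdY c (t j) p - (pdY c a p - pdY c s p)) (pdy (t j) p - (pdy a p - pdy s p))"
      "A' * t j p - B' = eta_value (t j p) (pdY c (t j) p) (t i p - (a p - s p)) (pdY c (t i) p - (pdY c a p - pdY c s p)) (pdy (t i) p - (pdy a p - pdy s p))"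
    using single[OF has_pd_diff[OF has_pd_a has_pd_s]] t_ne_pm[OF i] t_ne_pm[OF j]
    by (auto simp: L_simps pdY_def algebra_simps)
  have E: "E = [:B + B', (A + A') - c * (B + B'):]" unfolding E_def 1(1) 2(1) by (simp add: algebra_simps)
  have "(A + A') * t i p - (B + B') = (A * t i p - B) + (A' * t i p - B')" by (simp add: algebra_simps)
  also have "\<dots> = v2 i j p"
    unfolding 1 2 v2_def using eta_value_sum_conjugates[OF t_ne_pm[OF j] refl refl refl h_jet q_jet[OF j]] .
  finally have *: "(A + A') * t i p - (B + B') = v2 i j p" .
  have "(A + A') * t j p - (B + B') = (A * t j p - B) + (A' * t j p - B')" by (simp add: algebra_simps)
  also have "\<dots> = v2 j i p"
    unfolding 1 2 v2_def using eta_value_sum_conjugates[OF t_ne_pm[OF i] refl refl refl h_jet q_jet[OF i]] .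
  finally have "(A + A') * t j p - (B + B') = v2 j i p" .
  from linear_pair[OF * this tij]
  show "coeff E 0 = t i p * A2 i j p - v2 i j p" "coeff E 1 + c * coeff E 0 = A2 i j p"
    by (auto simp: E A2_def mult.commute)
qed

lemma eta_3:
  assumes i: "i < k" and j: "j < k" and l: "l < k" and ne: "i \<noteq> j" "j \<noteq> l" "l \<noteq> i"
  defines "E \<equiv> eta (L s (i + 2)) (L s (j + 2)) (L s (l + 2)) p"
  shows "coeff E 0 = t i p * A3 i j l p - v3 i j l p" "coeff E 1 + c * coeff E 0 = A3 i j l p"
proof -
  obtain A B where E: "E = [:B, A - c * B:]" and 1: "A * t i p - B = v3 i j l p" "A * t j p - B = v3 j l i p"
  proof (rule eta_lform[OF has_pd_t[OF i] has_pd_t[OF j] has_pd_t[OF l], of c])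
    show "t i p \<noteq> t j p" "t j p \<noteq> t l p" "t l p \<noteq> t i p" using t_ne pU i j l ne by auto
  next
    fix A B
    assume "eta (\<lambda>q. lform c (t i q)) (\<lambda>q. lform c (t j q)) (\<lambda>q. lform c (t l q)) p = [:B, A - c * B:]"
      "A * t i p - B = eta_value (t i p) (pdx (t i) p + c * pdy (t i) p) (t l p - t j p) (pdx (t l) p - pdx (t j) p + c * (pdy (t l) p - pdy (t j) p)) (pdy (t l) p - pdy (t j) p)"
      "A * t j p - B = eta_value (t j p) (pdx (t j) p + c * pdy (t j) p) (t i p - t l p) (pdx (t i) p - pdx (t l) p + c * (pdy (t i) p - pdy (t l) p)) (pdy (t i) p - pdy (t l) p)"
    then show thesis
      by (intro that) (simp_all add: E_def L_simps pdY_def v3_def eta_value_def algebra_simps)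
  qed
  from linear_pair[OF 1 t_ne[OF i j ne(1) pU]]
  show "coeff E 0 = t i p * A3 i j l p - v3 i j l p" "coeff E 1 + c * coeff E 0 = A3 i j l p"
    by (auto simp: E A3_def mult.commute)
qed

lemma eta_total:
  defines "E \<equiv> \<Sum>w<k+2. \<Sum>v<w. \<Sum>u<v. eta (L s u) (L s v) (L s w) p"
  shows "coeff E 0 = M p / h p" "coeff E 1 = N p / h p - c * (M p / h p)"
proof -
  let ?F = "\<lambda>u v w. eta (L s u) (L s v) (L s w) p"
  \<comment> \<open>For a form \<open>A dx + B (dy - c dx)\<close> coefficient 0 is \<open>B\<close>
    and coefficient 1 is \<open>A - c B\<close>, so \<open>D\<close> reads off
    \<open>A\<close>.\<close>
  define D where "D X = (coeff X 1 + c * coeff X 0)" for X :: "complex poly"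
  have D: "D (X + Y) = D X + D Y" "D (sum G I) = (\<Sum>i\<in>I. D (G i))" for X Y I and G :: "nat \<Rightarrow> complex poly"
    by (simp_all add: D_def coeff_sum sum.distrib sum_distrib_left algebra_simps)
  have E: "E = (\<Sum>j<k. ?F 0 1 (j + 2)) +
    (\<Sum>j<k. \<Sum>i<j. ?F 0 (i + 2) (j + 2) + ?F 1 (i + 2) (j + 2)) +
    (\<Sum>l<k. \<Sum>j<l. \<Sum>i<j. ?F (i + 2) (j + 2) (l + 2))"
    unfolding E_def by (rule sum_triples_add_2)
  have e0: "coeff E 0 = (\<Sum>j<k. coeff (?F 0 1 (j + 2)) 0) +
    (\<Sum>j<k. \<Sum>i<j. coeff (?F 0 (i + 2) (j + 2) + ?F 1 (i + 2) (j + 2)) 0) +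
    (\<Sum>l<k. \<Sum>j<l. \<Sum>i<j. coeff (?F (i + 2) (j + 2) (l + 2)) 0)"
    unfolding E by (simp only: coeff_add coeff_sum)
  have "coeff E 0 * h p = (\<Sum>j<k. coeff (?F 0 1 (j + 2)) 0 * h p) +
    h p * ((\<Sum>j<k. \<Sum>i<j. coeff (?F 0 (i + 2) (j + 2) + ?F 1 (i + 2) (j + 2)) 0) +
    (\<Sum>l<k. \<Sum>j<l. \<Sum>i<j. coeff (?F (i + 2) (j + 2) (l + 2)) 0))"
    unfolding e0 by (rule sum_add_mult)
  also have "\<dots> = M p"
    unfolding M_def by (intro arg_cong2[where f = "(+)"] arg_cong2[where f = "(*)"] sum.cong refl eta_pm eta_2 eta_3) auto
  finally show 0: "coeff E 0 = M p / h p" using hp by (simp add: field_simps)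
  have e1: "D E = (\<Sum>j<k. D (?F 0 1 (j + 2))) +
    (\<Sum>j<k. \<Sum>i<j. D (?F 0 (i + 2) (j + 2) + ?F 1 (i + 2) (j + 2))) +
    (\<Sum>l<k. \<Sum>j<l. \<Sum>i<j. D (?F (i + 2) (j + 2) (l + 2)))"
    unfolding E by (simp only: D(1)[of "_ + _" "sum _ _"] D(1)[of "sum _ _" "sum _ _"] D(2))
  have "D E * h p = (\<Sum>j<k. D (?F 0 1 (j + 2)) * h p) +
    h p * ((\<Sum>j<k. \<Sum>i<j. D (?F 0 (i + 2) (j + 2) + ?F 1 (i + 2) (j + 2))) +
    (\<Sum>l<k. \<Sum>j<l. \<Sum>i<j. D (?F (i + 2) (j + 2) (l + 2))))"
    unfolding e1 by (rule sum_add_mult)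
  also have "\<dots> = N p"
    unfolding N_def D_def by (intro arg_cong2[where f = "(+)"] arg_cong2[where f = "(*)"] sum.cong refl eta_pm eta_2 eta_3) auto
  finally have "D E = N p / h p" using hp by (simp add: field_simps)
  with 0 show "coeff E 1 = N p / h p - c * (M p / h p)" by (simp add: D_def algebra_simps)
qed

end

text \<open>As \<open>c\<close> is constant, \<open>N dx + M (dy - c dx)\<close> has the
  differential \<open>pdY c M - pdy N\<close>, and the quotient rule gives the rest. The factor
  \<open>h\<^sup>2\<close> clears the denominators, and no branch \<open>s\<close> appears on the
  right hand side.\<close>

lemma decomposed_curvature_L:
  assumes V: "open V" "V \<subseteq> U" "p \<in> V" and s: "sep_holo s V" and sq: "\<And>p. p \<in> V \<Longrightarrow> s p * s p = h p"
    and nz: "\<And>p. p \<in> V \<Longrightarrow> h p \<noteq> 0"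
  shows "decomposed_curvature (k + 2) (L s) p * (h p)\<^sup>2 =
    h p * (pdY c M p - pdy N p) - (M p * pdY c h p - N p * pdy h p)"
proof -
  define E where "E p = (\<Sum>w<k+2. \<Sum>v<w. \<Sum>u<v. eta (L s u) (L s v) (L s w) p)" for p
  have E: "coeff (E p) 0 = M p / h p" "coeff (E p) 1 = N p / h p - c * (M p / h p)" if "p \<in> V" for p
    unfolding E_def by (rule eta_total[OF V(1,2) that s sq nz[OF that]]; assumption)+
  have pU: "p \<in> U" and hp: "h p \<noteq> 0" using V nz by auto
  note dM = sep_holo_has_pd[OF sep_holo_M pU] and dN = sep_holo_has_pd[OF sep_holo_N pU] and dh = sep_holo_has_pd[OF h pU]
  note dMh = has_pd_divide[OF dM dh hp]
  have d0: "pdx (\<lambda>q. coeff (E q) 0) p = (pdx M p * h p - M p * pdx h p) / (h p * h p)"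
    by (rule has_pdD(1)[OF has_pd_cong_open[OF dMh V(1,3)]]) (simp add: E)
  have d1: "pdy (\<lambda>q. coeff (E q) 1) p = (pdy N p * h p - N p * pdy h p) / (h p * h p) -
      (0 * (M p / h p) + (pdy M p * h p - M p * pdy h p) / (h p * h p) * c)"
    by (rule has_pdD(2)[OF has_pd_cong_open[OF has_pd_diff[OF has_pd_divide[OF dN dh hp] has_pd_mult[OF has_pd_const dMh]] V(1,3)]])
      (simp only: E)
  have "decomposed_curvature (k + 2) (L s) p = ext_d E p"
    by (simp add: decomposed_curvature_def E_def[abs_def])
  also have "\<dots> = (pdx M p * h p - M p * pdx h p) / (h p * h p) -
      ((pdy N p * h p - N p * pdy h p) / (h p * h p) - c * ((pdy M p * h p - M p * pdy h p) / (h p * h p)))"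
    unfolding ext_d_def d0 d1 by simp
  also have "\<dots> = ((pdx M p * h p - M p * pdx h p) - (pdy N p * h p - N p * pdy h p) +
      c * (pdy M p * h p - M p * pdy h p)) / (h p * h p)"
    by (simp only: diff_divide_distrib add_divide_distrib times_divide_eq_right right_diff_distrib) simp
  finally have "decomposed_curvature (k + 2) (L s) p * (h p * h p) =
    (pdx M p * h p - M p * pdx h p) - (pdy N p * h p - N p * pdy h p) + c * (pdy M p * h p - M p * pdy h p)"
    using hp by simp
  then show ?thesis
    by (simp add: pdY_def power2_eq_square algebra_simps)
qed

text \<open>On \<open>h = 0\<close> the residue of the total form is \<open>N\<close> times
  \<open>dx + a (dy - c dx)\<close>, the double factor of the web; only the triples with both
  conjugate slopes contribute to it.\<close>

lemma N_on_zeros: "h p = 0 \<Longrightarrow> N p = (\<Sum>i<k. (t i p * pdY c h p - pdy h p) / (t i p - a p)) / 2"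
  and M_on_zeros: "h p = 0 \<Longrightarrow> M p = a p * N p"
  by (simp_all add: N_def M_def nn_def sum_divide_distrib sum_distrib_left mult.commute)

text \<open>The identity extends from the dense set \<open>h \<noteq> 0\<close> by continuity. On
  \<open>h = 0\<close> the terms with a factor \<open>h\<close> drop out, and what remains, the
  coefficient of the double pole, is \<open>N\<close> times the first factor of the claim.\<close>

lemma residue_vanishes:
  assumes \<kappa>: "continuous_on U \<kappa>" and dense: "\<And>W. open W \<Longrightarrow> W \<noteq> {} \<Longrightarrow> W \<subseteq> U \<Longrightarrow> \<exists>p\<in>W. h p \<noteq> 0"
    and curv: "\<And>p. p \<in> U \<Longrightarrow> h p \<noteq> 0 \<Longrightarrow>
      \<kappa> p * (h p)\<^sup>2 = h p * (pdY c M p - pdy N p) - (M p * pdY c h p - N p * pdy h p)"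
    and p: "p \<in> U" "h p = 0"
  shows "(a p * pdY c h p - pdy h p) * (\<Sum>i<k. (t i p * pdY c h p - pdy h p) / (t i p - a p)) = 0"
proof -
  define F where "F p = \<kappa> p * (h p)\<^sup>2 - (h p * (pdY c M p - pdy N p) - (M p * pdY c h p - N p * pdy h p))" for p
  have cont: "continuous_on U f" if "sep_holo f U" for f using that by (simp add: sep_holo_def)
  have "continuous_on U F"
    unfolding F_def by (intro continuous_intros \<kappa> cont sep_holo_pdY sep_holo_pd sep_holo_N sep_holo_M h)
  then have "open (U \<inter> F -` (- {0}))" using U by (intro continuous_open_preimage) auto
  moreover have "F p = 0" if "p \<in> U" "h p \<noteq> 0" for p using curv[OF that] by (simp add: F_def)
  ultimately have "U \<inter> F -` (- {0}) = {}" using dense[of "U \<inter> F -` (- {0})"] by blast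
  with p have "F p = 0" by auto
  then have "M p * pdY c h p - N p * pdy h p = 0" by (simp add: F_def p)
  then have "N p * (a p * pdY c h p - pdy h p) = 0" by (simp add: M_on_zeros[OF p(2)] algebra_simps)
  then show ?thesis by (auto simp: N_on_zeros[OF p(2)])
qed

end

section \<open>Factorization of a deformation\<close>

lemma form_disc_smult: "form_disc n (smult l P) = l ^ (2 * n - 2) * form_disc n P"
proof -
  have e: "(\<Sum>i<n. monom (of_nat (n - i) * coeff (smult l P) i) i) =
     smult l (\<Sum>i<n. monom (of_nat (n - i) * coeff P i) i)"
    by (simp add: smult_sum2 smult_monom mult.left_commute)
  have "sylvester_mat_sub m m' (smult l p) (smult l q) = l \<cdot>\<^sub>m sylvester_mat_sub m m' p q" for m m' p q
    by (rule eq_matI) (auto simp: sylvester_mat_sub_index)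
  then have "form_disc n (smult l P) = l ^ (n - 1 + (n - 1)) * form_disc n P"
    unfolding form_disc_def e pderiv_smult by simp
  also have "n - 1 + (n - 1) = 2 * n - 2" by simp
  finally show ?thesis .
qed

lemma form_eval_smult: "form_eval n (smult l P) v = l * form_eval n P v"
  by (simp add: form_eval_def sum_distrib_left mult_ac)

lemma form_eval_lform: "form_eval 1 (lform c t) v = (1 - c * t) * fst v + t * snd v"
  unfolding lform_def by (rule form_eval_linear)

lemma degree_lform: "degree (lform c t) \<le> 1"
  by (simp add: lform_def)

lemma form_eval_prod_lform:
  "form_eval n (\<Prod>i<n. lform c (t i)) v = (\<Prod>i<n. (1 - c * t i) * fst v + t i * snd v)"
  unfolding lform_def by (rule form_eval_prod_linear)

lemma degree_prod_lform: "degree (\<Prod>i<n. lform c (t i)) \<le> n"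
  unfolding lform_def by (rule degree_prod_linear_le)

lemma form_eval_prod_lform_base: "form_eval n (\<Prod>i<n. lform c (t i)) (1, c) = 1"
  by (simp add: form_eval_prod_lform)

lemma form_eval_prod_lform_kernel:
  "form_eval n (\<Prod>i<n. lform c (t i)) (- x, 1 - c * x) = (\<Prod>i<n. t i - x)"
  unfolding form_eval_prod_lform by (rule prod.cong) (auto simp: algebra_simps)

lemma form_eval_quad_lform_kernel:
  "form_eval 2 (lform c u * lform c v) (- x, 1 - c * x) = (u - x) * (v - x)"
proof -
  have "form_eval (1 + 1) (lform c u * lform c v) (- x, 1 - c * x) = (u - x) * (v - x)"
    by (subst form_eval_mult[OF degree_lform degree_lform]) (simp add: form_eval_lform[unfolded One_nat_def] algebra_simps)
  then show ?thesis by (simp add: numeral_2_eq_2)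
qed

lemma lform_nonzero: "lform c t \<noteq> 0"
  by (auto simp: lform_def)

lemma form_disc_prod_lform:
  assumes "n \<ge> 1"
  shows "form_disc n (\<Prod>i<n. lform c (t i)) = disc_const n * (\<Prod>i<n. \<Prod>j\<in>{..<n} - {i}. t j - t i)"
  unfolding lform_def form_disc_linear_factors[OF assms] by (simp add: algebra_simps)

lemma form_disc_quad_lform: "form_disc 2 (lform c (a + s) * lform c (a - s)) = - 4 * s\<^sup>2"
proof -
  have "lform c (a + s) * lform c (a - s) = (\<Prod>i<2::nat. lform c (if i = 0 then a + s else a - s))"
    by (simp add: numeral_2_eq_2)
  moreover have "{..<2} - {0} = {Suc 0}" "{..<2} - {Suc 0} = {0::nat}" by auto
  ultimately show ?thesis
    by (simp only: form_disc_prod_lform) (simp add: numeral_2_eq_2 disc_const_def power2_eq_square algebra_simps)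
qed

lemma form_disc_1: "form_disc 1 P = 1"
  by (simp add: form_disc_def sylvester_mat_sub_def)

text \<open>The value at \<open>(1, c)\<close> is the product of the values \<open>m i\<close> of
  the linear factors; as it is nonzero, each factor can be normalised to an
  \<open>lform c\<close>.\<close>

lemma lform_factors:
  assumes "degree P \<le> n" "n \<ge> 1" "form_eval n P (1, c) \<noteq> 0"
  obtains r where "P = smult (form_eval n P (1, c)) (\<Prod>i<n. lform c (r i))"
proof -
  obtain a b where P: "P = (\<Prod>i<n. [:b i, a i:])" using linear_factors[OF assms(1,2)] .
  define m where "m i = a i + c * b i" for i
  have m: "form_eval n P (1, c) = (\<Prod>i<n. m i)"
    unfolding P form_eval_prod_linear by (simp add: m_def mult.commute)
  with assms(3) have nz: "m i \<noteq> 0" if "i < n" for i using that by auto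
  have "P = (\<Prod>i<n. [:m i:] * lform c (b i / m i))"
    unfolding P
  proof (intro prod.cong refl)
    fix i assume "i \<in> {..<n}"
    with nz have "m i \<noteq> 0" by auto
    then show "[:b i, a i:] = [:m i:] * lform c (b i / m i)"
      by (simp add: lform_def m_def field_simps)
  qed
  also have "\<dots> = smult (\<Prod>i<n. m i) (\<Prod>i<n. lform c (b i / m i))"
  proof -
    have "(\<Prod>i<n. [:m i:]) = [:\<Prod>i<n. m i:]" for n by (induction n) auto
    then show ?thesis by (simp only: prod.distrib) simp
  qed
  finally show ?thesis using that m by metis
qed

text \<open>Used with \<open>m = 2\<close>, where the remaining factors form the quadratic cofactor,
  and with \<open>m = 0\<close>, where the \<open>t i\<close> are all the roots. Distinct roots sit
  at distinct indices, so the other indices can be renumbered.\<close>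

lemma lform_factors_from_roots:
  assumes "degree P \<le> k + m" "k + m \<ge> 1" "form_eval (k + m) P (1, c) \<noteq> 0"
    and inj: "inj_on t {..<k}" and roots: "\<And>i. i < k \<Longrightarrow> form_eval (k + m) P (- t i, 1 - c * t i) = 0"
  obtains r where "P = smult (form_eval (k + m) P (1, c)) ((\<Prod>i<m. lform c (r i)) * (\<Prod>i<k. lform c (t i)))"
proof -
  let ?l = "form_eval (k + m) P (1, c)"
  obtain \<rho> where P: "P = smult ?l (\<Prod>i<k+m. lform c (\<rho> i))"
    using lform_factors[OF assms(1-3)] .
  have "\<exists>j<k+m. \<rho> j = t i" if "i < k" for i
  proof -
    have "?l * (\<Prod>j<k+m. \<rho> j - t i) = 0"
      using roots[OF that] by (subst (asm) P) (simp add: form_eval_smult form_eval_prod_lform_kernel)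
    with assms(3) show ?thesis by auto
  qed
  then obtain j where j: "\<And>i. i < k \<Longrightarrow> j i < k + m" "\<And>i. i < k \<Longrightarrow> \<rho> (j i) = t i" by metis
  have injj: "inj_on j {..<k}"
  proof (rule inj_onI)
    fix x y assume xy: "x \<in> {..<k}" "y \<in> {..<k}" "j x = j y"
    then have "t x = t y" using j(2) by (metis lessThan_iff)
    with inj xy(1,2) show "x = y" by (meson inj_onD)
  qed
  have sub: "j ` {..<k} \<subseteq> {..<k+m}" using j by auto
  define R where "R = {..<k+m} - j ` {..<k}"
  have "finite R" "card R = m"
    using sub injj by (auto simp: R_def card_Diff_subset card_image)
  then obtain e where e: "bij_betw e {..<m} R"
    using ex_bij_betw_nat_finite[of R] by (auto simp: atLeast0LessThan)
  have "(\<Prod>i<k+m. lform c (\<rho> i)) = (\<Prod>i\<in>R. lform c (\<rho> i)) * (\<Prod>i\<in>j ` {..<k}. lform c (\<rho> i))"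
    unfolding R_def by (rule prod.subset_diff[OF sub]) simp
  also have "(\<Prod>i\<in>j ` {..<k}. lform c (\<rho> i)) = (\<Prod>i<k. lform c (t i))"
    using injj j(2) by (simp add: prod.reindex)
  also have "(\<Prod>i\<in>R. lform c (\<rho> i)) = (\<Prod>i<m. lform c (\<rho> (e i)))"
    by (rule prod.reindex_bij_betw[OF e, symmetric])
  finally show ?thesis using P that[of "\<lambda>i. \<rho> (e i)"] by simp
qed

text \<open>\<open>(dx + a (dy - c dx))\<^sup>2 - h (dy - c dx)\<^sup>2\<close>\<close>

definition quad :: "complex \<Rightarrow> complex \<Rightarrow> complex \<Rightarrow> complex poly" where
  "quad c a h = [:a\<^sup>2 - h, 2 * a * (1 - c * a) + 2 * c * h, (1 - c * a)\<^sup>2 - c\<^sup>2 * h:]"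

lemma quad_eq_lform: "s\<^sup>2 = h \<Longrightarrow> quad c a h = lform c (a + s) * lform c (a - s)"
  by (auto simp: quad_def lform_def power2_eq_square algebra_simps)

lemma lform_mult_eq_quad: "lform c u * lform c v = quad c ((u + v) / 2) (((u - v) / 2)\<^sup>2)"
proof -
  have "(u + v) / 2 + (u - v) / 2 = u" "(u + v) / 2 - (u - v) / 2 = v" by (auto simp: field_simps)
  then show ?thesis using quad_eq_lform[OF refl, of c "(u + v) / 2" "(u - v) / 2"] by simp
qed

lemma form_disc_quad: "form_disc 2 (quad c a h) = - 4 * h"
  using quad_eq_lform[of "csqrt h" h c a] form_disc_quad_lform[of c a "csqrt h"] by simp

lemma degree_quad: "degree (quad c a h) \<le> 2"
  by (simp add: quad_def)

lemma form_eval_quad: "form_eval 2 (quad c a h) (x, y) = (x + a * (y - c * x))\<^sup>2 - h * (y - c * x)\<^sup>2"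
  by (simp add: form_eval_def quad_def numeral_2_eq_2 power2_eq_square algebra_simps)

text \<open>After division by \<open>m\<close>, coefficient 0 is \<open>a\<^sup>2 - h\<close> and
  coefficient 1 is \<open>2 a - 2 c (a\<^sup>2 - h)\<close>; solving for \<open>a\<close> and
  \<open>h\<close> gives the two expressions.\<close>

lemma quadratic_eq_quad:
  fixes c :: complex
  assumes "degree P \<le> 2"
  defines "m \<equiv> form_eval 2 P (1, c)"
  assumes m: "m \<noteq> 0"
  shows "P = smult m (quad c ((coeff P 1 + 2 * coeff P 0 * c) / (2 * m))
    (((coeff P 1 + 2 * coeff P 0 * c) / (2 * m))\<^sup>2 - coeff P 0 / m))"
proof -
  define A where "A = (coeff P 1 + 2 * coeff P 0 * c) / (2 * m)"
  define B where "B = coeff P 0 / m"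
  have 0: "coeff P 0 = m * B" using m by (simp add: B_def)
  have 1: "coeff P 1 = 2 * m * A - 2 * m * B * c" using m by (simp add: A_def B_def)
  have "m = coeff P 2 + coeff P 1 * c + coeff P 0 * c\<^sup>2"
    by (simp add: m_def form_eval_def numeral_2_eq_2)
  then have 2: "coeff P 2 = m - 2 * m * A * c + m * B * c\<^sup>2"
    unfolding 0 1 by (simp add: algebra_simps power2_eq_square)
  have "P = [:coeff P 0, coeff P 1, coeff P 2:]"
  proof (rule poly_eqI)
    fix n show "coeff P n = coeff [:coeff P 0, coeff P 1, coeff P 2:] n"
      using assms(1) by (cases "n \<le> 2") (auto simp: coeff_eq_0 coeff_pCons le_Suc_eq numeral_2_eq_2 split: nat.split)
  qed
  also have "\<dots> = smult m (quad c A (A\<^sup>2 - B))"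
    unfolding 0 1 2 by (simp add: quad_def power2_eq_square algebra_simps)
  finally show ?thesis by (simp add: A_def B_def)
qed

text \<open>The restriction of a form to the kernel vectors \<open>(- t, 1 - c t)\<close>, as a polynomial in
  \<open>t\<close>: its roots are the slopes.\<close>

definition hat :: "complex \<Rightarrow> nat \<Rightarrow> complex poly \<Rightarrow> complex poly" where
  "hat c n P = (\<Sum>i\<le>n. smult (coeff P i) ([:0, -1:] ^ i * [:1, - c:] ^ (n - i)))"

lemma poly_hat: "poly (hat c n P) t = form_eval n P (- t, 1 - c * t)"
  by (simp add: hat_def form_eval_def poly_sum mult_ac)

lemma degree_hat: "degree (hat c n P) \<le> n"
  unfolding hat_def
proof (intro degree_sum_le)
  fix i assume i: "i \<in> {..n}"
  have "degree ([:0, -1:] ^ i * [:1, - c:] ^ (n - i)) \<le> 1 * i + 1 * (n - i)"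
    by (intro order_trans[OF degree_mult_le] add_mono order_trans[OF degree_power_le] mult_mono) auto
  then show "degree (smult (coeff P i) ([:0, -1:] ^ i * [:1, - c:] ^ (n - i))) \<le> n"
    using i by (intro order_trans[OF degree_smult_le]) auto
qed auto

lemma coeff_hat: "coeff (hat c n P) j = (\<Sum>i\<le>n. coeff P i * coeff ([:0, -1:] ^ i * [:1, - c:] ^ (n - i)) j)"
  by (simp add: hat_def coeff_sum)

lemma hat_prod_lform:
  "hat c n (smult l (\<Prod>i<n. lform c (r i))) = smult (l * (-1) ^ n) (\<Prod>i<n. [:- r i, 1:])"
proof -
  have "poly (hat c n (smult l (\<Prod>i<n. lform c (r i)))) x =
     poly (smult (l * (-1) ^ n) (\<Prod>i<n. [:- r i, 1:])) x" for x
  proof -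
    have "(\<Prod>i<n. r i - x) = (\<Prod>i<n. (-1) * (x - r i))" by (intro prod.cong) auto
    then have "(\<Prod>i<n. r i - x) = (-1) ^ n * (\<Prod>i<n. x - r i)"
      by (simp only: prod.distrib prod_constant card_lessThan)
    then show ?thesis
      by (simp add: poly_hat form_eval_smult form_eval_prod_lform_kernel poly_prod)
  qed
  then show ?thesis by (simp add: poly_eq_poly_eq_iff[symmetric] ext)
qed

text \<open>Since the form does not vanish on \<open>(1, c)\<close>, no slope is infinite and the
  degree of \<open>hat\<close> does not drop.\<close>

lemma coeff_hat_top:
  assumes "degree P \<le> n" "n \<ge> 1" "form_eval n P (1, c) \<noteq> 0"
  shows "coeff (hat c n P) n \<noteq> 0"
proof -
  obtain r where r: "P = smult (form_eval n P (1, c)) (\<Prod>i<n. lform c (r i))"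
    using lform_factors[OF assms] .
  have deg: "degree (\<Prod>i<n. [:- r i, 1:]) = n" by (simp add: degree_prod_eq_sum_degree)
  moreover have "lead_coeff (\<Prod>i<n. [:- r i, 1:]) = 1" by (simp only: lead_coeff_prod) simp
  ultimately have "coeff (\<Prod>i<n. [:- r i, 1:]) n = 1" by simp
  then show ?thesis by (subst r) (simp add: hat_prod_lform assms(3))
qed

lemma exists_nontangent_direction:
  assumes "P \<noteq> 0" "degree P \<le> n"
  obtains c where "form_eval n P (1, c) \<noteq> 0"
proof -
  define Q where "Q = (\<Sum>i\<le>n. monom (coeff P i) (n - i))"
  have cf: "coeff Q (n - i) = coeff P i" if "i \<le> n" for i
  proof -
    have "coeff Q (n - i) = (\<Sum>j\<le>n. if j = i then coeff P j else 0)"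
      unfolding Q_def coeff_sum by (rule sum.cong) (use that in auto)
    with that show ?thesis by simp
  qed
  have "coeff P (degree P) \<noteq> 0" using assms by simp
  with cf[OF assms(2)] have "Q \<noteq> 0" by auto
  then obtain c where "poly Q c \<noteq> 0" using poly_all_0_iff_0 by blast
  moreover have "poly Q c = form_eval n P (1, c)"
    by (simp add: Q_def form_eval_def poly_sum poly_monom)
  ultimately show ?thesis using that by simp
qed

section \<open>Complex linear forms in two and three variables\<close>

definition lin2 :: "(point \<Rightarrow> complex) set" where
  "lin2 = {\<lambda>v. a * fst v + b * snd v | a b. True}"

definition lin3 :: "(complex \<times> point \<Rightarrow> complex) set" where
  "lin3 = {\<lambda>v. a * fst v + b * fst (snd v) + c * snd (snd v) | a b c. True}"

interpretation lin2: complex_linear_maps lin2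
proof
  show "(\<lambda>_. 0) \<in> lin2" unfolding lin2_def by (auto intro!: exI[of _ 0])
next
  fix f g c assume "f \<in> lin2" "g \<in> lin2"
  then obtain a b a' b' where "f = (\<lambda>v. a * fst v + b * snd v)" "g = (\<lambda>v. a' * fst v + b' * snd v)"
    by (auto simp: lin2_def)
  then have "(\<lambda>v. f v + g v) = (\<lambda>v. (a + a') * fst v + (b + b') * snd v)"
    by (auto simp: algebra_simps)
  then show "(\<lambda>v. f v + g v) \<in> lin2" unfolding lin2_def by blast
next
  fix f c assume "f \<in> lin2"
  then obtain a b where "f = (\<lambda>v. a * fst v + b * snd v)" by (auto simp: lin2_def)
  then have "(\<lambda>v. f v * c) = (\<lambda>v. (a * c) * fst v + (b * c) * snd v)" by (auto simp: algebra_simps)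
  then show "(\<lambda>v. f v * c) \<in> lin2" unfolding lin2_def by blast
qed

interpretation lin3: complex_linear_maps lin3
proof
  show "(\<lambda>_. 0) \<in> lin3" unfolding lin3_def by (auto intro!: exI[of _ 0])
next
  fix f g assume "f \<in> lin3" "g \<in> lin3"
  then obtain a b c a' b' c' where "f = (\<lambda>v. a * fst v + b * fst (snd v) + c * snd (snd v))"
     "g = (\<lambda>v. a' * fst v + b' * fst (snd v) + c' * snd (snd v))"
    by (auto simp: lin3_def)
  then have "(\<lambda>v. f v + g v) = (\<lambda>v. (a + a') * fst v + (b + b') * fst (snd v) + (c + c') * snd (snd v))"
    by (auto simp: algebra_simps)
  then show "(\<lambda>v. f v + g v) \<in> lin3" unfolding lin3_def by blast
next
  fix f d assume "f \<in> lin3"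
  then obtain a b c where "f = (\<lambda>v. a * fst v + b * fst (snd v) + c * snd (snd v))" by (auto simp: lin3_def)
  then have "(\<lambda>v. f v * d) = (\<lambda>v. (a * d) * fst v + (b * d) * fst (snd v) + (c * d) * snd (snd v))"
    by (auto simp: algebra_simps)
  then show "(\<lambda>v. f v * d) \<in> lin3" unfolding lin3_def by blast
qed

lemma holo2_iff: "holo2 f U \<longleftrightarrow> open U \<and> (\<forall>p\<in>U. cdiff lin2 f p)"
  unfolding holo2_def cdiff_def lin2_def by blast

lemma holo3_iff: "holo3 f S \<longleftrightarrow> open S \<and> (\<forall>p\<in>S. cdiff lin3 f p)"
  unfolding holo3_def cdiff_def lin3_def by blast

lemma cdiff_slice:
  assumes "cdiff lin3 f (e, p)" shows "cdiff lin2 (\<lambda>p. f (e, p)) p"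
proof -
  obtain a b c where d: "(f has_derivative (\<lambda>v. a * fst v + b * fst (snd v) + c * snd (snd v))) (at (e, p))"
    using assms by (auto simp: cdiff_def lin3_def)
  have "((\<lambda>p. (e, p)) has_derivative (\<lambda>v. (0, v))) (at p)"
    by (auto intro!: derivative_eq_intros)
  from has_derivative_compose[OF this d]
  have "((\<lambda>p. f (e, p)) has_derivative (\<lambda>v. b * fst v + c * snd v)) (at p)" by simp
  then show ?thesis unfolding cdiff_def lin2_def by blast
qed

context complex_linear_maps
begin

lemma cdiff_coeff_mult:
  assumes "\<And>i. cdiff C (\<lambda>p. coeff (P p) i) p" "\<And>i. cdiff C (\<lambda>p. coeff (Q p) i) p"
  shows "cdiff C (\<lambda>p. coeff (P p * Q p) i) p"
  unfolding coeff_mult using assms by (intro cdiff_sum cdiff_mult) auto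

lemma cdiff_coeff_lform:
  assumes "cdiff C t p" shows "cdiff C (\<lambda>p. coeff (lform c (t p)) i) p"
proof -
  consider "i = 0" | "i = 1" | j where "i = Suc (Suc j)" by (metis One_nat_def not0_implies_Suc)
  then show ?thesis
    by cases (simp_all add: lform_def, (intro assms cdiff_diff cdiff_mult cdiff_const)+)
qed

lemma cdiff_coeff_prod_lform:
  fixes t :: "nat \<Rightarrow> 'a \<Rightarrow> complex"
  assumes "\<And>j. j < n \<Longrightarrow> cdiff C (t j) p"
  shows "cdiff C (\<lambda>p. coeff (\<Prod>j<n. lform c (t j p)) i) p"
  using assms
proof (induction n arbitrary: i)
  case 0
  then show ?case by (simp add: cdiff_const)
next
  case (Suc n)
  have "cdiff C (\<lambda>p. coeff ((\<Prod>j<n. lform c (t j p)) * lform c (t n p)) i) p"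
    by (intro cdiff_coeff_mult Suc.IH cdiff_coeff_lform Suc.prems) auto
  then show ?case by simp
qed

lemma cdiff_coeff_quad:
  assumes "cdiff C a p" "cdiff C h p"
  shows "cdiff C (\<lambda>p. coeff (quad c (a p) (h p)) i) p"
proof -
  consider "i = 0" | "i = 1" | "i = 2" | j where "i = Suc (Suc (Suc j))"
    by (metis One_nat_def not0_implies_Suc numeral_2_eq_2)
  then show ?thesis
    by cases (simp_all add: quad_def numeral_2_eq_2, (intro assms cdiff_diff cdiff_mult cdiff_const cdiff_add cdiff_power)+)
qed

lemma cdiff_form_eval:
  assumes "\<And>i. i \<le> n \<Longrightarrow> cdiff C (\<lambda>p. coeff (P p) i) p" "cdiff C x p" "cdiff C y p"
  shows "cdiff C (\<lambda>p. form_eval n (P p) (x p, y p)) p"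
  unfolding form_eval_def fst_conv snd_conv using assms by (intro cdiff_sum cdiff_mult cdiff_power) auto

lemma cdiff_coeff_hat:
  assumes "\<And>i. i \<le> n \<Longrightarrow> cdiff C (\<lambda>p. coeff (P p) i) p"
  shows "cdiff C (\<lambda>p. coeff (hat c n (P p)) i) p"
  unfolding coeff_hat using assms by (intro cdiff_sum cdiff_mult cdiff_const) auto

end

section \<open>The curvature of the web in an unramified chart\<close>

lemma web_on_lform:
  assumes "open V" "holo2 t V"
  shows "web_on V 1 (\<lambda>p. lform c (t p))"
proof -
  have "holo2 (\<lambda>p. coeff (lform c (t p)) i) V" for i
    using assms by (auto simp: holo2_iff intro: lin2.cdiff_coeff_lform)
  then show ?thesis
    using assms(1) form_disc_1 by (auto simp: web_on_def sform_on_def web_disc_def degree_lform[unfolded One_nat_def] lform_nonzero)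
qed

lemma pullback_id:
  assumes "degree (\<omega> q) \<le> n" shows "pullback n id \<omega> q = \<omega> q"
proof -
  have *: "pdy (fst \<circ> id) q = 0" "pdx (fst \<circ> id) q = 1" "pdy (snd \<circ> id) q = 1" "pdx (snd \<circ> id) q = 0"
    by (auto simp: pdx_def pdy_def)
  have "pullback n id \<omega> q = (\<Sum>i\<le>n. monom (coeff (\<omega> q) i) i)"
    unfolding pullback_def * by (simp add: monom_altdef one_pCons[symmetric])
  then show ?thesis using poly_as_sum_of_monoms'[OF assms] by simp
qed

lemma jacobian_id: "jacobian id q = 1"
  by (simp add: jacobian_def pdx_def pdy_def)

text \<open>Division by \<open>h p\<close> brings the nearby values into the right half plane, away
  from the branch cut of \<open>csqrt\<close>.\<close>

lemma holo2_sqrt: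
  assumes h: "holo2 h U" and p: "p \<in> U" "h p \<noteq> 0"
  obtains V s where "open V" "p \<in> V" "V \<subseteq> U" "holo2 s V" "\<And>q. q \<in> V \<Longrightarrow> s q * s q = h q" "\<And>q. q \<in> V \<Longrightarrow> h q \<noteq> 0"
proof -
  define V where "V = {q\<in>U. 0 < Re (h q / h p)}"
  define s where "s q = csqrt (h q / h p) * csqrt (h p)" for q
  have "continuous_on U (\<lambda>q. Re (h q / h p))"
    using holo2_imp_sep_holo[OF h] p by (intro continuous_intros) (auto simp: sep_holo_def)
  moreover have U: "open U" using h by (simp add: holo2_def)
  ultimately have "open (U \<inter> (\<lambda>q. Re (h q / h p)) -` {0<..})" by (intro continuous_open_preimage) auto
  moreover have "U \<inter> (\<lambda>q. Re (h q / h p)) -` {0<..} = V" by (auto simp: V_def)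
  ultimately have V: "open V" by simp
  have "cdiff lin2 s q" if "q \<in> V" for q
  proof -
    have "h q / h p \<notin> \<real>\<^sub>\<le>\<^sub>0" using that by (auto simp: V_def complex_nonpos_Reals_iff)
    moreover have "cdiff lin2 (\<lambda>q. h q / h p) q"
      using h that p by (intro lin2.cdiff_divide lin2.cdiff_const) (auto simp: V_def holo2_iff)
    ultimately have "cdiff lin2 (\<lambda>q. csqrt (h q / h p)) q"
      by (intro lin2.cdiff_compose[where g = csqrt and f = "\<lambda>q. h q / h p", OF _ has_field_derivative_csqrt])
    then show ?thesis unfolding s_def by auto
  qed
  then have "holo2 s V" using V by (simp add: holo2_iff)
  moreover have "s q * s q = h q" for q
  proof -
    have "s q * s q = (csqrt (h q / h p))\<^sup>2 * (csqrt (h p))\<^sup>2" by (simp add: s_def power2_eq_square mult_ac)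
    with p show ?thesis by simp
  qed
  moreover have "h q \<noteq> 0" if "q \<in> V" for q using that by (auto simp: V_def)
  moreover have "p \<in> V" using p by (simp add: V_def)
  moreover have "V \<subseteq> U" by (auto simp: V_def)
  ultimately show ?thesis using V by (intro that[of V s])
qed

text \<open>Off \<open>h = 0\<close> a local square root decomposes the web on a small set, whose
  inclusion is a chart with Jacobian 1. As the resulting expression does not involve the square
  root, the same \<open>M\<close> and \<open>N\<close> serve at all such points.\<close>

lemma (in slopes_on) curvature_identity:
  assumes hol: "holo2 a U" "holo2 h U" "\<And>i. i < k \<Longrightarrow> holo2 (t i) U" "holo2 l U"
    and W: "\<And>p. p \<in> U \<Longrightarrow> \<omega> p = smult (l p) (quad c (a p) (h p) * (\<Prod>i<k. lform c (t i p)))"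
    and disc: "\<And>p. p \<in> U \<Longrightarrow> h p \<noteq> 0 \<Longrightarrow> web_disc (k + 2) \<omega> p \<noteq> 0"
    and U': "U \<subseteq> U'" and curv: "is_curvature U' (k + 2) \<omega> \<kappa>" and p: "p \<in> U" "h p \<noteq> 0"
  shows "\<kappa> p * (h p)\<^sup>2 = h p * (pdY c M p - pdy N p) - (M p * pdY c h p - N p * pdy h p)"
proof -
  obtain V s where V: "open V" "p \<in> V" "V \<subseteq> U" and s: "holo2 s V" "\<And>q. q \<in> V \<Longrightarrow> s q * s q = h q"
    and hV: "\<And>q. q \<in> V \<Longrightarrow> h q \<noteq> 0" using holo2_sqrt[OF hol(2) p] by metis
  have Li: "web_on V 1 (L s i)" if "i < k + 2" for i
  proof -
    consider "i = 0" | "i = 1" | j where "i = Suc (Suc j)" "j < k"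
      using \<open>i < k + 2\<close> by (metis One_nat_def Suc_less_eq add_2_eq_Suc' not0_implies_Suc)
    then show ?thesis
    proof cases
      case 1
      have "holo2 (\<lambda>p. a p + s p) V" using hol s V by (auto simp: holo2_iff subset_iff)
      then show ?thesis unfolding 1 L_simps by (rule web_on_lform[OF V(1)])
    next
      case 2
      have "holo2 (\<lambda>p. a p - s p) V" using hol s V by (auto simp: holo2_iff subset_iff)
      then show ?thesis unfolding 2 L_simps(2)[folded One_nat_def] by (rule web_on_lform[OF V(1)])
    next
      case 3
      have "holo2 (t j) V" using hol(3)[OF 3(2)] V by (auto simp: holo2_iff subset_iff)
      then show ?thesis unfolding 3 L_simps by (rule web_on_lform[OF V(1)])
    qed
  qed
  have "decomposing_chart U' (k + 2) \<omega> V id (L s)"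
    unfolding decomposing_chart_def
  proof (intro conjI allI impI)
    have "((\<lambda>v. fst v) has_derivative (\<lambda>v. 1 * fst v + 0 * snd v)) (at q)"
      "((\<lambda>v. snd v) has_derivative (\<lambda>v. 0 * fst v + 1 * snd v)) (at q)" for q :: point
      by (auto intro!: derivative_eq_intros)
    then show "holo2 (fst \<circ> id) V" "holo2 (snd \<circ> id) V"
      using V(1) unfolding holo2_def comp_def id_def by blast+
    show "id ` V \<subseteq> U'" using V U' by auto
    show "\<exists>q\<in>A. jacobian id q \<noteq> 0" if "open A \<and> A \<noteq> {} \<and> A \<subseteq> V" for A
      using that by (auto simp: jacobian_id)
    show "web_on V 1 (L s i)" if "i < k + 2" for i using Li[OF that] .
    show "\<exists>g. holo2 g V \<and> (\<forall>q\<in>V. pullback (k + 2) id \<omega> q = smult (g q) (\<Prod>i<k + 2. L s i q))"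
    proof (intro exI[of _ l] conjI ballI)
      show "holo2 l V" using hol V by (auto simp: holo2_iff)
    next
      fix q assume q: "q \<in> V"
      have deg: "degree (quad c (a q) (h q) * (\<Prod>i<k. lform c (t i q))) \<le> 2 + k"
        by (intro order_trans[OF degree_mult_le] add_mono degree_quad degree_prod_lform)
      have Wq: "\<omega> q = smult (l q) (quad c (a q) (h q) * (\<Prod>i<k. lform c (t i q)))"
        using q V by (intro W) auto
      have "pullback (k + 2) id \<omega> q = \<omega> q"
        using deg unfolding add.commute[of 2] by (intro pullback_id, unfold Wq) (rule order_trans[OF degree_smult_le])
      also note Wq
      also have "quad c (a q) (h q) = lform c (a q + s q) * lform c (a q - s q)"
        by (rule quad_eq_lform) (simp add: power2_eq_square s(2)[OF q])
      also have "\<dots> * (\<Prod>i<k. lform c (t i q)) = (\<Prod>i<k + 2. L s i q)"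
        by (simp add: prod.lessThan_Suc_shift L_simps mult.assoc del: prod.lessThan_Suc)
      finally show "pullback (k + 2) id \<omega> q = smult (l q) (\<Prod>i<k + 2. L s i q)" .
    qed
  qed
  moreover have "web_disc (k + 2) \<omega> (id p) \<noteq> 0" using disc p by simp
  ultimately have "\<kappa> (id p) * jacobian id p = decomposed_curvature (k + 2) (L s) p"
    using curv V(2) unfolding is_curvature_def by (metis jacobian_id zero_neq_one)
  then show ?thesis
    using decomposed_curvature_L[OF V(1,3,2) holo2_imp_sep_holo[OF s(1)] s(2) hV] by (simp add: jacobian_id)
qed

lemma holo3_continuous_on: "holo3 f S \<Longrightarrow> continuous_on S f"
  using lin3.cdiff_continuous by (auto simp: holo3_iff intro: continuous_at_imp_continuous_on)

text \<open>Continuity jointly in parameter and point lets the nonvanishing of \<open>J\<close>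
  spread from parameter 0 to small parameters.\<close>

lemma holo3_continuous_on_pd:
  assumes f: "holo3 f S"
  shows "continuous_on S (\<lambda>z. pdx (\<lambda>p. f (fst z, p)) (snd z))"
    and "continuous_on S (\<lambda>z. pdy (\<lambda>p. f (fst z, p)) (snd z))"
proof -
  have S: "open S" using f by (simp add: holo3_iff)
  have cont: "continuous_on S f" by (rule holo3_continuous_on[OF f])
  have fd: "(\<lambda>x. f (e, (x, y))) field_differentiable at x" "(\<lambda>y. f (e, (x, y))) field_differentiable at y"
    if "(e, (x, y)) \<in> S" for e x y
  proof -
    have "cdiff lin2 (\<lambda>p. f (e, p)) (x, y)"
      using f that by (intro cdiff_slice) (simp add: holo3_iff)
    then obtain a b where "((\<lambda>p. f (e, p)) has_derivative (\<lambda>v. a * fst v + b * snd v)) (at (x, y))"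
      by (auto simp: cdiff_def lin2_def)
    then have "has_pd (\<lambda>p. f (e, p)) a b (x, y)" by (rule has_derivative_imp_has_pd)
    then show "(\<lambda>x. f (e, (x, y))) field_differentiable at x" "(\<lambda>y. f (e, (x, y))) field_differentiable at y"
      by (auto simp: has_pd_def field_differentiable_def)
  qed
  let ?A = "\<lambda>v. (fst (fst v), (snd v, snd (fst v)))" and ?B = "\<lambda>v. (fst (fst v), (snd (fst v), snd v))"
  have "open (?A -` S)" "open (?B -` S)" by (intro open_vimage S continuous_intros)+
  have "continuous_on (?A -` S) (\<lambda>v. f (?A v))" "continuous_on (?B -` S) (\<lambda>v. f (?B v))"
    by (auto intro!: continuous_on_compose2[OF cont] continuous_intros)
  note c = this
  have "continuous_on (?A -` S) (\<lambda>(a, x). deriv (\<lambda>x. f (fst a, (x, snd a))) x)"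
    by (rule continuous_on_deriv_param) (use \<open>open (?A -` S)\<close> c fd in \<open>auto simp: case_prod_unfold\<close>)
  then have "continuous_on S (\<lambda>z. case ((fst z, snd (snd z)), fst (snd z)) of (a, x) \<Rightarrow> deriv (\<lambda>x. f (fst a, (x, snd a))) x)"
    by (rule continuous_on_compose2) (auto intro!: continuous_intros)
  then show "continuous_on S (\<lambda>z. pdx (\<lambda>p. f (fst z, p)) (snd z))" by (simp add: pdx_def)
  have "continuous_on (?B -` S) (\<lambda>(a, y). deriv (\<lambda>y. f (fst a, (snd a, y))) y)"
    by (rule continuous_on_deriv_param) (use \<open>open (?B -` S)\<close> c fd in \<open>auto simp: case_prod_unfold\<close>)
  then have "continuous_on S (\<lambda>z. case ((fst z, fst (snd z)), snd (snd z)) of (a, x) \<Rightarrow> deriv (\<lambda>y. f (fst a, (snd a, y))) x)"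
    by (rule continuous_on_compose2) (auto intro!: continuous_intros)
  then show "continuous_on S (\<lambda>z. pdy (\<lambda>p. f (fst z, p)) (snd z))" by (simp add: pdy_def)
qed

text \<open>If the differentials were independent, \<open>(g, h)\<close> would be open at \<open>p\<close> and \<open>h\<close> would vanish at
  points where \<open>g\<close> does not.\<close>

lemma parallel_differentials:
  assumes g: "holo2 g W" and h: "holo2 h W" and p: "p \<in> W" "g p = 0" "h p = 0"
    and sub: "\<And>q. q \<in> W \<Longrightarrow> h q = 0 \<Longrightarrow> g q = 0"
  shows "pdx g p * pdy h p - pdy g p * pdx h p = 0"
proof (rule ccontr)
  define D where "D = pdx g p * pdy h p - pdy g p * pdx h p"
  assume "pdx g p * pdy h p - pdy g p * pdx h p \<noteq> 0"
  then have D: "D \<noteq> 0" by (simp add: D_def)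
  define f where "f q = (g q, h q)" for q
  define f' where "f' v = (pdx g p * fst v + pdy g p * snd v, pdx h p * fst v + pdy h p * snd v)" for v :: point
  \<comment> \<open>The inverse of \<open>f'\<close> by Cramer's rule, as required by the open
    mapping theorem.\<close>
  define g' where "g' w = ((pdy h p * fst w - pdy g p * snd w) / D, (pdx g p * snd w - pdx h p * fst w) / D)" for w :: point
  have W: "open W" using g by (simp add: holo2_def)
  have "continuous_on W f"
    using holo2_imp_sep_holo[OF g] holo2_imp_sep_holo[OF h] by (auto simp: f_def sep_holo_def intro!: continuous_intros)
  moreover have "(f has_derivative f') (at p)"
    unfolding f_def f'_def using has_derivative_Pair[OF holo2_has_derivative[OF g p(1)] holo2_has_derivative[OF h p(1)]] .
  moreover have "bounded_linear g'"
    unfolding g'_def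
    by (intro bounded_linear_Pair bounded_linear_compose[OF bounded_linear_divide] bounded_linear_sub
      bounded_linear_const_mult bounded_linear_fst bounded_linear_snd)
  moreover have "f' \<circ> g' = id"
  proof
    fix w :: point
    have "pdx g p * ((pdy h p * fst w - pdy g p * snd w) / D) + pdy g p * ((pdx g p * snd w - pdx h p * fst w) / D) = (D * fst w) / D"
      unfolding times_divide_eq_right add_divide_distrib[symmetric] by (simp add: D_def algebra_simps)
    moreover have "pdx h p * ((pdy h p * fst w - pdy g p * snd w) / D) + pdy h p * ((pdx g p * snd w - pdx h p * fst w) / D) = (D * snd w) / D"
      unfolding times_divide_eq_right add_divide_distrib[symmetric] by (simp add: D_def algebra_simps)
    ultimately show "(f' \<circ> g') w = id w" using D by (simp add: f'_def g'_def prod_eq_iff)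
  qed
  ultimately have "f p \<in> interior (f ` W)"
    using sussmann_open_mapping[OF W _ p(1), of f f' g' W] W p(1) by (auto simp: interior_open)
  then have "(0, 0) \<in> interior (f ` W)" by (simp add: f_def p)
  then obtain d where d: "d > 0" "ball (0, 0) d \<subseteq> f ` W" by (auto simp: mem_interior)
  have "(of_real (d / 2), 0) \<in> ball ((0, 0) :: point) d"
    using d(1) by (simp add: dist_Pair_Pair)
  with d(2) have "(of_real (d / 2), 0) \<in> f ` W" by blast
  then obtain q where q: "q \<in> W" "f q = (of_real (d / 2), 0)" by auto
  then have "g q = of_real (d / 2)" "h q = 0" by (auto simp: f_def)
  with sub[OF q(1)] d(1) show False by auto
qed

lemma quad_kernel_product:
  "s\<^sup>2 = h \<Longrightarrow> form_disc (k + 2) (quad c a h * Q) = disc_const (k + 2) / (disc_const 2 * disc_const k) * (- 4 * h) * form_disc k Q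
      * (form_eval k Q (- (a + s), 1 - c * (a + s)) * form_eval k Q (- (a - s), 1 - c * (a - s)))\<^sup>2"
  if "degree Q \<le> k" "k \<ge> 1"
  using form_disc_mult_quadratic[OF that, of "a + s" "1 - c * (a + s)" "a - s" "1 - c * (a - s)"]
    form_disc_quad[of c a h] quad_eq_lform[of s h c a] by (simp add: lform_def)

text \<open>Off the discriminant the product formula makes the discriminant of \<open>\<omega>k\<close> times the squared
  resultant a unit; the zeros of the discriminant are reached by continuity.\<close>

lemma coprime_at_origin:
  fixes c :: complex
  assumes k: "k \<ge> 1" and p0: "p0 \<in> U"
    and w2: "web_on U 2 \<omega>2" and wk: "web_on U k \<omega>k"
    and div: "same_divisor U (web_disc 2 \<omega>2) (web_disc (k + 2) (\<omega>2 \<boxtimes> \<omega>k))"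
    and c: "form_eval 2 (\<omega>2 p0) (1, c) \<noteq> 0"
  obtains A H s where "\<omega>2 p0 = smult (form_eval 2 (\<omega>2 p0) (1, c)) (quad c A H)" "s\<^sup>2 = H"
    "form_disc k (\<omega>k p0) \<noteq> 0" "form_eval k (\<omega>k p0) (- (A + s), 1 - c * (A + s)) \<noteq> 0"
    "form_eval k (\<omega>k p0) (- (A - s), 1 - c * (A - s)) \<noteq> 0"
proof -
  define m where "m p = form_eval 2 (\<omega>2 p) (1, c)" for p
  define A where "A p = (coeff (\<omega>2 p) 1 + 2 * coeff (\<omega>2 p) 0 * c) / (2 * m p)" for p
  define H where "H p = (A p)\<^sup>2 - coeff (\<omega>2 p) 0 / m p" for p
  define G where "G p = form_eval k (\<omega>k p) (- (A p + csqrt (H p)), 1 - c * (A p + csqrt (H p))) *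
    form_eval k (\<omega>k p) (- (A p - csqrt (H p)), 1 - c * (A p - csqrt (H p)))" for p
  define K where "K = disc_const (k + 2) / (disc_const 2 * disc_const k)"
  obtain u where u: "unit_on U u" "\<And>p. p \<in> U \<Longrightarrow> web_disc 2 \<omega>2 p = u p * web_disc (k + 2) (\<omega>2 \<boxtimes> \<omega>k) p"
    using div by (auto simp: same_divisor_def)
  have U: "open U" using w2 by (simp add: web_on_def)
  have cf: "cdiff lin2 (\<lambda>p. coeff (\<omega>2 p) i) p" if "i \<le> 2" "p \<in> U" for i p
    using w2 that by (auto simp: web_on_def sform_on_def holo2_iff)
  have cfk: "cdiff lin2 (\<lambda>p. coeff (\<omega>k p) i) p" if "i \<le> k" "p \<in> U" for i p
    using wk that by (auto simp: web_on_def sform_on_def holo2_iff)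
  have deg: "degree (\<omega>2 p) \<le> 2" "degree (\<omega>k p) \<le> k" if "p \<in> U" for p
    using w2 wk that by (auto simp: web_on_def sform_on_def)
  have m: "cdiff lin2 m p" if "p \<in> U" for p unfolding m_def
    by (intro lin2.cdiff_form_eval cf that lin2.cdiff_const) auto
  define V where "V = {p\<in>U. m p \<noteq> 0}"
  have "continuous_on U m" using m lin2.cdiff_continuous by (auto intro: continuous_at_imp_continuous_on)
  from continuous_open_preimage[OF this U, of "- {0}"] have V: "open V" by (auto simp: V_def vimage_def Int_def)
  have pV: "p0 \<in> V" using p0 c by (simp add: V_def m_def)
  have A: "cdiff lin2 A p" and H: "cdiff lin2 H p" if "p \<in> V" for p
    using that unfolding A_def H_def V_def
    by (auto intro!: lin2.cdiff_divide lin2.cdiff_add lin2.cdiff_diff lin2.cdiff_power lin2.cdiff_mult lin2.cdiff_const cf m)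
  have w: "\<omega>2 p = smult (m p) (quad c (A p) (H p))" if "p \<in> V" for p
    unfolding A_def H_def m_def by (rule quadratic_eq_quad) (use that deg in \<open>auto simp: V_def m_def\<close>)
  \<comment> \<open>Both discriminants contain the factor
    \<open>(m p)\<^sup>2 * (- 4 * H p)\<close>, which cancels where
    \<open>H p \<noteq> 0\<close>.\<close>
  have main: "1 = u p * (m p) ^ (2 * k) * (K * form_disc k (\<omega>k p) * (G p)\<^sup>2)" if "p \<in> V" "H p \<noteq> 0" for p
  proof -
    have p: "p \<in> U" "m p \<noteq> 0" using that by (auto simp: V_def)
    have "web_disc 2 \<omega>2 p = (m p)\<^sup>2 * (- 4 * H p)"
      by (simp add: web_disc_def w[OF that(1)] form_disc_smult form_disc_quad)
    moreover have "web_disc (k + 2) (\<omega>2 \<boxtimes> \<omega>k) p = form_disc (k + 2) (smult (m p) (quad c (A p) (H p) * \<omega>k p))"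
      by (simp add: web_disc_def superpose_def w[OF that(1)])
    then have "web_disc (k + 2) (\<omega>2 \<boxtimes> \<omega>k) p = (m p) ^ (2 * (k + 2) - 2) * (K * (- 4 * H p) * form_disc k (\<omega>k p) * (G p)\<^sup>2)"
      unfolding form_disc_smult K_def G_def
      by (simp only: quad_kernel_product[OF deg(2)[OF p(1)] k, of "csqrt (H p)" "H p" c "A p", OF power2_csqrt])
    moreover have "(m p) ^ (2 * (k + 2) - 2) = (m p)\<^sup>2 * (m p) ^ (2 * k)"
      by (simp flip: power_add)
    ultimately have "(m p)\<^sup>2 * (- 4 * H p) * 1 = (m p)\<^sup>2 * (- 4 * H p) * (u p * (m p) ^ (2 * k) * (K * form_disc k (\<omega>k p) * (G p)\<^sup>2))"
      using u(2)[OF p(1)] by (simp only: mult_ac mult_1_left mult_1_right)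
    then show ?thesis using p that by (subst (asm) mult_cancel_left) auto
  qed
  have "1 = u p0 * (m p0) ^ (2 * k) * (K * form_disc k (\<omega>k p0) * (G p0)\<^sup>2)"
  proof (cases "H p0 = 0")
    case False
    with main pV show ?thesis by blast
  next
    case True
    define F where "F p = u p * (m p) ^ (2 * k) * (K * form_disc k (\<omega>k p) * (G p)\<^sup>2)" for p
    \<comment> \<open>The discriminant of \<open>\<omega>2\<close> vanishes on no nonempty open set,
      so points with \<open>H \<noteq> 0\<close> accumulate at \<open>p0\<close>.\<close>
    have HV: "\<exists>p\<in>S. H p \<noteq> 0" if "open S" "S \<noteq> {}" "S \<subseteq> V" for S
    proof -
      have "S \<subseteq> U" using that by (auto simp: V_def)
      then have "\<exists>p\<in>S. web_disc 2 \<omega>2 p \<noteq> 0" using w2 that unfolding web_on_def by blast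
      then obtain p where p: "p \<in> S" "web_disc 2 \<omega>2 p \<noteq> 0" by blast
      moreover have "web_disc 2 \<omega>2 p = (m p)\<^sup>2 * (- 4 * H p)"
      proof -
        have "p \<in> V" using p that by auto
        then show ?thesis by (simp add: web_disc_def w form_disc_smult form_disc_quad)
      qed
      ultimately show ?thesis by auto
    qed
    have isC: "isCont f p0" if "cdiff lin2 f p0" for f using lin2.cdiff_continuous[OF that] .
    \<comment> \<open>At a zero of \<open>H\<close> a square root is continuous for any choice of
      branches, because its modulus is the square root of \<open>norm (H p)\<close>.\<close>
    have sq: "isCont (\<lambda>p. csqrt (H p)) p0"
    proof -
      have "((\<lambda>p. sqrt (norm (H p))) \<longlongrightarrow> sqrt (norm (H p0))) (at p0)"
        using isC[OF H[OF pV]] by (intro tendsto_intros) (simp add: isCont_def)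
      then have "((\<lambda>p. norm (csqrt (H p))) \<longlongrightarrow> 0) (at p0)" using True by simp
      then have "((\<lambda>p. csqrt (H p)) \<longlongrightarrow> 0) (at p0)" by (rule tendsto_norm_zero_cancel)
      then show ?thesis using True by (simp add: isCont_def)
    qed
    have u2: "cdiff lin2 u p0" using u p0 by (auto simp: unit_on_def holo2_iff)
    have "isCont G p0" unfolding G_def form_eval_def fst_conv snd_conv
      by (intro continuous_intros sq isC A H pV cfk p0) auto
    moreover have "isCont (\<lambda>p. form_disc k (\<omega>k p)) p0"
    proof -
      have cc: "continuous_on U (\<lambda>p. coeff (\<omega>k p) i)" for i
      proof (cases "i \<le> k")
        case True
        then show ?thesis using cfk lin2.cdiff_continuous by (auto intro: continuous_at_imp_continuous_on)
      next
        case False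
        then have "coeff (\<omega>k p) i = 0" if "p \<in> U" for p using deg(2)[OF that] by (intro coeff_eq_0) auto
        then show ?thesis by (simp cong: continuous_on_cong_simp)
      qed
      have "continuous_on U (\<lambda>p. form_disc k (\<omega>k p))" by (rule continuous_on_form_disc[OF cc])
      then show ?thesis using U p0 by (simp add: continuous_on_eq_continuous_at)
    qed
    moreover have "isCont u p0" "isCont m p0" using u2 m[OF p0] isC by auto
    ultimately have F: "isCont F p0"
      unfolding F_def by (intro continuous_intros)
    show ?thesis
    proof (rule ccontr)
      assume "\<not> ?thesis"
      then have "F p0 \<noteq> 1" by (simp add: F_def)
      then have "\<forall>\<^sub>F p in nhds p0. F p \<noteq> 1"
        using F by (auto simp: isCont_def tendsto_at_iff_tendsto_nhds intro: tendsto_imp_eventually_ne)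
      then obtain S where S: "open S" "p0 \<in> S" "\<And>p. p \<in> S \<Longrightarrow> F p \<noteq> 1" by (auto simp: eventually_nhds)
      have "\<exists>p\<in>S \<inter> V. H p \<noteq> 0" by (rule HV) (use S V pV in auto)
      then obtain p where p: "p \<in> S" "p \<in> V" "H p \<noteq> 0" by blast
      from main[OF p(2,3)] S(3)[OF p(1)] show False by (simp add: F_def)
    qed
  qed
  then have "form_disc k (\<omega>k p0) \<noteq> 0" "G p0 \<noteq> 0" by auto
  with w[OF pV] show ?thesis
    by (intro that[of "A p0" "H p0" "csqrt (H p0)"]) (auto simp: m_def G_def)
qed

section \<open>Factorization into a quadratic and \<open>k\<close> linear factors\<close>

lemma (in complex_linear_maps) open_nonzero:
  assumes "open S" "\<And>z. z \<in> S \<Longrightarrow> cdiff C F z"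
  shows "open {z\<in>S. F z \<noteq> 0}"
proof -
  have "continuous_on S F" using assms(2) cdiff_continuous by (auto intro: continuous_at_imp_continuous_on)
  from continuous_open_preimage[OF this assms(1), of "- {0}"] show ?thesis
    by (simp add: vimage_def Int_def open_Compl)
qed

lemma form_eval_web_kernel:
  "form_eval (k + 2) (smult l (lform c u * lform c v * (\<Prod>i<k. lform c (t i)))) (- x, 1 - c * x)
    = l * ((u - x) * (v - x) * (\<Prod>i<k. t i - x))"
proof -
  have "degree (lform c u * lform c v) \<le> 2"
    by (simp add: lform_mult_eq_quad degree_quad)
  then have "form_eval (2 + k) (lform c u * lform c v * (\<Prod>i<k. lform c (t i))) (- x, 1 - c * x) =
     (u - x) * (v - x) * (\<Prod>i<k. t i - x)"
    by (subst form_eval_mult[OF _ degree_prod_lform])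
      (simp_all only: form_eval_quad_lform_kernel form_eval_prod_lform_kernel)
  then show ?thesis by (simp only: form_eval_smult add.commute[of 2])
qed

text \<open>The polynomial (u - X)(v - X) is monic, so its values at two points determine the sum of
  its roots and then their difference up to sign. These expressions can be holomorphic where
  \<open>u\<close> and \<open>v\<close> separately are not.\<close>

lemma quadratic_from_two_values:
  fixes u v x y :: complex
  assumes "x \<noteq> y"
  shows "(x\<^sup>2 - y\<^sup>2 - ((u - x) * (v - x) - (u - y) * (v - y))) / (2 * (x - y)) = (u + v) / 2"
    and "(x - (u + v) / 2)\<^sup>2 - (u - x) * (v - x) = ((u - v) / 2)\<^sup>2"
proof -
  have "x\<^sup>2 - y\<^sup>2 - ((u - x) * (v - x) - (u - y) * (v - y)) = (u + v) * (x - y)"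
    by (simp add: power2_eq_square algebra_simps)
  then show "(x\<^sup>2 - y\<^sup>2 - ((u - x) * (v - x) - (u - y) * (v - y))) / (2 * (x - y)) = (u + v) / 2"
    using assms by (simp only:) (rule mult_divide_mult_cancel_right, simp)
  show "(x - (u + v) / 2)\<^sup>2 - (u - x) * (v - x) = ((u - v) / 2)\<^sup>2"
    by (simp add: power2_eq_square field_simps)
qed

text \<open>Hensel's lemma for one double and \<open>k\<close> simple factors.  Only the simple roots need an implicit
  function argument: the quadratic cofactor is recovered from its values at two constants \<open>x\<close>, \<open>y\<close>.\<close>

lemma (in complex_linear_maps) holomorphic_factorization:
  fixes W :: "'a \<Rightarrow> complex poly" and c :: complex
  assumes S: "open S" "z0 \<in> S" and W: "\<And>z i. z \<in> S \<Longrightarrow> i \<le> k + 2 \<Longrightarrow> cdiff C (\<lambda>z. coeff (W z) i) z"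
    and deg: "\<And>z. z \<in> S \<Longrightarrow> degree (W z) \<le> k + 2"
    and W0: "W z0 = smult l0 (lform c u * lform c v * (\<Prod>i<k. lform c (\<tau> i)))" and l0: "l0 \<noteq> 0"
    and inj: "inj_on \<tau> {..<k}" and uv: "\<And>i. i < k \<Longrightarrow> \<tau> i \<noteq> u \<and> \<tau> i \<noteq> v"
  defines "l \<equiv> \<lambda>z. form_eval (k + 2) (W z) (1, c)"
  obtains T t a h r where "open T" "z0 \<in> T" "T \<subseteq> S"
    "\<And>i z. i < k \<Longrightarrow> z \<in> T \<Longrightarrow> cdiff C (t i) z" "\<And>z. z \<in> T \<Longrightarrow> cdiff C a z" "\<And>z. z \<in> T \<Longrightarrow> cdiff C h z"
    "\<And>z. z \<in> T \<Longrightarrow> l z \<noteq> 0"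
    "\<And>z. z \<in> T \<Longrightarrow> W z = smult (l z) (quad c (a z) (h z) * (\<Prod>i<k. lform c (t i z)))"
    "\<And>i j z. i < k \<Longrightarrow> j < k \<Longrightarrow> i \<noteq> j \<Longrightarrow> z \<in> T \<Longrightarrow> t i z \<noteq> t j z"
    "\<And>i z. i < k \<Longrightarrow> z \<in> T \<Longrightarrow> (t i z - a z)\<^sup>2 - h z \<noteq> 0"
    "\<And>i. i < k \<Longrightarrow> t i z0 = \<tau> i" "a z0 = (u + v) / 2" "h z0 = ((u - v) / 2)\<^sup>2"
    "\<And>i. i < k \<Longrightarrow> r i > 0"
    "\<And>i z x. i < k \<Longrightarrow> z \<in> T \<Longrightarrow> x \<in> ball (\<tau> i) (r i) \<Longrightarrow> form_eval (k + 2) (W z) (- x, 1 - c * x) = 0 \<Longrightarrow> x = t i z"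
proof -
  define P where "P z = hat c (k + 2) (W z)" for z
  have P: "cdiff C (\<lambda>z. coeff (P z) i) z" if "z \<in> S" for z i
    unfolding P_def by (intro cdiff_coeff_hat W that)
  have lz0: "l z0 = l0"
  proof -
    have "form_eval (2 + k) (quad c ((u + v) / 2) (((u - v) / 2)\<^sup>2) * (\<Prod>i<k. lform c (\<tau> i))) (1, c) = 1"
      by (subst form_eval_mult[OF degree_quad degree_prod_lform]) (simp add: form_eval_quad form_eval_prod_lform_base)
    then show ?thesis unfolding l_def W0 lform_mult_eq_quad form_eval_smult by (simp add: add.commute)
  qed
  have Pz0: "poly (P z0) x = l0 * ((u - x) * (v - x) * (\<Prod>i<k. \<tau> i - x))" for x
    unfolding P_def poly_hat W0 by (rule form_eval_web_kernel)
  have top: "coeff (P z0) (k + 2) \<noteq> 0"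
    unfolding P_def using deg[OF S(2)] l0 lz0 by (intro coeff_hat_top) (auto simp: l_def)
  have root: "\<exists>T r w. open T \<and> z0 \<in> T \<and> T \<subseteq> S \<and> r > 0 \<and> w z0 = \<tau> i \<and> (\<forall>z\<in>T. cdiff C w z) \<and>
      (\<forall>z\<in>T. poly (P z) (w z) = 0) \<and> (\<forall>z\<in>T. \<forall>x\<in>ball (\<tau> i) r. poly (P z) x = 0 \<longrightarrow> x = w z)"
    if i: "i < k" for i
  proof -
    \<comment> \<open>The cofactor of the root \<open>\<tau> i\<close>; up to sign its value there
      is the derivative of \<open>P z0\<close>, nonzero because \<open>\<tau> i\<close> differs from
      all other roots.\<close>
    define R where "R = smult l0 ([:u, -1:] * [:v, -1:] * (\<Prod>j\<in>{..<k} - {i}. [:\<tau> j, -1:]))"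
    have polyR: "poly R x = l0 * ((u - x) * (v - x) * (\<Prod>j\<in>{..<k} - {i}. \<tau> j - x))" for x
      unfolding R_def poly_smult poly_mult poly_prod by simp
    have "poly (P z0) x = poly ([:\<tau> i, -1:] * R) x" for x
      unfolding Pz0 poly_mult polyR using i by (simp add: prod.remove[of _ i])
    then have PR: "P z0 = [:\<tau> i, -1:] * R" by (simp only: poly_eq_poly_eq_iff[symmetric] ext)
    have "poly R (\<tau> i) \<noteq> 0"
      unfolding polyR using l0 uv[OF i] i inj by (auto simp: inj_on_def)
    moreover have "poly (pderiv (P z0)) (\<tau> i) = - poly R (\<tau> i)"
      unfolding PR pderiv_mult by (simp add: pderiv_pCons)
    ultimately have simple: "poly (pderiv (P z0)) (\<tau> i) \<noteq> 0" by simp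
    have "poly (P z0) (\<tau> i) = 0" unfolding PR by simp
    have degP: "\<And>z. degree (P z) \<le> k + 2" by (simp only: P_def degree_hat)
    show ?thesis
    proof (rule simple_root[where P = P and N = "k + 2" and S = S and ?z0.0 = z0 and ?w0.0 = "\<tau> i" and R = 1])
      show "open S" "z0 \<in> S" by (fact S)+
      show "cdiff C (\<lambda>z. coeff (P z) j) z" if "z \<in> S" for z j by (rule P[OF that])
      show "degree (P z) \<le> k + 2" for z by (rule degP)
      show "coeff (P z0) (k + 2) \<noteq> 0" by (rule top)
      show "poly (P z0) (\<tau> i) = 0" by fact
      show "poly (pderiv (P z0)) (\<tau> i) \<noteq> 0" by (rule simple)
      show "(0::real) < 1" by simp
    next
      fix T r w
      assume "open T" "z0 \<in> T" "T \<subseteq> S" "r > 0" "w z0 = \<tau> i" "\<And>z. z \<in> T \<Longrightarrow> cdiff C w z"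
        "\<And>z. z \<in> T \<Longrightarrow> poly (P z) (w z) = 0"
        "\<And>z x. z \<in> T \<Longrightarrow> x \<in> ball (\<tau> i) r \<Longrightarrow> poly (P z) x = 0 \<Longrightarrow> x = w z"
      then show ?thesis by (intro exI[of _ T] exI[of _ r] exI[of _ w]) simp
    qed
  qed
  define good where "good i T r w \<longleftrightarrow> open T \<and> z0 \<in> T \<and> T \<subseteq> S \<and> r > 0 \<and> w z0 = \<tau> i \<and> (\<forall>z\<in>T. cdiff C w z) \<and>
      (\<forall>z\<in>T. poly (P z) (w z) = 0) \<and> (\<forall>z\<in>T. \<forall>x\<in>ball (\<tau> i) r. poly (P z) x = 0 \<longrightarrow> x = w z)" for i T r w
  have "\<forall>i\<in>{..<k}. \<exists>x. case x of (T, r, w) \<Rightarrow> good i T r w"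
    using root unfolding good_def by auto
  from bchoice[OF this] obtain f where "\<forall>i\<in>{..<k}. case f i of (T, r, w) \<Rightarrow> good i T r w" by blast
  then have f: "case f i of (T, r, w) \<Rightarrow> good i T r w" if "i < k" for i using that by simp
  define T r t where "T i = fst (f i)" and "r i = fst (snd (f i))" and "t i = snd (snd (f i))" for i
  have g: "good i (T i) (r i) (t i)" if "i < k" for i
    using f[OF that] by (simp add: T_def r_def t_def case_prod_unfold)
  define T0 where "T0 = S \<inter> (\<Inter>i\<in>{..<k}. T i)"
  have T0: "open T0" "z0 \<in> T0" "T0 \<subseteq> S" "\<And>i. i < k \<Longrightarrow> T0 \<subseteq> T i"
    using S g by (auto simp: T0_def good_def intro!: open_Int open_INT)
  have t: "cdiff C (t i) z" "poly (P z) (t i z) = 0" if "i < k" "z \<in> T0" for i z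
    using g[OF that(1)] T0(4)[OF that(1)] that(2) by (auto simp: good_def)
  have t0: "t i z0 = \<tau> i" if "i < k" for i using g[OF that] by (simp add: good_def)
  \<comment> \<open>Two sample points away from all \<open>\<tau> i\<close>, so that near
    \<open>z0\<close> the quadratic cofactor can be evaluated at them by division.\<close>
  have "finite (\<tau> ` {..<k})" by simp
  then obtain x where x: "x \<notin> \<tau> ` {..<k}" using ex_new_if_finite[OF infinite_UNIV_char_0] by blast
  have "finite (insert x (\<tau> ` {..<k}))" by simp
  then obtain y where y: "y \<notin> insert x (\<tau> ` {..<k})" using ex_new_if_finite[OF infinite_UNIV_char_0] by blast
  have xy: "x \<noteq> y" using y by auto
  define F where "F z = l z * (\<Prod>i<k. (t i z - x) * (t i z - y)) * (\<Prod>i<k. \<Prod>j\<in>{..<k} - {i}. t i z - t j z)" for z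
  have l: "cdiff C l z" if "z \<in> S" for z
    unfolding l_def by (intro cdiff_form_eval W that cdiff_const)
  have F: "cdiff C F z" if "z \<in> T0" for z
    unfolding F_def using that T0 by (intro cdiff_mult cdiff_prod cdiff_diff cdiff_const l t) auto
  define T1 where "T1 = {z\<in>T0. F z \<noteq> 0}"
  have T1: "open T1" unfolding T1_def by (rule open_nonzero[OF T0(1) F])
  have "F z0 \<noteq> 0"
    unfolding F_def using l0 lz0 t0 x y inj by (auto simp: inj_on_def)
  then have z1: "z0 \<in> T1" using T0 by (simp add: T1_def)
  have nz: "l z \<noteq> 0" "i < k \<Longrightarrow> t i z \<noteq> x" "i < k \<Longrightarrow> t i z \<noteq> y"
    "i < k \<Longrightarrow> j < k \<Longrightarrow> i \<noteq> j \<Longrightarrow> t i z \<noteq> t j z" if "z \<in> T1" for i j z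
    using that by (auto simp: T1_def F_def)
  \<comment> \<open>The value of the quadratic cofactor at slope \<open>x\<close>, as a quotient of
    holomorphic functions.\<close>
  define q where "q x z = form_eval (k + 2) (W z) (- x, 1 - c * x) / (l z * (\<Prod>i<k. t i z - x))" for x z
  define a where "a z = (x\<^sup>2 - y\<^sup>2 - (q x z - q y z)) / (2 * (x - y))" for z
  define h where "h z = (x - a z)\<^sup>2 - q x z" for z
  have T1S: "T1 \<subseteq> T0" "T1 \<subseteq> S" using T0 by (auto simp: T1_def)
  have qd: "cdiff C (q x') z" if "z \<in> T1" "x' = x \<or> x' = y" for x' z
    unfolding q_def
  proof (intro cdiff_divide cdiff_form_eval cdiff_mult cdiff_prod cdiff_diff cdiff_const W l t)
    show "l z * (\<Prod>i<k. t i z - x') \<noteq> 0" using nz[OF that(1)] that(2) by auto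
  qed (use that T1S in auto)
  have a: "cdiff C a z" if "z \<in> T1" for z
    unfolding a_def using xy that by (intro cdiff_divide cdiff_diff cdiff_const qd) auto
  have h: "cdiff C h z" if "z \<in> T1" for z
    unfolding h_def using that by (intro cdiff_diff cdiff_power cdiff_const qd a) auto
  have val: "a z = (u' + v') / 2" "h z = ((u' - v') / 2)\<^sup>2"
    if "z \<in> T1" "W z = smult (l z) (lform c u' * lform c v' * (\<Prod>i<k. lform c (t i z)))" for z u' v'
  proof -
    have q: "q x' z = (u' - x') * (v' - x')" if "x' = x \<or> x' = y" for x'
    proof -
      have "l z * (\<Prod>i<k. t i z - x') \<noteq> 0" using nz[OF \<open>z \<in> T1\<close>] that by auto
      moreover have "form_eval (k + 2) (W z) (- x', 1 - c * x') = l z * ((u' - x') * (v' - x') * (\<Prod>i<k. t i z - x'))"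
        by (subst \<open>W z = _\<close>) (rule form_eval_web_kernel)
      ultimately show ?thesis by (simp add: q_def)
    qed
    have az: "a z = (u' + v') / 2"
      unfolding a_def q[OF disjI1[OF refl]] q[OF disjI2[OF refl]] by (rule quadratic_from_two_values(1)[OF xy])
    then show "a z = (u' + v') / 2" .
    show "h z = ((u' - v') / 2)\<^sup>2"
      unfolding h_def q[OF disjI1[OF refl]] az by (rule quadratic_from_two_values(2)[OF xy])
  qed
  have WT: "W z = smult (l z) (quad c (a z) (h z) * (\<Prod>i<k. lform c (t i z)))" if z: "z \<in> T1" for z
  proof -
    have inj: "inj_on (\<lambda>i. t i z) {..<k}" using nz(4)[OF z] by (auto simp: inj_on_def)
    have roots: "form_eval (k + 2) (W z) (- t i z, 1 - c * t i z) = 0" if "i < k" for i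
      using t(2)[OF that] z T1S by (auto simp: P_def poly_hat)
    have W2: "degree (W z) \<le> k + 2" "k + 2 \<ge> 1" "form_eval (k + 2) (W z) (1, c) \<noteq> 0"
      using deg[of z] z T1S nz(1)[OF z] by (auto simp: l_def)
    obtain \<rho> where "W z = smult (form_eval (k + 2) (W z) (1, c))
        ((\<Prod>i<2::nat. lform c (\<rho> i)) * (\<Prod>i<k. lform c (t i z)))"
      by (rule lform_factors_from_roots[OF W2 inj roots])
    then have \<rho>: "W z = smult (l z) ((\<Prod>i<2. lform c (\<rho> i)) * (\<Prod>i<k. lform c (t i z)))"
      by (simp add: l_def)
    have "(\<Prod>i<2::nat. lform c (\<rho> i)) = lform c (\<rho> 0) * lform c (\<rho> 1)" by (simp add: numeral_2_eq_2)
    with \<rho> have W1: "W z = smult (l z) (lform c (\<rho> 0) * lform c (\<rho> 1) * (\<Prod>i<k. lform c (t i z)))" by simp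
    show ?thesis unfolding val[OF z W1] lform_mult_eq_quad[symmetric] by (rule W1)
  qed
  have "W z0 = smult (l z0) (lform c u * lform c v * (\<Prod>i<k. lform c (t i z0)))"
    by (simp add: W0 lz0 t0)
  note ah0 = val[OF z1 this]
  define G where "G z = (\<Prod>i<k. (t i z - a z)\<^sup>2 - h z)" for z
  have G: "cdiff C G z" if "z \<in> T1" for z
    unfolding G_def using that T1S by (intro cdiff_prod cdiff_diff cdiff_power t a h) auto
  have "(\<tau> i - (u + v) / 2)\<^sup>2 - ((u - v) / 2)\<^sup>2 = (\<tau> i - u) * (\<tau> i - v)" for i
    by (simp add: power2_eq_square field_simps)
  then have "G z0 \<noteq> 0" using uv by (auto simp: G_def t0 ah0)
  define T2 where "T2 = {z\<in>T1. G z \<noteq> 0}"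
  have T2: "open T2" "z0 \<in> T2" "T2 \<subseteq> T1"
    using open_nonzero[OF T1 G] z1 \<open>G z0 \<noteq> 0\<close> by (auto simp: T2_def)
  show ?thesis
  proof (rule that[of T2 t a h r])
    show "T2 \<subseteq> S" using T2 T1S by auto
    show "cdiff C (t i) z" if "i < k" "z \<in> T2" for i z using t that T2 T1S by auto
    show "cdiff C a z" "cdiff C h z" "l z \<noteq> 0"
      "W z = smult (l z) (quad c (a z) (h z) * (\<Prod>i<k. lform c (t i z)))" if "z \<in> T2" for z
      using that T2 a h nz(1) WT by blast+
    show "t i z \<noteq> t j z" if "i < k" "j < k" "i \<noteq> j" "z \<in> T2" for i j z using nz(4) that T2 by blast
    show "(t i z - a z)\<^sup>2 - h z \<noteq> 0" if "i < k" "z \<in> T2" for i z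
      using that by (auto simp: T2_def G_def)
    show "r i > 0" if "i < k" for i using g[OF that] by (simp add: good_def)
    show "x' = t i z" if "i < k" "z \<in> T2" "x' \<in> ball (\<tau> i) (r i)" "form_eval (k + 2) (W z) (- x', 1 - c * x') = 0" for i z x'
    proof -
      have "z \<in> T i" using T0(4)[OF that(1)] T1S T2 that(2) by blast
      moreover have "poly (P z) x' = 0" using that(4) by (simp add: P_def poly_hat)
      ultimately show ?thesis using g[OF that(1)] that(3) unfolding good_def by blast
    qed
  qed (use T2 t0 ah0 in auto)
qed

lemma form_disc_2:
  assumes "degree P \<le> 2"
  shows "form_disc 2 P = 4 * coeff P 2 * coeff P 0 - (coeff P 1)\<^sup>2"
proof -
  obtain a b where P: "P = (\<Prod>i<2::nat. [:b i, a i:])" by (rule linear_factors[OF assms one_le_numeral])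
  have m2: "{..<2} - {0} = {Suc 0}" "{..<2} - {Suc 0} = {0::nat}" by auto
  have "form_disc 2 P = disc_const 2 * (\<Prod>i<2. \<Prod>j\<in>{..<2} - {i}. a i * b j - a j * b i)"
    unfolding P by (rule form_disc_linear_factors) simp
  also have "\<dots> = (a 0 * b 1 - a 1 * b 0) * (a 1 * b 0 - a 0 * b 1)"
    by (simp add: numeral_2_eq_2 m2[unfolded numeral_2_eq_2] disc_const_def)
  also have "\<dots> = 4 * coeff P 2 * coeff P 0 - (coeff P 1)\<^sup>2"
    unfolding P by (simp add: numeral_2_eq_2 power2_eq_square algebra_simps)
  finally show ?thesis .
qed

text \<open>The discriminant is quadratic in the coefficients, so its differential vanishes wherever
  the form does. A smooth discriminant thus excludes zeros of the form.\<close>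

lemma web_disc_2:
  assumes "web_on U 2 \<omega>"
  shows "holo2 (web_disc 2 \<omega>) U"
    and "p \<in> U \<Longrightarrow> \<omega> p = 0 \<Longrightarrow> pdx (web_disc 2 \<omega>) p = 0 \<and> pdy (web_disc 2 \<omega>) p = 0"
proof -
  have U: "open U" and cf: "\<And>i. i \<le> 2 \<Longrightarrow> holo2 (\<lambda>p. coeff (\<omega> p) i) U"
    and deg: "\<And>p. p \<in> U \<Longrightarrow> degree (\<omega> p) \<le> 2" using assms by (auto simp: web_on_def sform_on_def)
  let ?c = "\<lambda>i p. coeff (\<omega> p) i"
  have D: "web_disc 2 \<omega> p = 4 * ?c 2 p * ?c 0 p - ?c 1 p * ?c 1 p" if "p \<in> U" for p
    using form_disc_2[OF deg[OF that]] by (simp add: web_disc_def power2_eq_square)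
  show "holo2 (web_disc 2 \<omega>) U"
    unfolding holo2_iff
  proof (intro conjI U ballI)
    fix p assume p: "p \<in> U"
    have "cdiff lin2 (\<lambda>p. 4 * ?c 2 p * ?c 0 p - ?c 1 p * ?c 1 p) p"
      using cf p by (intro lin2.cdiff_diff lin2.cdiff_mult lin2.cdiff_const) (auto simp: holo2_iff)
    then show "cdiff lin2 (web_disc 2 \<omega>) p"
      by (rule lin2.cdiff_cong_open[OF _ U p]) (simp add: D)
  qed
  assume p: "p \<in> U" "\<omega> p = 0"
  have pd: "has_pd (?c i) (pdx (?c i) p) (pdy (?c i) p) p" if "i \<le> 2" for i
    using sep_holo_has_pd[OF holo2_imp_sep_holo[OF cf[OF that]] p(1)] .
  have "has_pd (\<lambda>p. 4 * ?c 2 p * ?c 0 p - ?c 1 p * ?c 1 p) 0 0 p"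
    using has_pd_diff[OF has_pd_mult[OF has_pd_mult[OF has_pd_const pd[of 2]] pd[of 0]] has_pd_mult[OF pd[of 1] pd[of 1]], of 4] p(2)
    by simp
  then have "has_pd (web_disc 2 \<omega>) 0 0 p"
    by (rule has_pd_cong_open[OF _ U p(1)]) (simp add: D)
  then show "pdx (web_disc 2 \<omega>) p = 0 \<and> pdy (web_disc 2 \<omega>) p = 0" by (auto dest: has_pdD)
qed

text \<open>Everything but \<open>- 4 * h\<close> is nonzero as long as \<open>l\<close>, the
  differences of the \<open>t i\<close> and the values of the quadratic factor at them are; so the
  discriminant is a unit times \<open>h\<close>.\<close>

lemma form_disc_web:
  assumes "k \<ge> 1"
  shows "form_disc (k + 2) (smult l (quad c a h * (\<Prod>i<k. lform c (t i)))) =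
    l ^ (2 * (k + 2) - 2) * (disc_const (k + 2) / (disc_const 2 * disc_const k) *
      (disc_const k * (\<Prod>i<k. \<Prod>j\<in>{..<k} - {i}. t j - t i)) * (\<Prod>i<k. (t i - a)\<^sup>2 - h)\<^sup>2) * (- 4 * h)"
proof -
  define s where "s = csqrt h"
  have s: "s\<^sup>2 = h" by (simp add: s_def)
  have "(\<Prod>i<k. t i - (a + s)) * (\<Prod>i<k. t i - (a - s)) = (\<Prod>i<k. (t i - a)\<^sup>2 - h)"
    unfolding prod.distrib[symmetric] by (intro prod.cong refl) (simp add: s[symmetric] power2_eq_square algebra_simps)
  then show ?thesis
    unfolding form_disc_smult quad_kernel_product[OF degree_prod_lform assms s] form_eval_prod_lform_kernel
      form_disc_prod_lform[OF assms] by (simp only: mult_ac)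
qed

lemma quad_nonzero: "quad c a h \<noteq> 0"
proof
  assume "quad c a h = 0"
  then have "form_eval 2 (quad c a h) (1, c) = 0" by (simp add: form_eval_def)
  then show False by (simp add: form_eval_quad)
qed

section \<open>Invariance of the discriminant\<close>

text \<open>Invariance is tested on every local equation \<open>g\<close> of the curve, not only on
  \<open>h\<close>. The differentials of \<open>g\<close> and \<open>h\<close> are parallel at the
  point and that of \<open>h\<close> is nonzero, so the condition passes from \<open>h\<close> to
  \<open>g\<close>.\<close>

lemma invariant_quad:
  fixes c :: complex
  assumes U: "open U" and h: "holo2 h U" and D: "\<And>p. p \<in> U \<Longrightarrow> D p = 0 \<longleftrightarrow> h p = 0"
    and Z: "\<And>p. p \<in> U \<Longrightarrow> h p = 0 \<Longrightarrow> a p * pdY c h p - pdy h p = 0 \<and> pdY c h p \<noteq> 0"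
  shows "invariant_divisor U 2 (\<lambda>p. quad c (a p) (h p)) D"
  unfolding invariant_divisor_def invariant_curve_def
proof (intro ballI allI impI)
  fix p V g
  assume p: "p \<in> {p\<in>U. D p = 0}"
    and "p \<in> V \<and> holo2 g V \<and> {p\<in>U. D p = 0} \<inter> V = {q\<in>V. g q = 0} \<and> (pdx g p \<noteq> 0 \<or> pdy g p \<noteq> 0)"
  then have V: "p \<in> V" "holo2 g V" "{p\<in>U. D p = 0} \<inter> V = {q\<in>V. g q = 0}" by auto
  have pU: "p \<in> U" "h p = 0" using p D[of p] by auto
  have "open (U \<inter> V)" using U V(2) by (auto simp: holo2_def)
  then have "holo2 g (U \<inter> V)" "holo2 h (U \<inter> V)" using V(2) h by (auto simp: holo2_def)
  moreover have "g p = 0" using V(1,3) p by auto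
  moreover have "g q = 0" if "q \<in> U \<inter> V" "h q = 0" for q using that V(3) D by blast
  ultimately have par: "pdx g p * pdy h p - pdy g p * pdx h p = 0"
    using parallel_differentials[of g "U \<inter> V" h p] pU V(1) by blast
  have hy: "pdy h p = a p * pdY c h p" and nz: "pdY c h p \<noteq> 0" using Z[OF pU] by auto
  have "(a p * pdY c g p - pdy g p) * pdY c h p = pdY c g p * pdy h p - pdy g p * pdY c h p"
    unfolding hy by (simp add: algebra_simps)
  also have "\<dots> = pdx g p * pdy h p - pdy g p * pdx h p" by (simp add: pdY_def algebra_simps)
  finally have Zg: "a p * pdY c g p - pdy g p = 0" using par nz by simp
  have "form_eval 2 (quad c (a p) (h p)) (- pdy g p, pdx g p) = (a p * pdY c g p - pdy g p)\<^sup>2"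
    unfolding form_eval_quad pU(2) by (simp add: pdY_def algebra_simps)
  with Zg show "form_eval 2 (quad c (a p) (h p)) (- pdy g p, pdx g p) = 0" by simp
qed

text \<open>By smoothness the discriminant itself, \<open>B h\<close> with
  \<open>B p \<noteq> 0\<close>, serves as local equation. As \<open>h p = 0\<close>, the quadratic
  form at \<open>p\<close> is a multiple of a square, and its vanishing on the tangent direction
  gives the equation; a zero of \<open>pdY c h\<close> would then make the discriminant
  singular.\<close>

lemma invariant_quad_converse:
  fixes c :: complex
  assumes w2: "web_on U 2 \<omega>2" and inv: "invariant_divisor U 2 \<omega>2 (web_disc 2 \<omega>2)"
    and smooth: "smooth_divisor U (web_disc 2 \<omega>2)"
    and T: "open T" "p \<in> T" "T \<subseteq> U" and w: "holo2 w T" "w p \<noteq> 0" and h: "holo2 h T" "h p = 0"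
    and eq: "\<And>q. q \<in> T \<Longrightarrow> \<omega>2 q = smult (w q) (quad c (a q) (h q))"
  shows "a p * pdY c h p - pdy h p = 0" "pdY c h p \<noteq> 0"
proof -
  let ?D = "web_disc 2 \<omega>2"
  define B where "B q = - 4 * (w q * w q)" for q
  have D: "?D q = B q * h q" if "q \<in> T" for q
    unfolding web_disc_def eq[OF that] form_disc_smult form_disc_quad by (simp add: B_def power2_eq_square)
  have Bp: "B p \<noteq> 0" using w by (simp add: B_def)
  have "has_pd w (pdx w p) (pdy w p) p" "has_pd h (pdx h p) (pdy h p) p"
    using sep_holo_has_pd holo2_imp_sep_holo w(1) h(1) T(2) by blast+
  note pd = this
  have "has_pd (\<lambda>q. B q * h q) (B p * pdx h p) (B p * pdy h p) p"
    unfolding B_def using has_pd_mult[OF has_pd_mult[OF has_pd_const has_pd_mult[OF pd(1) pd(1)]] pd(2), of "-4"] h(2)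
    by (simp add: mult.commute)
  then have "has_pd ?D (B p * pdx h p) (B p * pdy h p) p"
    by (rule has_pd_cong_open[OF _ T(1,2)]) (simp add: D)
  then have dD: "pdx ?D p = B p * pdx h p" "pdy ?D p = B p * pdy h p" by (auto dest: has_pdD)
  have pU: "p \<in> U" and Dp: "?D p = 0" using T D[OF T(2)] h(2) by auto
  have ne: "pdx ?D p \<noteq> 0 \<or> pdy ?D p \<noteq> 0" using smooth pU Dp by (auto simp: smooth_divisor_def)
  have "holo2 ?D U" using web_disc_2(1)[OF w2] .
  moreover have "{q\<in>U. ?D q = 0} \<inter> U = {q\<in>U. ?D q = 0}" by auto
  ultimately have "form_eval 2 (\<omega>2 p) (- pdy ?D p, pdx ?D p) = 0"
    using inv pU Dp ne unfolding invariant_divisor_def invariant_curve_def by blast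
  then have "w p * (B p * (a p * pdY c h p - pdy h p))\<^sup>2 = 0"
    unfolding eq[OF T(2)] form_eval_smult form_eval_quad dD h(2) by (simp add: pdY_def algebra_simps)
  with w Bp show Z: "a p * pdY c h p - pdy h p = 0" by simp
  show "pdY c h p \<noteq> 0"
  proof
    assume Y: "pdY c h p = 0"
    with Z have "pdy h p = 0" by simp
    moreover from this Y have "pdx h p = 0" by (simp add: pdY_def)
    ultimately show False using ne by (simp add: dD)
  qed
qed

text \<open>\<open>Z\<close> of the introduction is \<open>a Y h - \<partial>\<^sub>y h\<close>, and \<open>J\<close> is the sum that is assumed not to
  vanish.\<close>

lemma (in slopes_on) invariant_of_holomorphic_curvature:
  assumes k: "k \<ge> 1"
    and hol: "holo2 a U" "holo2 h U" "\<And>i. i < k \<Longrightarrow> holo2 (t i) U" "holo2 l U"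
    and W: "\<And>p. p \<in> U \<Longrightarrow> \<omega> p = smult (l p) (quad c (a p) (h p) * (\<Prod>i<k. lform c (t i p)))"
    and l: "\<And>p. p \<in> U \<Longrightarrow> l p \<noteq> 0"
    and U': "U \<subseteq> U'" and web: "web_on U' (k + 2) \<omega>" and curv: "holomorphic_curvature U' (k + 2) \<omega>"
    and J: "\<And>p. p \<in> U \<Longrightarrow> (\<Sum>i<k. (t i p * pdY c h p - pdy h p) / (t i p - a p)) \<noteq> 0"
    and p: "p \<in> U" "h p = 0"
  shows "a p * pdY c h p - pdy h p = 0 \<and> pdY c h p \<noteq> 0"
proof -
  obtain \<kappa> where \<kappa>: "holo2 \<kappa> U'" "is_curvature U' (k + 2) \<omega> \<kappa>" using curv by (auto simp: holomorphic_curvature_def)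
  have disc: "web_disc (k + 2) \<omega> p \<noteq> 0 \<longleftrightarrow> h p \<noteq> 0" if "p \<in> U" for p
    unfolding web_disc_def W[OF that] form_disc_web[OF k]
    using l[OF that] q_nz[OF _ that] t_ne[OF _ _ _ that] disc_const_nonzero k disc_const_nonzero[of 2] disc_const_nonzero[of "k + 2"]
    by (auto simp: q_def power2_eq_square)
  have id: "\<kappa> p * (h p)\<^sup>2 = h p * (pdY c M p - pdy N p) - (M p * pdY c h p - N p * pdy h p)"
    if "p \<in> U" "h p \<noteq> 0" for p
    by (rule curvature_identity[OF hol W _ U' \<kappa>(2) that]) (use disc in auto)
  have dense: "\<exists>p\<in>S. h p \<noteq> 0" if "open S" "S \<noteq> {}" "S \<subseteq> U" for S
  proof -
    have "\<exists>p\<in>S. web_disc (k + 2) \<omega> p \<noteq> 0" using web that U' unfolding web_on_def by blast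
    with disc that(3) show ?thesis by blast
  qed
  have "continuous_on U \<kappa>"
    using holo2_imp_sep_holo[OF \<kappa>(1)] U' by (auto simp: sep_holo_def intro: continuous_on_subset)
  from residue_vanishes[OF this dense id p]
  have Z: "a p * pdY c h p - pdy h p = 0" using J[OF p(1)] by simp
  moreover have "pdY c h p \<noteq> 0"
  proof
    assume "pdY c h p = 0"
    moreover from this Z have "pdy h p = 0" by simp
    ultimately show False using J[OF p(1)] by simp
  qed
  ultimately show ?thesis by blast
qed

section \<open>The deformation near the origin\<close>

theorem corollary1:
  fixes k :: nat and U :: "point set" and E :: "complex set"
    and \<omega>\<^sub>2 \<omega>\<^sub>k :: sform and \<Omega> :: "complex \<Rightarrow> sform"
  assumes "k \<ge> 1"
    and "(0, 0) \<in> U"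
    and "web_on U 2 \<omega>\<^sub>2" and "web_on U k \<omega>\<^sub>k" and "web_on U (k + 2) (\<omega>\<^sub>2 \<boxtimes> \<omega>\<^sub>k)"
    and "same_divisor U (web_disc 2 \<omega>\<^sub>2) (web_disc (k + 2) (\<omega>\<^sub>2 \<boxtimes> \<omega>\<^sub>k))"
    and "smooth_divisor U (web_disc 2 \<omega>\<^sub>2)"
    and "invariant_divisor U 2 \<omega>\<^sub>2 (web_disc 2 \<omega>\<^sub>2)"
    and "deformation_on E U (k + 2) \<Omega> (\<omega>\<^sub>2 \<boxtimes> \<omega>\<^sub>k)"
    and "\<forall>\<epsilon>\<in>E. holomorphic_curvature U (k + 2) (\<Omega> \<epsilon>)"
  shows "\<exists>E' U' \<Omega>\<^sub>2 \<Omega>\<^sub>k. E' \<subseteq> E \<and> U' \<subseteq> U \<and> (0, 0) \<in> U' \<and>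
    deformation_on E' U' 2 \<Omega>\<^sub>2 \<omega>\<^sub>2 \<and> deformation_on E' U' k \<Omega>\<^sub>k \<omega>\<^sub>k \<and>
    (\<forall>\<epsilon>\<in>E'. same_web U' (\<Omega> \<epsilon>) (\<Omega>\<^sub>2 \<epsilon> \<boxtimes> \<Omega>\<^sub>k \<epsilon>) \<and>
       same_divisor U' (web_disc 2 (\<Omega>\<^sub>2 \<epsilon>)) (web_disc (k + 2) (\<Omega> \<epsilon>)) \<and>
       invariant_divisor U' 2 (\<Omega>\<^sub>2 \<epsilon>) (web_disc 2 (\<Omega>\<^sub>2 \<epsilon>)))"
proof -
  note k = assms(1) and w2 = assms(3) and wk = assms(4)
  define p0 :: point where "p0 = (0, 0)"
  define z0 where "z0 = (0 :: complex, p0)"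
  have p0: "p0 \<in> U" using assms(2) by (simp add: p0_def)
  have U: "open U" using w2 by (simp add: web_on_def)
  have E: "open E" "0 \<in> E" and cf: "\<And>i. i \<le> k + 2 \<Longrightarrow> holo3 (\<lambda>z. coeff (\<Omega> (fst z) (snd z)) i) (E \<times> U)"
    and web\<Omega>: "\<And>\<epsilon>. \<epsilon> \<in> E \<Longrightarrow> web_on U (k + 2) (\<Omega> \<epsilon>)"
    using assms(9) by (auto simp: deformation_on_def)
  obtain v where v: "unit_on U v" "\<And>p. p \<in> U \<Longrightarrow> \<Omega> 0 p = smult (v p) (\<omega>\<^sub>2 p * \<omega>\<^sub>k p)"
    using assms(9) by (auto simp: deformation_on_def same_web_def superpose_def)
  have deg2: "degree (\<omega>\<^sub>2 p) \<le> 2" and degk: "degree (\<omega>\<^sub>k p) \<le> k" if "p \<in> U" for p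
    using w2 wk that by (auto simp: web_on_def sform_on_def)
  have "\<omega>\<^sub>2 p0 \<noteq> 0"
  proof
    \<comment> \<open>A zero of the quadratic form would be a singular zero of its discriminant,
      against smoothness.\<close>
    assume 0: "\<omega>\<^sub>2 p0 = 0"
    then have "web_disc 2 \<omega>\<^sub>2 p0 = 0" using form_disc_smult[of 2 0 0] by (simp add: web_disc_def)
    with assms(7) p0 web_disc_2(2)[OF w2 p0 0] show False by (auto simp: smooth_divisor_def)
  qed
  obtain c where c2: "form_eval 2 (\<omega>\<^sub>2 p0) (1, c) \<noteq> 0" and ck: "\<omega>\<^sub>k p0 \<noteq> 0 \<Longrightarrow> form_eval k (\<omega>\<^sub>k p0) (1, c) \<noteq> 0"
  proof -
    \<comment> \<open>The direction must suit both forms, but that \<open>\<omega>\<^sub>k\<close>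
      is nonzero at the origin only follows from coprimality, which is stated in terms of
      \<open>c\<close>. The default 1 avoids the circle.\<close>
    define P where "P = (if \<omega>\<^sub>k p0 = 0 then 1 else \<omega>\<^sub>k p0)"
    have P: "degree P \<le> k" "P \<noteq> 0" using degk[OF p0] by (auto simp: P_def)
    have "degree (\<omega>\<^sub>2 p0 * P) \<le> 2 + k" using degree_mult_le[of "\<omega>\<^sub>2 p0" P] P(1) deg2[OF p0] by linarith
    moreover have "\<omega>\<^sub>2 p0 * P \<noteq> 0" using P \<open>\<omega>\<^sub>2 p0 \<noteq> 0\<close> by simp
    ultimately obtain c where "form_eval (2 + k) (\<omega>\<^sub>2 p0 * P) (1, c) \<noteq> 0" using exists_nontangent_direction by metis
    then have "form_eval 2 (\<omega>\<^sub>2 p0) (1, c) \<noteq> 0" "form_eval k P (1, c) \<noteq> 0"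
      unfolding form_eval_mult[OF deg2[OF p0] P(1)] by auto
    then show ?thesis by (intro that[of c]) (auto simp: P_def)
  qed
  obtain A H s where A: "\<omega>\<^sub>2 p0 = smult (form_eval 2 (\<omega>\<^sub>2 p0) (1, c)) (quad c A H)" "s\<^sup>2 = H"
    "form_disc k (\<omega>\<^sub>k p0) \<noteq> 0" "form_eval k (\<omega>\<^sub>k p0) (- (A + s), 1 - c * (A + s)) \<noteq> 0"
    "form_eval k (\<omega>\<^sub>k p0) (- (A - s), 1 - c * (A - s)) \<noteq> 0"
    by (rule coprime_at_origin[OF k p0 w2 wk assms(6) c2])
  define lk where "lk p = form_eval k (\<omega>\<^sub>k p) (1, c)" for p
  have "\<omega>\<^sub>k p0 \<noteq> 0" using A(4) by (auto simp: form_eval_def)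
  then have lk0: "lk p0 \<noteq> 0" using ck by (simp add: lk_def)
  obtain \<tau> where \<tau>: "\<omega>\<^sub>k p0 = smult (lk p0) (\<Prod>i<k. lform c (\<tau> i))"
    using lform_factors[OF degk[OF p0] k] lk0 unfolding lk_def by metis
  have inj: "inj_on \<tau> {..<k}"
    using A(3) lk0 k unfolding \<tau> form_disc_smult form_disc_prod_lform[OF k] by (auto simp: inj_on_def)
  have uv: "\<tau> i \<noteq> A + s \<and> \<tau> i \<noteq> A - s" if "i < k" for i
    using A(4,5) that unfolding \<tau> form_eval_smult form_eval_prod_lform_kernel by auto
  define l0 where "l0 = v p0 * form_eval 2 (\<omega>\<^sub>2 p0) (1, c) * lk p0"
  have l0: "l0 \<noteq> 0" using v(1) p0 c2 lk0 by (auto simp: l0_def unit_on_def)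
  define W where "W z = \<Omega> (fst z) (snd z)" for z
  have Wz0: "W z0 = smult l0 (lform c (A + s) * lform c (A - s) * (\<Prod>i<k. lform c (\<tau> i)))"
  proof -
    define m where "m = form_eval 2 (\<omega>\<^sub>2 p0) (1, c)"
    have "W z0 = smult (v p0) (\<omega>\<^sub>2 p0 * \<omega>\<^sub>k p0)" using v(2)[OF p0] by (simp add: W_def z0_def)
    also have "\<omega>\<^sub>2 p0 = smult m (lform c (A + s) * lform c (A - s))"
      using A(1) unfolding quad_eq_lform[OF A(2)] m_def .
    finally show ?thesis unfolding \<tau> l0_def m_def[symmetric] by (simp add: mult_ac)
  qed
  define l where "l z = form_eval (k + 2) (W z) (1, c)" for z
  have S: "open (E \<times> U)" "z0 \<in> E \<times> U" using E U p0 by (auto simp: open_Times z0_def)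
  have Wcf: "cdiff lin3 (\<lambda>z. coeff (W z) i) z" if "z \<in> E \<times> U" "i \<le> k + 2" for z i
    using cf[OF that(2)] that(1) unfolding holo3_iff W_def by blast
  have Wdeg: "degree (W z) \<le> k + 2" if "z \<in> E \<times> U" for z
    using web\<Omega> that by (auto simp: W_def web_on_def sform_on_def)
  obtain T t a h r where T: "open T" "z0 \<in> T" "T \<subseteq> E \<times> U"
    and td: "\<And>i z. i < k \<Longrightarrow> z \<in> T \<Longrightarrow> cdiff lin3 (t i) z" and ad: "\<And>z. z \<in> T \<Longrightarrow> cdiff lin3 a z"
    and hd: "\<And>z. z \<in> T \<Longrightarrow> cdiff lin3 h z" and lnz: "\<And>z. z \<in> T \<Longrightarrow> form_eval (k + 2) (W z) (1, c) \<noteq> 0"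
    and WT: "\<And>z. z \<in> T \<Longrightarrow> W z = smult (form_eval (k + 2) (W z) (1, c)) (quad c (a z) (h z) * (\<Prod>i<k. lform c (t i z)))"
    and tne: "\<And>i j z. i < k \<Longrightarrow> j < k \<Longrightarrow> i \<noteq> j \<Longrightarrow> z \<in> T \<Longrightarrow> t i z \<noteq> t j z"
    and qne: "\<And>i z. i < k \<Longrightarrow> z \<in> T \<Longrightarrow> (t i z - a z)\<^sup>2 - h z \<noteq> 0"
    and t0: "\<And>i. i < k \<Longrightarrow> t i z0 = \<tau> i" and a0: "a z0 = ((A + s) + (A - s)) / 2" and h0: "h z0 = (((A + s) - (A - s)) / 2)\<^sup>2"
    and r: "\<And>i. i < k \<Longrightarrow> r i > 0"
    and uniq: "\<And>i z x. i < k \<Longrightarrow> z \<in> T \<Longrightarrow> x \<in> ball (\<tau> i) (r i) \<Longrightarrow> form_eval (k + 2) (W z) (- x, 1 - c * x) = 0 \<Longrightarrow> x = t i z"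
    by (rule lin3.holomorphic_factorization[OF S Wcf Wdeg Wz0 l0 inj uv]) (assumption | rule that)+
  note lnz = lnz[folded l_def] and WT = WT[folded l_def]
  have ld: "cdiff lin3 l z" if "z \<in> T" for z
    unfolding l_def using that T(3) by (intro lin3.cdiff_form_eval Wcf lin3.cdiff_const) auto

  \<comment> \<open>Near the origin the roots of \<open>\<omega>\<^sub>k\<close> are the \<open>t i\<close> at parameter \<open>0\<close>, by the uniqueness clause.\<close>
  have cfk: "cdiff lin2 (\<lambda>p. coeff (\<omega>\<^sub>k p) i) p" if "i \<le> k" "p \<in> U" for i p
    using wk that by (auto simp: web_on_def sform_on_def holo2_iff)
  have "\<forall>\<^sub>F p in nhds p0. \<exists>x\<in>ball (\<tau> i) (r i). poly (hat c k (\<omega>\<^sub>k p)) x = 0" if i: "i < k" for i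
  proof (rule poly_root_near[where N = k])
    show "isCont (\<lambda>p. coeff (hat c k (\<omega>\<^sub>k p)) j) p0" for j
      by (intro lin2.cdiff_continuous lin2.cdiff_coeff_hat cfk p0)
    show "coeff (hat c k (\<omega>\<^sub>k p0)) k \<noteq> 0" using coeff_hat_top[OF degk[OF p0] k] lk0 by (simp add: lk_def)
    show "poly (hat c k (\<omega>\<^sub>k p0)) (\<tau> i) = 0"
      unfolding poly_hat \<tau> form_eval_smult form_eval_prod_lform_kernel using i by auto
  qed (use degree_hat r i in auto)
  then have "\<forall>\<^sub>F p in nhds p0. \<forall>i\<in>{..<k}. \<exists>x\<in>ball (\<tau> i) (r i). poly (hat c k (\<omega>\<^sub>k p)) x = 0"
    by (subst eventually_ball_finite_distrib) auto
  then obtain U1 where U1: "open U1" "p0 \<in> U1"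
    "\<And>p i. p \<in> U1 \<Longrightarrow> i < k \<Longrightarrow> \<exists>x\<in>ball (\<tau> i) (r i). poly (hat c k (\<omega>\<^sub>k p)) x = 0"
    unfolding eventually_nhds by blast
  define T0 where "T0 = U1 \<inter> (\<lambda>p. (0, p)) -` T"
  have "open ((\<lambda>p. (0 :: complex, p)) -` T)" by (intro open_vimage T(1) continuous_intros)
  then have T0: "open T0" "p0 \<in> T0" using U1 T(2) by (auto simp: T0_def z0_def)
  have T0T: "(0, p) \<in> T" "p \<in> U" "p \<in> U1" if "p \<in> T0" for p using that T(3) by (auto simp: T0_def)
  have fact0: "\<omega>\<^sub>k p = smult (lk p) (\<Prod>i<k. lform c (t i (0, p)))" "lk p \<noteq> 0"
    "\<omega>\<^sub>2 p = smult (l (0, p) / (v p * lk p)) (quad c (a (0, p)) (h (0, p)))" if p: "p \<in> T0" for p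
  proof -
    note pT = T0T[OF p]
    have W0: "W (0, p) = smult (v p) (\<omega>\<^sub>2 p * \<omega>\<^sub>k p)" using v(2)[OF pT(2)] by (simp add: W_def)
    have ev: "form_eval (k + 2) (W (0, p)) w = v p * (form_eval 2 (\<omega>\<^sub>2 p) w * form_eval k (\<omega>\<^sub>k p) w)" for w
      unfolding W0 form_eval_smult using form_eval_mult[OF deg2[OF pT(2)] degk[OF pT(2)], of w] by (simp add: add.commute)
    have nz: "v p \<noteq> 0" "lk p \<noteq> 0" using lnz[OF pT(1)] unfolding l_def ev by (auto simp: lk_def)
    have root: "form_eval (k + 0) (\<omega>\<^sub>k p) (- t i (0, p), 1 - c * t i (0, p)) = 0" if i: "i < k" for i
    proof -
      obtain x where x: "x \<in> ball (\<tau> i) (r i)" "form_eval k (\<omega>\<^sub>k p) (- x, 1 - c * x) = 0"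
        using U1(3)[OF pT(3) i] unfolding poly_hat by blast
      have "form_eval (k + 2) (W (0, p)) (- x, 1 - c * x) = 0" unfolding ev x(2) by simp
      then have "x = t i (0, p)" by (rule uniq[OF i pT(1) x(1)])
      with x show ?thesis by simp
    qed
    have inj: "inj_on (\<lambda>i. t i (0, p)) {..<k}" using tne[OF _ _ _ pT(1)] by (auto simp: inj_on_def)
    have k0: "degree (\<omega>\<^sub>k p) \<le> k + 0" "k + 0 \<ge> 1" "form_eval (k + 0) (\<omega>\<^sub>k p) (1, c) \<noteq> 0"
      using degk[OF pT(2)] k nz by (auto simp: lk_def)
    obtain \<rho> where "\<omega>\<^sub>k p = smult (form_eval (k + 0) (\<omega>\<^sub>k p) (1, c))
        ((\<Prod>i<0::nat. lform c (\<rho> i)) * (\<Prod>i<k. lform c (t i (0, p))))"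
      by (rule lform_factors_from_roots[OF k0 inj root]) (assumption | rule that)+
    then show k': "\<omega>\<^sub>k p = smult (lk p) (\<Prod>i<k. lform c (t i (0, p)))" by (simp add: lk_def)
    show "lk p \<noteq> 0" by fact
    let ?Q = "\<Prod>i<k. lform c (t i (0, p))"
    \<comment> \<open>The linear factors on both sides agree, so they cancel and identify the
      quadratic factor at parameter 0 with \<open>\<omega>\<^sub>2\<close> up to a unit.\<close>
    have "?Q \<noteq> 0" by (simp add: lform_nonzero)
    have "smult (v p * lk p) (\<omega>\<^sub>2 p) * ?Q = smult (l (0, p)) (quad c (a (0, p)) (h (0, p))) * ?Q"
      using WT[OF pT(1)] unfolding W0 by (subst (asm) k') (simp add: mult_ac)
    then have "smult (v p * lk p) (\<omega>\<^sub>2 p) = smult (l (0, p)) (quad c (a (0, p)) (h (0, p)))"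
      by (rule mult_right_cancel[OF \<open>?Q \<noteq> 0\<close>, THEN iffD1])
    then have "smult (1 / (v p * lk p)) (smult (v p * lk p) (\<omega>\<^sub>2 p)) =
      smult (1 / (v p * lk p)) (smult (l (0, p)) (quad c (a (0, p)) (h (0, p))))" by simp
    then show "\<omega>\<^sub>2 p = smult (l (0, p) / (v p * lk p)) (quad c (a (0, p)) (h (0, p)))"
      using nz by simp
  qed
  have lk: "holo2 lk T0" using T0(1) T0T(2) cfk
    by (auto simp: holo2_iff lk_def[abs_def] intro!: lin2.cdiff_form_eval lin2.cdiff_const)
  have vd: "cdiff lin2 v p" "v p \<noteq> 0" if "p \<in> U" for p using v(1) that by (auto simp: unit_on_def holo2_iff)
  have slice: "cdiff lin2 (\<lambda>p. f (e, p)) p" if "cdiff lin3 f (e, p)" for f e p using cdiff_slice[OF that] .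

  define Yh where "Yh z = pdx (\<lambda>p. h (fst z, p)) (snd z) + c * pdy (\<lambda>p. h (fst z, p)) (snd z)" for z
  define hy where "hy z = pdy (\<lambda>p. h (fst z, p)) (snd z)" for z
  define J where "J z = (\<Sum>i<k. (t i z * Yh z - hy z) / (t i z - a z))" for z
  have "holo3 h T" using hd T(1) by (simp add: holo3_iff)
  from holo3_continuous_on_pd[OF this] have contY: "continuous_on T Yh" "continuous_on T hy"
    unfolding Yh_def hy_def by (auto intro!: continuous_intros)
  have contT: "continuous_on T f" if "\<And>z. z \<in> T \<Longrightarrow> cdiff lin3 f z" for f
    using that lin3.cdiff_continuous by (auto intro: continuous_at_imp_continuous_on)
  \<comment> \<open>If \<open>h z0 \<noteq> 0\<close>, the discriminant is empty near the origin for
    small parameters and invariance is vacuous. Otherwise \<open>J\<close> is nonzero at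
    \<open>z0\<close>, hence nearby.\<close>
  obtain T' where T': "open T'" "z0 \<in> T'" "T' \<subseteq> T"
    "(\<forall>z\<in>T'. h z \<noteq> 0) \<or> (\<forall>z\<in>T'. (\<forall>i<k. t i z \<noteq> a z) \<and> J z \<noteq> 0)"
  proof (cases "h z0 = 0")
    case False
    show ?thesis
      by (rule that[of "{z\<in>T. h z \<noteq> 0}"]) (use lin3.open_nonzero[OF T(1) hd] T(2) False in auto)
  next
    case True
    define G where "G z = (\<Prod>i<k. t i z - a z)" for z
    define T2 where "T2 = {z\<in>T. G z \<noteq> 0}"
    have T2: "open T2" unfolding T2_def G_def
      by (intro lin3.open_nonzero[OF T(1)] lin3.cdiff_prod lin3.cdiff_diff td ad) auto
    have G: "t i z \<noteq> a z" if "i < k" "z \<in> T2" for i z using that by (auto simp: T2_def G_def)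
    have z2: "z0 \<in> T2"
    proof -
      have "t i z0 \<noteq> a z0" if "i < k" for i using qne[OF that T(2)] True by auto
      with T(2) show ?thesis by (auto simp: T2_def G_def)
    qed
    have "T2 \<subseteq> T" by (auto simp: T2_def)
    then have "continuous_on T2 J" unfolding J_def
      by (intro continuous_intros continuous_on_subset[OF contY(1)] continuous_on_subset[OF contY(2)]
        continuous_on_subset[OF contT[OF td]] continuous_on_subset[OF contT[OF ad]]) (use G in auto)
    from continuous_open_preimage[OF this T2, of "- {0}"] have "open (T2 \<inter> J -` (- {0}))" by auto
    moreover have "J z0 \<noteq> 0"
    proof -
      define f where "f p = h (0, p)" for p
      have "holo2 (\<lambda>p. l (0, p) / (v p * lk p)) T0" unfolding holo2_iff
        using T0(1) T0T fact0(2) vd lk by (auto simp: holo2_iff intro!: lin2.cdiff_divide lin2.cdiff_mult slice[OF ld])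
      moreover have "holo2 f T0" unfolding holo2_iff f_def using T0(1) T0T by (auto intro!: slice[OF hd])
      moreover have "l (0, p0) / (v p0 * lk p0) \<noteq> 0" using lnz[OF T(2)] vd p0 lk0 by (simp add: z0_def)
      moreover have "T0 \<subseteq> U" using T0T(2) by blast
      moreover have "f p0 = 0" using True by (simp add: f_def z0_def)
      ultimately have "a (0, p0) * pdY c f p0 - pdy f p0 = 0" "pdY c f p0 \<noteq> 0"
        using invariant_quad_converse[OF w2 assms(8,7) T0(1,2), of "\<lambda>p. l (0, p) / (v p * lk p)" f c "\<lambda>p. a (0, p)"]
          fact0(3) by (auto simp: f_def)
      then have Z: "hy z0 = a z0 * Yh z0" and Y: "Yh z0 \<noteq> 0"
        by (simp_all add: hy_def Yh_def z0_def pdY_def f_def[abs_def])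
      \<comment> \<open>Invariance at parameter 0 turns each numerator into
        \<open>(t i - a) * Yh\<close>, so \<open>J\<close> is \<open>k * Yh\<close> at
        \<open>z0\<close>, nonzero because \<open>k \<ge> 1\<close>.\<close>
      have "J z0 = (\<Sum>i<k. Yh z0)"
        unfolding J_def Z
      proof (intro sum.cong refl)
        fix i assume "i \<in> {..<k}"
        then have "t i z0 - a z0 \<noteq> 0" using G z2 by auto
        then show "(t i z0 * Yh z0 - a z0 * Yh z0) / (t i z0 - a z0) = Yh z0"
          by (simp add: left_diff_distrib[symmetric])
      qed
      with Y k show ?thesis by simp
    qed
    ultimately show ?thesis
      by (intro that[of "T2 \<inter> J -` (- {0})"]) (use z2 G \<open>T2 \<subseteq> T\<close> in auto)
  qed
  \<comment> \<open>A product neighbourhood, so that one set of points serves all parameters in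
    \<open>E'\<close>.\<close>
  obtain E' V where EV: "open E'" "open V" "z0 \<in> E' \<times> V" "E' \<times> V \<subseteq> T'"
    by (rule open_prod_elim[OF T'(1,2)])
  define U' where "U' = V \<inter> T0"
  have U': "open U'" "p0 \<in> U'" "U' \<subseteq> U" "U' \<subseteq> T0" using EV T0 T0T(2) by (auto simp: U'_def z0_def)
  have inT': "(\<epsilon>, p) \<in> T'" and inT: "(\<epsilon>, p) \<in> T" if "\<epsilon> \<in> E'" "p \<in> U'" for \<epsilon> p
    using that EV(4) T'(3) by (auto simp: U'_def)
  have E': "0 \<in> E'" "E' \<subseteq> E" using EV(3) inT[OF _ U'(2)] T(3) by (auto simp: z0_def)
  define \<Omega>2 where "\<Omega>2 \<epsilon> p = quad c (a (\<epsilon>, p)) (h (\<epsilon>, p))" for \<epsilon> p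
  define \<Omega>k where "\<Omega>k \<epsilon> p = (\<Prod>i<k. lform c (t i (\<epsilon>, p)))" for \<epsilon> p
  have W': "\<Omega> \<epsilon> p = smult (l (\<epsilon>, p)) (\<Omega>2 \<epsilon> p * \<Omega>k \<epsilon> p)" if "\<epsilon> \<in> E'" "p \<in> U'" for \<epsilon> p
    using WT[OF inT[OF that]] by (simp add: W_def \<Omega>2_def \<Omega>k_def)
  have sl: "holo2 (\<lambda>p. f (\<epsilon>, p)) U'" if "\<And>z. z \<in> T \<Longrightarrow> cdiff lin3 f z" "\<epsilon> \<in> E'" for f \<epsilon>
    unfolding holo2_iff using U'(1) that inT by (auto intro!: slice)
  \<comment> \<open>The unit by which the discriminant of the deformed web differs from
    \<open>- 4 * h\<close>, the discriminant of its quadratic factor.\<close>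
  define X where "X \<epsilon> p = l (\<epsilon>, p) ^ (2 * (k + 2) - 2) * (disc_const (k + 2) / (disc_const 2 * disc_const k) *
      (disc_const k * (\<Prod>i<k. \<Prod>j\<in>{..<k} - {i}. t j (\<epsilon>, p) - t i (\<epsilon>, p))) * (\<Prod>i<k. (t i (\<epsilon>, p) - a (\<epsilon>, p))\<^sup>2 - h (\<epsilon>, p))\<^sup>2)" for \<epsilon> p
  have disc: "web_disc (k + 2) (\<Omega> \<epsilon>) p = X \<epsilon> p * (- 4 * h (\<epsilon>, p))" if "\<epsilon> \<in> E'" "p \<in> U'" for \<epsilon> p
    unfolding web_disc_def W'[OF that] \<Omega>2_def \<Omega>k_def form_disc_web[OF k] X_def ..
  have disc2: "web_disc 2 (\<Omega>2 \<epsilon>) p = - 4 * h (\<epsilon>, p)" for \<epsilon> p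
    by (simp add: web_disc_def \<Omega>2_def form_disc_quad)
  have Xnz: "X \<epsilon> p \<noteq> 0" if "\<epsilon> \<in> E'" "p \<in> U'" for \<epsilon> p
    using lnz[OF inT[OF that]] tne[OF _ _ _ inT[OF that]] qne[OF _ inT[OF that]] disc_const_nonzero[OF k]
      disc_const_nonzero[of 2] disc_const_nonzero[of "k + 2"]
    by (auto simp: X_def)
  have Xh: "holo2 (X \<epsilon>) U'" if e: "\<epsilon> \<in> E'" for \<epsilon>
    unfolding holo2_iff
  proof (intro conjI U'(1) ballI)
    fix p assume p: "p \<in> U'"
    note z = inT[OF e p]
    show "cdiff lin2 (X \<epsilon>) p"
      unfolding X_def[abs_def]
      by (intro lin2.cdiff_mult lin2.cdiff_power lin2.cdiff_const lin2.cdiff_prod lin2.cdiff_diff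
        slice[OF ld[OF z]] slice[OF td[OF _ z]] slice[OF ad[OF z]] slice[OF hd[OF z]]) auto
  qed
  have web2: "web_on U' 2 (\<Omega>2 \<epsilon>)" if e: "\<epsilon> \<in> E'" for \<epsilon>
    unfolding web_on_def sform_on_def
  proof (intro conjI ballI allI impI U'(1))
    show "degree (\<Omega>2 \<epsilon> p) \<le> 2" for p by (simp add: \<Omega>2_def degree_quad)
    show "holo2 (\<lambda>p. coeff (\<Omega>2 \<epsilon> p) i) U'" for i
      unfolding \<Omega>2_def by (rule sl[OF lin3.cdiff_coeff_quad[OF ad hd] e])
    show "\<forall>\<^sub>F q in at p. \<Omega>2 \<epsilon> q \<noteq> 0" for p by (simp add: \<Omega>2_def quad_nonzero)
    fix V assume V: "open V \<and> V \<noteq> {} \<and> V \<subseteq> U'"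
    then have "\<exists>p\<in>V. web_disc (k + 2) (\<Omega> \<epsilon>) p \<noteq> 0"
      using web\<Omega>[of \<epsilon>] e E'(2) U'(3) unfolding web_on_def by (meson order_trans subset_iff)
    then show "\<exists>p\<in>V. web_disc 2 (\<Omega>2 \<epsilon>) p \<noteq> 0"
      using disc[OF e] V unfolding disc2 by (metis mult_eq_0_iff subset_iff)
  qed
  have webk: "web_on U' k (\<Omega>k \<epsilon>)" if e: "\<epsilon> \<in> E'" for \<epsilon>
    unfolding web_on_def sform_on_def
  proof (intro conjI ballI allI impI U'(1))
    show "degree (\<Omega>k \<epsilon> p) \<le> k" for p by (simp add: \<Omega>k_def degree_prod_lform)
    show "holo2 (\<lambda>p. coeff (\<Omega>k \<epsilon> p) i) U'" for i
      unfolding \<Omega>k_def by (rule sl[OF lin3.cdiff_coeff_prod_lform[OF td] e])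
    show "\<forall>\<^sub>F q in at p. \<Omega>k \<epsilon> q \<noteq> 0" for p by (simp add: \<Omega>k_def lform_nonzero)
    fix V assume V: "open V \<and> V \<noteq> {} \<and> V \<subseteq> U'"
    then obtain p where p: "p \<in> V" "p \<in> U'" by blast
    have "web_disc k (\<Omega>k \<epsilon>) p \<noteq> 0"
      unfolding web_disc_def \<Omega>k_def form_disc_prod_lform[OF k]
      using disc_const_nonzero[OF k] tne[OF _ _ _ inT[OF e p(2)]] by auto
    with p show "\<exists>p\<in>V. web_disc k (\<Omega>k \<epsilon>) p \<noteq> 0" by blast
  qed
  have lkU: "cdiff lin2 lk p" "lk p \<noteq> 0" if "p \<in> U'" for p
    using lk fact0(2)[of p] U'(4) that by (auto simp: holo2_iff)
  have "deformation_on E' U' 2 \<Omega>2 \<omega>\<^sub>2"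
    unfolding deformation_on_def
  proof (intro conjI EV(1) E'(1) allI impI ballI)
    show "holo3 (\<lambda>z. coeff (\<Omega>2 (fst z) (snd z)) i) (E' \<times> U')" for i
      unfolding holo3_iff \<Omega>2_def prod.collapse
      using EV(1) U'(1) inT by (auto simp: open_Times intro!: lin3.cdiff_coeff_quad ad hd)
    show "same_web U' (\<Omega>2 0) \<omega>\<^sub>2"
      unfolding same_web_def
    proof (intro exI conjI ballI)
      show "unit_on U' (\<lambda>p. v p * lk p / l (0, p))"
        unfolding unit_on_def holo2_iff
        using U'(1,3) vd lkU lnz[OF inT[OF E'(1)]]
        by (auto intro!: lin2.cdiff_divide lin2.cdiff_mult slice[OF ld[OF inT[OF E'(1)]]])
      fix p assume p: "p \<in> U'"
      have nz: "v p \<noteq> 0" "lk p \<noteq> 0" "l (0, p) \<noteq> 0" using vd(2)[of p] lkU(2)[OF p] U'(3) p lnz[OF inT[OF E'(1) p]] by auto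
      have "\<omega>\<^sub>2 p = smult (l (0, p) / (v p * lk p)) (\<Omega>2 0 p)"
        using fact0(3)[of p] U'(4) p by (auto simp: \<Omega>2_def)
      then show "\<Omega>2 0 p = smult (v p * lk p / l (0, p)) (\<omega>\<^sub>2 p)" using nz by simp
    qed
  qed (rule web2)
  moreover have "deformation_on E' U' k \<Omega>k \<omega>\<^sub>k"
    unfolding deformation_on_def
  proof (intro conjI EV(1) E'(1) allI impI ballI)
    show "holo3 (\<lambda>z. coeff (\<Omega>k (fst z) (snd z)) i) (E' \<times> U')" for i
      unfolding holo3_iff \<Omega>k_def prod.collapse
      using EV(1) U'(1) inT by (auto simp: open_Times intro!: lin3.cdiff_coeff_prod_lform td)
    show "same_web U' (\<Omega>k 0) \<omega>\<^sub>k"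
      unfolding same_web_def
    proof (intro exI conjI ballI)
      show "unit_on U' (\<lambda>p. 1 / lk p)"
        unfolding unit_on_def holo2_iff using U'(1) lkU by (auto intro!: lin2.cdiff_divide lin2.cdiff_const)
      fix p assume p: "p \<in> U'"
      have "\<omega>\<^sub>k p = smult (lk p) (\<Omega>k 0 p)" using fact0(1)[of p] U'(4) p by (auto simp: \<Omega>k_def)
      then show "\<Omega>k 0 p = smult (1 / lk p) (\<omega>\<^sub>k p)" using lkU(2)[OF p] by simp
    qed
  qed (rule webk)
  moreover have "same_web U' (\<Omega> \<epsilon>) (\<Omega>2 \<epsilon> \<boxtimes> \<Omega>k \<epsilon>)" if e: "\<epsilon> \<in> E'" for \<epsilon>
    unfolding same_web_def
  proof (intro exI conjI ballI)
    show "unit_on U' (\<lambda>p. l (\<epsilon>, p))"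
      unfolding unit_on_def using sl[OF ld e] lnz[OF inT[OF e]] by auto
  qed (simp add: W'[OF e] superpose_def)
  moreover have "same_divisor U' (web_disc 2 (\<Omega>2 \<epsilon>)) (web_disc (k + 2) (\<Omega> \<epsilon>))" if e: "\<epsilon> \<in> E'" for \<epsilon>
    unfolding same_divisor_def
  proof (intro exI conjI ballI)
    show "unit_on U' (\<lambda>p. 1 / X \<epsilon> p)"
      unfolding unit_on_def holo2_iff using U'(1) Xh[OF e] Xnz[OF e]
      by (auto simp: holo2_iff intro!: lin2.cdiff_divide lin2.cdiff_const)
    show "web_disc 2 (\<Omega>2 \<epsilon>) p = 1 / X \<epsilon> p * web_disc (k + 2) (\<Omega> \<epsilon>) p" if "p \<in> U'" for p
      unfolding disc[OF e that] disc2 using Xnz[OF e that] by simp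
  qed
  moreover have "invariant_divisor U' 2 (\<Omega>2 \<epsilon>) (web_disc 2 (\<Omega>2 \<epsilon>))" if e: "\<epsilon> \<in> E'" for \<epsilon>
    unfolding \<Omega>2_def[abs_def]
  proof (rule invariant_quad[OF U'(1) sl[OF hd e]])
    show "web_disc 2 (\<lambda>p. quad c (a (\<epsilon>, p)) (h (\<epsilon>, p))) p = 0 \<longleftrightarrow> h (\<epsilon>, p) = 0" for p
      by (simp add: web_disc_def form_disc_quad)
    fix p assume p: "p \<in> U'" "h (\<epsilon>, p) = 0"
    \<comment> \<open>A zero of \<open>h\<close> in \<open>T'\<close> excludes the first
      alternative, so the second holds on all of \<open>T'\<close>.\<close>
    then have gJ: "t i z \<noteq> a z" "J z \<noteq> 0" if "i < k" "z \<in> T'" for i z using T'(4) inT'[OF e p(1)] that by auto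
    define h' where "h' p = h (\<epsilon>, p)" for p
    interpret slopes_on c k "\<lambda>p. a (\<epsilon>, p)" h' "\<lambda>i p. t i (\<epsilon>, p)" U'
    proof
      show "sep_holo (\<lambda>p. a (\<epsilon>, p)) U'" "sep_holo h' U'" "\<And>i. i < k \<Longrightarrow> sep_holo (\<lambda>p. t i (\<epsilon>, p)) U'"
        unfolding h'_def[abs_def] by (intro holo2_imp_sep_holo sl[OF _ e] ad hd td; assumption)+
      show "t i (\<epsilon>, p) \<noteq> a (\<epsilon>, p)" if "i < k" "p \<in> U'" for i p using gJ(1)[OF that(1) inT'[OF e that(2)]] .
      show "slopes.q (\<lambda>p. a (\<epsilon>, p)) h' (\<lambda>i p. t i (\<epsilon>, p)) i p \<noteq> 0" if "i < k" "p \<in> U'" for i p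
        using qne[OF that(1) inT[OF e that(2)]] by (simp add: slopes.q_def h'_def power2_eq_square)
      show "t i (\<epsilon>, p) \<noteq> t j (\<epsilon>, p)" if "i < k" "j < k" "i \<noteq> j" "p \<in> U'" for i j p
        using tne[OF that(1-3) inT[OF e that(4)]] .
    qed (rule U'(1))
    have "a (\<epsilon>, p) * pdY c h' p - pdy h' p = 0 \<and> pdY c h' p \<noteq> 0"
    proof (rule invariant_of_holomorphic_curvature[OF k, where l = "\<lambda>p. l (\<epsilon>, p)" and \<omega> = "\<Omega> \<epsilon>" and U' = U])
      show "holo2 (\<lambda>p. a (\<epsilon>, p)) U'" "holo2 h' U'" "\<And>i. i < k \<Longrightarrow> holo2 (\<lambda>p. t i (\<epsilon>, p)) U'" "holo2 (\<lambda>p. l (\<epsilon>, p)) U'"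
        unfolding h'_def[abs_def] by (intro sl[OF _ e] ad hd td ld; assumption)+
      show "\<Omega> \<epsilon> p = smult (l (\<epsilon>, p)) (quad c (a (\<epsilon>, p)) (h' p) * (\<Prod>i<k. lform c (t i (\<epsilon>, p))))" if "p \<in> U'" for p
        using W'[OF e that] by (simp add: \<Omega>2_def \<Omega>k_def h'_def)
      show "l (\<epsilon>, p) \<noteq> 0" if "p \<in> U'" for p using lnz[OF inT[OF e that]] .
      show "web_on U (k + 2) (\<Omega> \<epsilon>)" "holomorphic_curvature U (k + 2) (\<Omega> \<epsilon>)"
        using web\<Omega> assms(10) e E'(2) by auto
      show "(\<Sum>i<k. (t i (\<epsilon>, p) * pdY c h' p - pdy h' p) / (t i (\<epsilon>, p) - a (\<epsilon>, p))) \<noteq> 0" if "p \<in> U'" for p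
        using gJ(2)[of 0 "(\<epsilon>, p)"] k inT'[OF e that] by (simp add: J_def Yh_def hy_def pdY_def h'_def[abs_def])
    qed (use U'(3) p in \<open>auto simp: h'_def\<close>)
    then show "a (\<epsilon>, p) * pdY c (\<lambda>p. h (\<epsilon>, p)) p - pdy (\<lambda>p. h (\<epsilon>, p)) p = 0 \<and> pdY c (\<lambda>p. h (\<epsilon>, p)) p \<noteq> 0"
      by (simp add: h'_def[abs_def])
  qed
  ultimately show ?thesis
    using E'(2) U'(2,3) unfolding p0_def by (intro exI[of _ E'] exI[of _ U'] exI[of _ \<Omega>2] exI[of _ \<Omega>k]) blast
qed

end
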